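(* Let $N\ge 1$ be an integer and let $B\subset\mathbb{R}^N$ be an open ball of diameter $2$. Then $$\lambda_1(B)=\min\{\lambda_1(\Omega):\ \Omega\subset\mathbb{R}^N\text{ open},\ D(\Omega)=2\}.$$
   Context: $D(\Omega)=\sup_{x,y\in\Omega}|x-y|$ is the diameter of $\Omega$, and $\lambda_1(\Omega)$ is the first (smallest) eigenvalue of the Laplacian $-\Delta$ with Dirichlet boundary conditions on the bounded open set $\Omega$. *)

theory Defs
  imports "HOL-Analysis.Analysis"
begin

primrec C_k :: "nat \<Rightarrow> ('a::euclidean_space \<Rightarrow> real) \<Rightarrow> bool" where
  "C_k 0 f \<longleftrightarrow> continuous_on UNIV f"
| "C_k (Suc k) f \<longleftrightarrow>
     (\<forall>x. f differentiable (at x)) \<and> (\<forall>v. C_k k (\<lambda>x. frechet_derivative f (at x) v))"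

definition test_functions :: "'a::euclidean_space set \<Rightarrow> ('a \<Rightarrow> real) set" where
  "test_functions \<Omega> =
     {\<phi>. (\<forall>k. C_k k \<phi>) \<and> compact (closure {x. \<phi> x \<noteq> 0}) \<and> closure {x. \<phi> x \<noteq> 0} \<subseteq> \<Omega>}"

definition gradient :: "('a::euclidean_space \<Rightarrow> real) \<Rightarrow> 'a \<Rightarrow> 'a" where
  "gradient \<phi> x = (\<Sum>b\<in>Basis. frechet_derivative \<phi> (at x) b *\<^sub>R b)"

definition square_integrable_on :: "('a::euclidean_space \<Rightarrow> 'b::euclidean_space) \<Rightarrow> 'a set \<Rightarrow> bool" where
  "square_integrable_on f \<Omega> \<longleftrightarrow>
     set_borel_measurable lebesgue \<Omega> f \<and> set_integrable lebesgue \<Omega> (\<lambda>x. (norm (f x))\<^sup>2)"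

definition weak_gradient :: "'a::euclidean_space set \<Rightarrow> ('a \<Rightarrow> real) \<Rightarrow> ('a \<Rightarrow> 'a) \<Rightarrow> bool" where
  "weak_gradient \<Omega> u g \<longleftrightarrow>
     (\<forall>\<phi>\<in>test_functions \<Omega>. \<forall>b\<in>Basis.
        (LINT x:\<Omega>|lebesgue. u x * (gradient \<phi> x \<bullet> b)) =
          - (LINT x:\<Omega>|lebesgue. (g x \<bullet> b) * \<phi> x))"

text \<open>Elements of the Sobolev spaces are represented by functions on the whole space (whose
  values off \<open>\<Omega>\<close> are irrelevant), not by classes modulo null sets; the weak gradient \<open>g\<close>, unique
  up to null sets, is carried along as a second argument.\<close>

definition H1 :: "'a::euclidean_space set \<Rightarrow> ('a \<Rightarrow> real) \<Rightarrow> ('a \<Rightarrow> 'a) \<Rightarrow> bool" where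
  "H1 \<Omega> u g \<longleftrightarrow>
     square_integrable_on u \<Omega> \<and> square_integrable_on g \<Omega> \<and> weak_gradient \<Omega> u g"

text \<open>The closure of the test functions in the \<open>H\<^sup>1\<close> norm; membership in this space is the Dirichlet
  boundary condition, with no regularity of the boundary required.\<close>

definition H1_0 :: "'a::euclidean_space set \<Rightarrow> ('a \<Rightarrow> real) \<Rightarrow> ('a \<Rightarrow> 'a) \<Rightarrow> bool" where
  "H1_0 \<Omega> u g \<longleftrightarrow>
     H1 \<Omega> u g \<and>
     (\<exists>\<phi>. (\<forall>k::nat. \<phi> k \<in> test_functions \<Omega>) \<and>
        (\<lambda>k. (LINT x:\<Omega>|lebesgue. (u x - \<phi> k x)\<^sup>2)
            + (LINT x:\<Omega>|lebesgue. (norm (g x - gradient (\<phi> k) x))\<^sup>2)) \<longlonglongrightarrow> 0)"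

text \<open>The weak form of \<open>- \<Delta> u = l u\<close> in \<open>\<Omega>\<close>, \<open>u = 0\<close> on the boundary, \<open>u\<close> not identically zero.
  The operator is self-adjoint, so real eigenvalues and real eigenfunctions suffice.\<close>

definition dirichlet_eigenvalue :: "'a::euclidean_space set \<Rightarrow> real \<Rightarrow> bool" where
  "dirichlet_eigenvalue \<Omega> l \<longleftrightarrow>
     (\<exists>u g. H1_0 \<Omega> u g \<and> \<not> (AE x in lebesgue. x \<in> \<Omega> \<longrightarrow> u x = 0) \<and>
        (\<forall>v h. H1_0 \<Omega> v h \<longrightarrow>
           (LINT x:\<Omega>|lebesgue. g x \<bullet> h x) = l * (LINT x:\<Omega>|lebesgue. u x * v x)))"

definition lambda1 :: "'a::euclidean_space set \<Rightarrow> real" where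
  "lambda1 \<Omega> = (LEAST l. dirichlet_eigenvalue \<Omega> l)"

text \<open>The library's \<^const>\<open>diameter\<close> is a real number even for unbounded sets, where it is
  meaningless, so boundedness has to be stated next to \<open>diameter \<Omega> = 2\<close>.\<close>

definition open_sets_of_diameter :: "real \<Rightarrow> 'a::euclidean_space set set" where
  "open_sets_of_diameter d = {\<Omega>. open \<Omega> \<and> bounded \<Omega> \<and> diameter \<Omega> = d}"

definition is_minimum :: "'b::order set \<Rightarrow> 'b \<Rightarrow> bool" where
  "is_minimum S m \<longleftrightarrow> m \<in> S \<and> (\<forall>s\<in>S. m \<le> s)"

end

theory Submission
  imports Defs "HOL-Complex_Analysis.Great_Picard"
begin

text \<open>The first eigenvalue is the optimal constant in the Poincare inequality for test functions
  (Rellich compactness and the direct method), so it suffices to compare these constants. The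
  comparison uses neither the Faber--Krahn nor the isodiametric inequality. If \<open>\<psi>\<close> is radial with
  \<open>\<Delta> \<psi> = - \<mu> \<psi>\<close>, and positive on the closed unit ball, one runs a two-point maximum principle: the
  averages of a nonnegative \<open>u\<close> over the lattice neighbours, killed outside \<open>\<Omega>\<close>, preserve a bound
  \<open>u x * u y \<le> M (\<psi> ((x - y)/2))\<^sup>2\<close>, which makes sense because \<open>(x - y)/2\<close> lies in the unit ball whenever
  \<open>\<Omega>\<close> has diameter at most 2, while \<open>M\<close> shrinks at a rate given by \<open>\<mu>\<close>. Letting the mesh tend to 0
  yields the Poincare constant \<open>\<mu>\<close> for \<open>\<Omega>\<close>. Conversely, if \<open>\<psi>\<close> vanishes somewhere in the closed unit
  ball, then truncations of \<open>\<psi>\<close> show that the constant of the unit ball is at most \<open>\<mu>\<close>.\<close>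

section \<open>Square-integrable functions\<close>

text \<open>The two halves meet through a dichotomy in \<mu>. Normalise \<psi> to 1 at the origin.
  If \<mu> lies strictly below the constant of the unit ball, a first zero of \<psi> in the closed
  ball would be contradictory, so \<psi> is positive there and the two-point argument gives \<mu>
  for \<Omega>. The obstacle is that the boundary is arbitrary: an eigenfunction of \<Omega> offers
  no pointwise control for a maximum principle. Iterating a lattice operator on the modulus of a
  test function avoids this: killing outside \<Omega> only lowers a product of nonnegative values,
  and the initial bound follows from a positive lower bound of \<psi>. The two points move
  oppositely, x by e_i and y by -e_j, so that (x - y)/2 moves by (e_i + e_j)/2. The diagonal i = j
  then visits exactly the lattice neighbours of (x - y)/2 and sees the Laplacian of \<psi>. The
  other pairs sample midpoints, where the square of \<psi> differs from the product of the two end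
  values by O(h^2). The loss is quadratic in this error, so O(h^4), and is paid for by lowering
  \<mu> by \<epsilon>, which gains order h^2.\<close>

definition sqint :: "'x measure \<Rightarrow> ('x \<Rightarrow> 'b::euclidean_space) \<Rightarrow> bool" where
  "sqint M F \<longleftrightarrow> F \<in> borel_measurable M \<and> integrable M (\<lambda>x. (norm (F x))\<^sup>2)"

lemma sqint_inner:
  assumes "sqint M F" "sqint M G"
  shows "integrable M (\<lambda>x. F x \<bullet> G x)"
proof (rule Bochner_Integration.integrable_bound)
  show "integrable M (\<lambda>x. (norm (F x))\<^sup>2 + (norm (G x))\<^sup>2)"
    using assms by (simp add: sqint_def)
  show "(\<lambda>x. F x \<bullet> G x) \<in> borel_measurable M"
    using assms by (auto simp: sqint_def)
  show "AE x in M. norm (F x \<bullet> G x) \<le> norm ((norm (F x))\<^sup>2 + (norm (G x))\<^sup>2)"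
  proof (rule AE_I2)
    fix x
    have "\<bar>F x \<bullet> G x\<bar> \<le> norm (F x) * norm (G x)" by (rule Cauchy_Schwarz_ineq2)
    also have "\<dots> \<le> (norm (F x))\<^sup>2 + (norm (G x))\<^sup>2"
      using sum_squares_bound[of "norm (F x)" "norm (G x)"] mult_nonneg_nonneg[of "norm (F x)" "norm (G x)"]
        norm_ge_zero[of "F x"] norm_ge_zero[of "G x"] by linarith
    finally show "norm (F x \<bullet> G x) \<le> norm ((norm (F x))\<^sup>2 + (norm (G x))\<^sup>2)" by simp
  qed
qed

lemma sqint_scaleR: "sqint M F \<Longrightarrow> sqint M (\<lambda>x. c *\<^sub>R F x)"
  by (auto simp: sqint_def power_mult_distrib)

lemma sqint_add:
  assumes "sqint M F" "sqint M G"
  shows "sqint M (\<lambda>x. F x + G x)"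
proof -
  have "(\<lambda>x. (norm (F x + G x))\<^sup>2) = (\<lambda>x. (norm (F x))\<^sup>2 + 2 * (F x \<bullet> G x) + (norm (G x))\<^sup>2)"
    by (auto simp: power2_norm_eq_inner inner_add inner_commute)
  then show ?thesis using assms sqint_inner[OF assms] by (auto simp: sqint_def)
qed

lemma sqint_diff:
  assumes "sqint M F" "sqint M G"
  shows "sqint M (\<lambda>x. F x - G x)"
  using sqint_add[OF assms(1) sqint_scaleR[OF assms(2), of "-1"]] by simp

lemma integral_norm_add_squared:
  assumes "sqint M F" "sqint M G"
  shows "(\<integral>x. (norm (F x + t *\<^sub>R G x))\<^sup>2 \<partial>M)
    = (\<integral>x. (norm (F x))\<^sup>2 \<partial>M) + 2 * t * (\<integral>x. F x \<bullet> G x \<partial>M) + t\<^sup>2 * (\<integral>x. (norm (G x))\<^sup>2 \<partial>M)"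
proof -
  have "(\<lambda>x. (norm (F x + t *\<^sub>R G x))\<^sup>2)
    = (\<lambda>x. (norm (F x))\<^sup>2 + 2 * t * (F x \<bullet> G x) + t\<^sup>2 * (norm (G x))\<^sup>2)"
    unfolding power2_norm_eq_inner
    by (auto simp: inner_add_left inner_add_right inner_commute[of "G _" "F _"]
        power2_eq_square algebra_simps)
  then show ?thesis using assms sqint_inner[OF assms] by (simp add: sqint_def)
qed

text \<open>Serves twice: it gives Cauchy-Schwarz, and with \<open>a = 0\<close> it turns minimality
  of the Rayleigh quotient into a vanishing first variation. No sign of \<open>c\<close> is assumed,
  so \<open>c = 0\<close> and \<open>c < 0\<close> are treated separately before the minimum at t =
  -b/c is inserted.\<close>

lemma quadratic_nonneg_discriminant:
  fixes a b c :: real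
  assumes "\<And>t. 0 \<le> a + 2 * t * b + t\<^sup>2 * c"
  shows "b\<^sup>2 \<le> a * c"
proof (cases "c = 0")
  case True
  have "b = 0"
  proof (rule ccontr)
    assume "b \<noteq> 0"
    \<comment> \<open>With this \<open>t\<close> the expression equals -1.\<close>
    then show False using assms[of "- (a + 1) / (2 * b)"] True by (simp add: field_simps)
  qed
  then show ?thesis using True by simp
next
  case False
  have "0 \<le> c"
  proof (rule ccontr)
    assume "\<not> 0 \<le> c"
    have a: "0 \<le> a" using assms[of 0] by simp
    \<comment> \<open>Chosen so that t^2 (-c) exceeds 2 t b + a by at least 1.\<close>
    define t where "t = (\<bar>2 * b\<bar> + a + 1) / (-c) + 1"
    have t1: "t \<ge> 1" using \<open>\<not> 0 \<le> c\<close> a by (simp add: t_def divide_nonneg_neg)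
    have "t * (-c) = (\<bar>2 * b\<bar> + a + 1) - c" using \<open>\<not> 0 \<le> c\<close> by (simp add: t_def field_simps)
    then have "t * (t * (-c)) \<ge> t * (\<bar>2 * b\<bar> + a + 1)" using t1 \<open>\<not> 0 \<le> c\<close> by (intro mult_left_mono) auto
    moreover have "t * (2*b) \<le> t * \<bar>2*b\<bar>" using t1 by (intro mult_left_mono) auto
    moreover have "a + 1 \<le> t * (a + 1)" using t1 a by simp
    ultimately show False using assms[of t] by (simp add: power2_eq_square algebra_simps)
  qed
  with False have c: "c > 0" by simp
  have "0 \<le> a + 2 * (-b/c) * b + (-b/c)\<^sup>2 * c" by (rule assms)
  also have "\<dots> = a - b\<^sup>2/c" using c by (simp add: power2_eq_square field_simps)
  finally show ?thesis using c by (simp add: field_simps)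
qed

lemma integral_Cauchy_Schwarz:
  assumes "sqint M F" "sqint M G"
  shows "(\<integral>x. F x \<bullet> G x \<partial>M)\<^sup>2 \<le> (\<integral>x. (norm (F x))\<^sup>2 \<partial>M) * (\<integral>x. (norm (G x))\<^sup>2 \<partial>M)"
  by (rule quadratic_nonneg_discriminant)
     (simp add: integral_norm_add_squared[OF assms, symmetric])

lemma tendsto_integral_inner:
  assumes F: "\<And>k. sqint M (F k)" "sqint M F'" and G: "sqint M G"
    and lim: "(\<lambda>k::nat. \<integral>x. (norm (F k x - F' x))\<^sup>2 \<partial>M) \<longlonglongrightarrow> 0"
  shows "(\<lambda>k. \<integral>x. F k x \<bullet> G x \<partial>M) \<longlonglongrightarrow> (\<integral>x. F' x \<bullet> G x \<partial>M)"
proof -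
  have "(\<lambda>k. ((\<integral>x. F k x \<bullet> G x \<partial>M) - (\<integral>x. F' x \<bullet> G x \<partial>M))\<^sup>2) \<longlonglongrightarrow> 0"
  proof (rule Lim_null_comparison)
    show "(\<lambda>k. (\<integral>x. (norm (F k x - F' x))\<^sup>2 \<partial>M) * (\<integral>x. (norm (G x))\<^sup>2 \<partial>M)) \<longlonglongrightarrow> 0"
      using tendsto_mult_left_zero[OF lim] by blast
    show "\<forall>\<^sub>F k in sequentially. norm (((\<integral>x. F k x \<bullet> G x \<partial>M) - (\<integral>x. F' x \<bullet> G x \<partial>M))\<^sup>2)
      \<le> (\<integral>x. (norm (F k x - F' x))\<^sup>2 \<partial>M) * (\<integral>x. (norm (G x))\<^sup>2 \<partial>M)"
    proof (rule always_eventually, rule allI)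
      fix k
      have "(\<integral>x. F k x \<bullet> G x \<partial>M) - (\<integral>x. F' x \<bullet> G x \<partial>M) = (\<integral>x. (F k x - F' x) \<bullet> G x \<partial>M)"
        using sqint_inner[OF F(1) G] sqint_inner[OF F(2) G] by (simp add: inner_diff_left)
      then show "norm (((\<integral>x. F k x \<bullet> G x \<partial>M) - (\<integral>x. F' x \<bullet> G x \<partial>M))\<^sup>2)
        \<le> (\<integral>x. (norm (F k x - F' x))\<^sup>2 \<partial>M) * (\<integral>x. (norm (G x))\<^sup>2 \<partial>M)"
        using integral_Cauchy_Schwarz[OF sqint_diff[OF F(1) F(2)] G] by simp
    qed
  qed
  then show ?thesis
    by (simp add: LIM_zero_iff tendsto_null_power)
qed

lemma tendsto_integral_norm_squared:
  assumes F: "\<And>k. sqint M (F k)" "sqint M F'"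
    and lim: "(\<lambda>k::nat. \<integral>x. (norm (F k x - F' x))\<^sup>2 \<partial>M) \<longlonglongrightarrow> 0"
  shows "(\<lambda>k. \<integral>x. (norm (F k x))\<^sup>2 \<partial>M) \<longlonglongrightarrow> (\<integral>x. (norm (F' x))\<^sup>2 \<partial>M)"
proof -
  have eq: "(\<integral>x. (norm (F k x))\<^sup>2 \<partial>M) = (\<integral>x. (norm (F k x - F' x))\<^sup>2 \<partial>M)
     + 2 * (\<integral>x. F k x \<bullet> F' x \<partial>M) - (\<integral>x. (norm (F' x))\<^sup>2 \<partial>M)" for k
    using integral_norm_add_squared[OF F(1) F(2), of k "-1"] by simp
  have "(\<lambda>k. (\<integral>x. (norm (F k x - F' x))\<^sup>2 \<partial>M)
     + 2 * (\<integral>x. F k x \<bullet> F' x \<partial>M) - (\<integral>x. (norm (F' x))\<^sup>2 \<partial>M))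
     \<longlonglongrightarrow> 0 + 2 * (\<integral>x. F' x \<bullet> F' x \<partial>M) - (\<integral>x. (norm (F' x))\<^sup>2 \<partial>M)"
    by (intro tendsto_intros lim tendsto_integral_inner F)
  then show ?thesis unfolding eq by (simp add: power2_norm_eq_inner)
qed

section \<open>Completeness of the space of square-integrable functions\<close>

text \<open>The weights 2^k leave the integrals summable, being at most (1/4)^k. Almost everywhere
  the weighted squares are then summable, hence bounded, and the increments decay geometrically with
  ratio \<open>sqrt (1/2)\<close>.\<close>

lemma AE_Cauchy_of_summable_squares:
  fixes F :: "nat \<Rightarrow> 'x \<Rightarrow> 'b::euclidean_space"
  assumes F: "\<And>k. sqint M (F k)"
    and small: "\<And>k. (\<integral>x. (norm (F (Suc k) x - F k x))\<^sup>2 \<partial>M) \<le> (1/8)^k"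
  shows "AE x in M. convergent (\<lambda>k. F k x)"
proof -
  define d where "d k x = (norm (F (Suc k) x - F k x))\<^sup>2" for k x
  have [measurable]: "F k \<in> borel_measurable M" for k using F by (simp add: sqint_def)
  have [measurable]: "d k \<in> borel_measurable M" for k unfolding d_def by measurable
  have dint: "integrable M (d k)" for k
  proof -
    have "d k = (\<lambda>x. (norm (F (Suc k) x - F k x))\<^sup>2)" by (auto simp: d_def)
    then show ?thesis using sqint_diff[OF F[of "Suc k"] F[of k]] unfolding sqint_def by metis
  qed
  have "(\<integral>\<^sup>+x. (\<Sum>k. ennreal (2^k * d k x)) \<partial>M) = (\<Sum>k. \<integral>\<^sup>+x. ennreal (2^k * d k x) \<partial>M)"
    by (rule nn_integral_suminf) simp
  also have "\<dots> \<le> (\<Sum>k. ennreal ((1/4)^k))"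
  proof (intro suminf_le)
    fix k
    have "(\<integral>\<^sup>+x. ennreal (2^k * d k x) \<partial>M) = ennreal (\<integral>x. 2^k * d k x \<partial>M)"
      by (rule nn_integral_eq_integral[OF integrable_mult_right[OF dint]]) (simp add: d_def)
    also have "\<dots> \<le> ennreal (2^k * (1/8)^k)"
      using small[of k] by (intro ennreal_leI) (simp add: d_def)
    also have "(2::real)^k * (1/8)^k = (1/4)^k" by (simp flip: power_mult_distrib)
    finally show "(\<integral>\<^sup>+x. ennreal (2^k * d k x) \<partial>M) \<le> ennreal ((1/4)^k)" .
  qed auto
  also have "\<dots> = ennreal (\<Sum>k. (1/4::real)^k)"
    by (intro suminf_ennreal2 summable_geometric) auto
  also have "\<dots> < \<infinity>" by simp
  finally have "(\<integral>\<^sup>+x. (\<Sum>k. ennreal (2^k * d k x)) \<partial>M) \<noteq> \<infinity>" by simp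
  then have "AE x in M. (\<Sum>k. ennreal (2^k * d k x)) \<noteq> \<infinity>"
    by (intro nn_integral_PInf_AE) auto
  then show ?thesis
  proof (eventually_elim)
    case (elim x)
    have nn: "0 \<le> 2^k * d k x" for k by (simp add: d_def)
    have "summable (\<lambda>k. 2^k * d k x)"
      using elim nn by (intro summable_suminf_not_top) auto
    then obtain C where C: "\<And>k. norm (2^k * d k x) \<le> C"
      using summable_imp_Bseq[of "\<lambda>k. 2^k * d k x"] unfolding Bseq_def by blast
    have bd: "norm (F (Suc k) x - F k x) \<le> sqrt C * (sqrt (1/2))^k" for k
    proof -
      have "d k x \<le> C * (1/2)^k" using C[of k] nn[of k] by (simp add: field_simps)
      then have "sqrt (d k x) \<le> sqrt (C * (1/2)^k)" by simp
      then show ?thesis by (simp add: d_def real_sqrt_mult real_sqrt_power)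
    qed
    have "summable (\<lambda>k. F (Suc k) x - F k x)"
    proof (rule summable_comparison_test)
      show "\<exists>N. \<forall>k\<ge>N. norm (F (Suc k) x - F k x) \<le> sqrt C * (sqrt (1/2))^k" using bd by blast
      have "norm (sqrt (1/2)) < 1" by simp
      then show "summable (\<lambda>k. sqrt C * (sqrt (1/2))^k)"
        by (intro summable_mult summable_geometric)
    qed
    then have "convergent (\<lambda>n. \<Sum>k<n. F (Suc k) x - F k x)" by (simp add: summable_iff_convergent)
    then have "convergent (\<lambda>n. F n x - F 0 x)" by (simp add: sum_lessThan_telescope[of "\<lambda>k. F k x"])
    then have "convergent (\<lambda>n. (F n x - F 0 x) + F 0 x)" by (intro convergent_add convergent_const)
    then show ?case by simp
  qed
qed

text \<open>Riesz-Fischer: a fast subsequence converges almost everywhere, and Fatou's lemma along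
  it transfers the Cauchy bound to the distance from the limit, for the whole sequence at
  once.\<close>

lemma L2_complete:
  fixes F :: "nat \<Rightarrow> 'x \<Rightarrow> 'b::euclidean_space"
  assumes F: "\<And>k. sqint M (F k)"
    and Cauchy: "\<And>e. e > 0 \<Longrightarrow> \<exists>n. \<forall>j\<ge>n. \<forall>k\<ge>n. (\<integral>x. (norm (F j x - F k x))\<^sup>2 \<partial>M) < e"
  obtains G where "sqint M G" "(\<lambda>k. \<integral>x. (norm (F k x - G x))\<^sup>2 \<partial>M) \<longlonglongrightarrow> 0"
proof -
  have mF [measurable]: "F k \<in> borel_measurable M" for k using F by (simp add: sqint_def)
  have "\<forall>i. \<exists>n. \<forall>j\<ge>n. \<forall>k\<ge>n. (\<integral>x. (norm (F j x - F k x))\<^sup>2 \<partial>M) < (1/8)^i"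
    using Cauchy by simp
  then obtain n where n: "\<And>i j k. j \<ge> n i \<Longrightarrow> k \<ge> n i \<Longrightarrow> (\<integral>x. (norm (F j x - F k x))\<^sup>2 \<partial>M) < (1/8)^i"
    by metis
  \<comment> \<open>Summing the thresholds makes \<open>r\<close> monotone and \<open>r i\<close> at
    least \<open>n i\<close>; the summand \<open>i\<close> sends it to infinity.\<close>
  define r where "r i = (\<Sum>j\<le>i. n j) + i" for i
  have rn: "n i \<le> r i" "r i \<le> r (Suc i)" "i \<le> r i" for i
    unfolding r_def by (auto intro: member_le_sum le_trans[OF member_le_sum[of i "{..i}" n]])
  \<comment> \<open>The value 0 on the exceptional null set makes \<open>G\<close> measurable
    everywhere.\<close>
  define G where "G x = (if convergent (\<lambda>i. F (r i) x) then lim (\<lambda>i. F (r i) x) else 0)" for x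
  have mG [measurable]: "G \<in> borel_measurable M"
  proof -
    have "{x\<in>space M. convergent (\<lambda>i. F (r i) x)} \<in> sets M"
      by (simp add: convergent_eq_Cauchy Cauchy_convergent_iff[symmetric])
    then show ?thesis unfolding G_def[abs_def]
      by (intro measurable_If) (auto intro!: borel_measurable_lim_metric)
  qed
  have conv: "AE x in M. (\<lambda>i. F (r i) x) \<longlonglongrightarrow> G x"
  proof -
    have "AE x in M. convergent (\<lambda>i. F (r i) x)"
      by (rule AE_Cauchy_of_summable_squares[OF F])
         (intro less_imp_le n order_trans[OF rn(1) rn(2)] rn(1))
    then show ?thesis
      by eventually_elim (simp add: G_def convergent_LIMSEQ_iff)
  qed
  have fatou: "(\<integral>\<^sup>+x. ennreal ((norm (F k x - G x))\<^sup>2) \<partial>M) \<le> ennreal ((1/8)^i)" if k: "k \<ge> n i" for i k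
  proof -
    have "(\<integral>\<^sup>+x. ennreal ((norm (F k x - G x))\<^sup>2) \<partial>M)
      = (\<integral>\<^sup>+x. liminf (\<lambda>j. ennreal ((norm (F k x - F (r j) x))\<^sup>2)) \<partial>M)"
    proof (rule nn_integral_cong_AE, use conv in eventually_elim)
      case (elim x)
      have "(\<lambda>j. ennreal ((norm (F k x - F (r j) x))\<^sup>2)) \<longlonglongrightarrow> ennreal ((norm (F k x - G x))\<^sup>2)"
        by (intro tendsto_intros elim tendsto_ennrealI)
      then show ?case by (intro lim_imp_Liminf[symmetric]) auto
    qed
    also have "\<dots> \<le> liminf (\<lambda>j. \<integral>\<^sup>+x. ennreal ((norm (F k x - F (r j) x))\<^sup>2) \<partial>M)"
      by (rule nn_integral_liminf) measurable
    also have "\<dots> \<le> ennreal ((1/8)^i)"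
    proof (rule Liminf_le)
      have "(\<integral>\<^sup>+x. ennreal ((norm (F k x - F (r j) x))\<^sup>2) \<partial>M) \<le> ennreal ((1/8)^i)" if "j \<ge> n i" for j
      proof -
        have "(\<integral>\<^sup>+x. ennreal ((norm (F k x - F (r j) x))\<^sup>2) \<partial>M)
          = ennreal (\<integral>x. (norm (F k x - F (r j) x))\<^sup>2 \<partial>M)"
          by (rule nn_integral_eq_integral) (use sqint_diff[OF F F] in \<open>auto simp: sqint_def\<close>)
        also have "\<dots> \<le> ennreal ((1/8)^i)"
          using n[OF k, of "r j"] rn(3)[of j] that by (intro ennreal_leI) auto
        finally show ?thesis .
      qed
      then show "\<forall>\<^sub>F j in sequentially. (\<integral>\<^sup>+x. ennreal ((norm (F k x - F (r j) x))\<^sup>2) \<partial>M) \<le> ennreal ((1/8)^i)"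
        by (auto simp: eventually_sequentially)
    qed simp
    finally show ?thesis .
  qed
  \<comment> \<open>The Fatou bound is finite, so one difference is square-integrable, and with it
    \<open>G\<close>.\<close>
  have sq: "sqint M (\<lambda>x. F (n 0) x - G x)"
    using fatou[of 0 "n 0"] unfolding sqint_def
    by (auto intro!: integrableI_nonneg simp: top_unique intro: le_less_trans)
  have "sqint M G"
    using sqint_diff[OF F[of "n 0"] sq] by simp
  moreover have "(\<lambda>k. \<integral>x. (norm (F k x - G x))\<^sup>2 \<partial>M) \<longlonglongrightarrow> 0"
  proof (rule LIMSEQ_I)
    fix e :: real assume "e > 0"
    then obtain i where i: "(1/8::real)^i < e" using real_arch_pow_inv[of e "1/8"] by auto
    have "norm ((\<integral>x. (norm (F k x - G x))\<^sup>2 \<partial>M) - 0) < e" if "k \<ge> n i" for k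
    proof -
      have "ennreal (\<integral>x. (norm (F k x - G x))\<^sup>2 \<partial>M) = (\<integral>\<^sup>+x. ennreal ((norm (F k x - G x))\<^sup>2) \<partial>M)"
        by (rule nn_integral_eq_integral[symmetric])
           (use sqint_diff[OF F \<open>sqint M G\<close>] in \<open>auto simp: sqint_def\<close>)
      with fatou[OF that] have "ennreal (\<integral>x. (norm (F k x - G x))\<^sup>2 \<partial>M) \<le> ennreal ((1/8)^i)" by simp
      then have "(\<integral>x. (norm (F k x - G x))\<^sup>2 \<partial>M) \<le> (1/8)^i" by (subst (asm) ennreal_le_iff) auto
      then show ?thesis using i by simp
    qed
    then show "\<exists>no. \<forall>k\<ge>no. norm ((\<integral>x. (norm (F k x - G x))\<^sup>2 \<partial>M) - 0) < e" by blast
  qed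
  ultimately show ?thesis by (rule that)
qed

section \<open>Smooth functions\<close>

lemma C_k_SucD: "C_k (Suc k) f \<Longrightarrow> C_k k f"
proof (induction k arbitrary: f)
  case 0
  then show ?case
    by (simp add: continuous_at_imp_continuous_on differentiable_imp_continuous_within)
next
  case (Suc k)
  then show ?case by (metis C_k.simps(2))
qed

lemma C_k_SucI:
  assumes "\<And>x. (f has_derivative f' x) (at x)" "\<And>v. C_k k (\<lambda>x. f' x v)"
  shows "C_k (Suc k) f"
proof -
  have "frechet_derivative f (at x) = f' x" for x
    using frechet_derivative_at[OF assms(1)] by simp
  then show ?thesis using assms by (auto simp: differentiable_def)
qed

lemma C_k_Suc_derivative:
  assumes "C_k (Suc k) f"
  shows "\<exists>f'. (\<forall>x. (f has_derivative f' x) (at x)) \<and> (\<forall>v. C_k k (\<lambda>x. f' x v))"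
  using assms
  by (intro exI[of _ "\<lambda>x. frechet_derivative f (at x)"]) (auto simp: frechet_derivative_works)

lemma C_k_const: "C_k k (\<lambda>x. c)"
  by (induction k arbitrary: c) (auto intro!: C_k_SucI[of _ "\<lambda>_ _. 0"])

lemma C_k_linear:
  assumes "bounded_linear f"
  shows "C_k k f"
proof (cases k)
  case 0
  then show ?thesis using assms by (simp add: linear_continuous_on)
next
  case (Suc j)
  show ?thesis unfolding Suc
    by (rule C_k_SucI[of _ "\<lambda>_. f"]) (auto intro: bounded_linear_imp_has_derivative assms C_k_const)
qed

lemma C_k_add: "C_k k f \<Longrightarrow> C_k k g \<Longrightarrow> C_k k (\<lambda>x. f x + g x)"
proof (induction k arbitrary: f g)
  case 0
  then show ?case by (auto intro: continuous_intros)
next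
  case (Suc k)
  obtain f' where "\<And>x. (f has_derivative f' x) (at x)" "\<And>v. C_k k (\<lambda>x. f' x v)"
    using C_k_Suc_derivative[OF Suc.prems(1)] by blast
  moreover obtain g' where "\<And>x. (g has_derivative g' x) (at x)" "\<And>v. C_k k (\<lambda>x. g' x v)"
    using C_k_Suc_derivative[OF Suc.prems(2)] by blast
  ultimately show ?case
    by (intro C_k_SucI[of _ "\<lambda>x v. f' x v + g' x v"] Suc.IH has_derivative_add)
qed

lemma C_k_mult: "C_k k f \<Longrightarrow> C_k k g \<Longrightarrow> C_k k (\<lambda>x. f x * g x)"
proof (induction k arbitrary: f g)
  case 0
  then show ?case by (auto intro: continuous_intros)
next
  case (Suc k)
  obtain f' where "\<And>x. (f has_derivative f' x) (at x)" "\<And>v. C_k k (\<lambda>x. f' x v)"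
    using C_k_Suc_derivative[OF Suc.prems(1)] by blast
  moreover obtain g' where "\<And>x. (g has_derivative g' x) (at x)" "\<And>v. C_k k (\<lambda>x. g' x v)"
    using C_k_Suc_derivative[OF Suc.prems(2)] by blast
  moreover have "C_k k f" "C_k k g" using Suc.prems C_k_SucD by blast+
  ultimately show ?case
    by (intro C_k_SucI[of _ "\<lambda>x v. f x * g' x v + f' x v * g x"] C_k_add Suc.IH has_derivative_mult)
qed

lemma C_k_sum: "(\<And>i. i \<in> I \<Longrightarrow> C_k k (f i)) \<Longrightarrow> C_k k (\<lambda>x. \<Sum>i\<in>I. f i x)"
  by (induction I rule: infinite_finite_induct) (auto intro: C_k_const C_k_add)

lemma C_k_compose:
  fixes F :: "real \<Rightarrow> real"
  shows "C_k k F \<Longrightarrow> C_k k g \<Longrightarrow> C_k k (\<lambda>x. F (g x))"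
proof (induction k arbitrary: F)
  case 0
  then show ?case using continuous_on_compose2[of UNIV F UNIV g] by simp
next
  case (Suc k)
  obtain F' where F': "\<And>x. (F has_derivative F' x) (at x)" "\<And>v. C_k k (\<lambda>x. F' x v)"
    using C_k_Suc_derivative[OF Suc.prems(1)] by blast
  obtain g' where g': "\<And>x. (g has_derivative g' x) (at x)" "\<And>v. C_k k (\<lambda>x. g' x v)"
    using C_k_Suc_derivative[OF Suc.prems(2)] by blast
  show ?case
  proof (rule C_k_SucI[of _ "\<lambda>x v. g' x v * F' (g x) 1"])
    fix x
    interpret bounded_linear "F' (g x)" using F'(1) has_derivative_bounded_linear by blast
    have "((\<lambda>x. F (g x)) has_derivative (\<lambda>v. F' (g x) (g' x v))) (at x)"
      by (rule has_derivative_compose[OF g'(1) F'(1)])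
    moreover have "F' (g x) (g' x v) = g' x v * F' (g x) 1" for v
      by (rule scaleR[of "g' x v" 1, unfolded real_scaleR_def mult_1_right])
    ultimately show "((\<lambda>x. F (g x)) has_derivative (\<lambda>v. g' x v * F' (g x) 1)) (at x)"
      by (simp only:)
  next
    fix v
    have "C_k k (\<lambda>x. F' (g x) 1)"
      by (rule Suc.IH[OF F'(2)]) (rule C_k_SucD[OF Suc.prems(2)])
    then show "C_k k (\<lambda>x. g' x v * F' (g x) 1)"
      by (intro C_k_mult g'(2))
  qed
qed

text \<open>Smoothness is local, but \<open>C_k\<close> is a global recursion. The induction glues
  derivatives over the cover; on the overlap they agree by uniqueness of the derivative.\<close>

lemma C_k_local:
  assumes "open U" "open V" "U \<union> V = UNIV" "C_k k g" "C_k k h"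
    "\<And>x. x \<in> U \<Longrightarrow> f x = g x" "\<And>x. x \<in> V \<Longrightarrow> f x = h x"
  shows "C_k k f"
  using assms
proof (induction k arbitrary: f g h)
  case 0
  have "continuous_on U f" "continuous_on V f"
    using 0 by (auto intro: continuous_on_subset cong: continuous_on_cong)
  then show ?case using continuous_on_open_Un[of U V f] 0 by simp
next
  case (Suc k)
  obtain g' where g': "\<And>x. (g has_derivative g' x) (at x)" "\<And>v. C_k k (\<lambda>x. g' x v)"
    using C_k_Suc_derivative[OF Suc.prems(4)] by blast
  obtain h' where h': "\<And>x. (h has_derivative h' x) (at x)" "\<And>v. C_k k (\<lambda>x. h' x v)"
    using C_k_Suc_derivative[OF Suc.prems(5)] by blast
  have fU: "(f has_derivative g' x) (at x)" if "x \<in> U" for x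
    using has_derivative_transform_within_open[OF g'(1) Suc.prems(1) that, of f] Suc.prems(6) by simp
  have fV: "(f has_derivative h' x) (at x)" if "x \<in> V" for x
    using has_derivative_transform_within_open[OF h'(1) Suc.prems(2) that, of f] Suc.prems(7) by simp
  show ?case
  proof (rule C_k_SucI[of _ "\<lambda>x. if x \<in> U then g' x else h' x"])
    fix x show "(f has_derivative (if x \<in> U then g' x else h' x)) (at x)"
      using fU fV Suc.prems(3) by auto
  next
    fix v
    show "C_k k (\<lambda>x. (if x \<in> U then g' x else h' x) v)"
    proof (rule Suc.IH[OF Suc.prems(1-3) g'(2)[of v] h'(2)[of v]])
      fix x assume "x \<in> V"
      then show "(if x \<in> U then g' x else h' x) v = h' x v"
        using has_derivative_unique[OF fU fV] by (cases "x \<in> U") auto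
    qed auto
  qed
qed

section \<open>Functions flat at the origin\<close>

lemma C_k_real_SucI:
  fixes f :: "real \<Rightarrow> real"
  assumes "\<And>x. (f has_real_derivative f' x) (at x)" "C_k k f'"
  shows "C_k (Suc k) f"
  by (rule C_k_SucI[of _ "\<lambda>x v. f' x * v"])
     (use assms in \<open>auto simp: has_field_derivative_def intro: C_k_mult C_k_const\<close>)

text \<open>The classical function exp(-1/t), taken with all polynomial factors in 1/t because this
  family is closed under differentiation: \<open>p\<close> becomes X^2 (p - p'). Smoothness then
  follows by an induction that varies \<open>p\<close>.\<close>

definition flat :: "real poly \<Rightarrow> real \<Rightarrow> real" where
  "flat p t = (if t > 0 then poly p (1 / t) * exp (- 1 / t) else 0)"

lemma tendsto_poly_exp: "((\<lambda>x. poly p x * exp (- x)) \<longlongrightarrow> (0::real)) at_top"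
proof -
  have "((\<lambda>x. \<Sum>i\<le>degree p. coeff p i * (x ^ i / exp x)) \<longlongrightarrow> (\<Sum>i\<le>degree p. coeff p i * 0)) at_top"
    by (intro tendsto_intros tendsto_power_div_exp_0)
  then show ?thesis
    by (simp add: poly_altdef sum_distrib_right exp_minus divide_inverse mult.assoc)
qed

lemma flat_at_0: "((\<lambda>t. flat p t) \<longlongrightarrow> 0) (at 0)"
proof -
  have "(flat p \<longlongrightarrow> 0) (at_right 0)"
  proof (rule Lim_transform_eventually)
    show "((\<lambda>t. poly p (inverse t) * exp (- inverse t)) \<longlongrightarrow> 0) (at_right (0::real))"
      by (rule filterlim_compose[OF tendsto_poly_exp filterlim_inverse_at_top_right])
    show "\<forall>\<^sub>F t in at_right 0. poly p (inverse t) * exp (- inverse t) = flat p t"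
      by (auto simp: eventually_at_right_field flat_def inverse_eq_divide intro!: exI[of _ 1])
  qed
  moreover have "(flat p \<longlongrightarrow> 0) (at_left 0)"
    by (rule Lim_transform_eventually[OF tendsto_const])
       (auto simp: eventually_at_left_field flat_def intro!: exI[of _ "-1"])
  ultimately show ?thesis by (simp add: filterlim_split_at)
qed

lemma flat_has_derivative:
  "(flat p has_real_derivative flat (([:0,0,1:]) * (p - pderiv p)) t) (at t)"
proof (cases t "0::real" rule: linorder_cases)
  case less
  have "((\<lambda>_. 0) has_real_derivative 0) (at t)" by simp
  then have "(flat p has_real_derivative 0) (at t)"
    by (rule has_field_derivative_transform_within_open[of _ _ _ "{..<0}"]) (use less in \<open>auto simp: flat_def\<close>)
  then show ?thesis using less by (simp add: flat_def)
next
  case equal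
  have "((\<lambda>h. flat (pCons 0 p) h) \<longlongrightarrow> 0) (at 0)" by (rule flat_at_0)
  \<comment> \<open>Dividing by \<open>h\<close> multiplies the polynomial in 1/h by its variable,
    so the difference quotient at 0 is again a flat function.\<close>
  moreover have "flat (pCons 0 p) = (\<lambda>h. (flat p (0 + h) - flat p 0) / h)"
    by (auto simp: flat_def)
  ultimately have "(flat p has_real_derivative 0) (at 0)" unfolding DERIV_def by simp
  then show ?thesis using equal by (simp add: flat_def)
next
  case greater
  have "((\<lambda>t. poly p (1 / t) * exp (- 1 / t)) has_real_derivative
     (poly (pderiv p) (1/t) * (- 1 / t\<^sup>2)) * exp (- 1 / t) + exp (- 1 / t) * (1 / t\<^sup>2) * poly p (1/t)) (at t)"
    using greater
    by (auto intro!: derivative_eq_intros DERIV_chain2[OF poly_DERIV] simp: power2_eq_square)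
  also have "(poly (pderiv p) (1/t) * (- 1 / t\<^sup>2)) * exp (- 1 / t) + exp (- 1 / t) * (1 / t\<^sup>2) * poly p (1/t)
     = flat (([:0,0,1:]) * (p - pderiv p)) t"
    using greater by (simp add: flat_def power2_eq_square field_simps)
  finally show ?thesis
    by (rule has_field_derivative_transform_within_open[of _ _ _ "{0<..}"]) (use greater in \<open>auto simp: flat_def\<close>)
qed

lemma C_k_flat: "C_k k (flat p)"
proof (induction k arbitrary: p)
  case 0
  have "isCont (flat p) x" for x
    using DERIV_isCont flat_has_derivative by blast
  then show ?case by (simp add: continuous_at_imp_continuous_on)
next
  case (Suc k)
  then show ?case by (rule C_k_real_SucI[OF flat_has_derivative])
qed

lemma C_k_norm_squared: "C_k k (\<lambda>x. (norm (x - c))\<^sup>2)"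
proof -
  have "(\<lambda>x. (norm (x - c))\<^sup>2) = (\<lambda>x. \<Sum>b\<in>Basis. (x \<bullet> b + - (c \<bullet> b)) * (x \<bullet> b + - (c \<bullet> b)))"
    unfolding power2_norm_eq_inner
    by (subst euclidean_inner) (auto simp: inner_diff_left)
  moreover have "C_k k (\<lambda>x. x \<bullet> b)" for b :: 'a
    by (rule C_k_linear[OF bounded_linear_inner_left])
  ultimately show ?thesis
    by (simp only:) (intro C_k_sum C_k_mult C_k_add C_k_const)
qed

lemma gradient_eqI:
  assumes "(f has_derivative (\<lambda>v. g \<bullet> v)) (at x)"
  shows "gradient f x = g"
  using frechet_derivative_at[OF assms, symmetric] by (simp add: gradient_def euclidean_representation)

lemma gradient_has_derivative:
  assumes "f differentiable (at x)"
  shows "(f has_derivative (\<lambda>v. gradient f x \<bullet> v)) (at x)"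
proof -
  have d: "(f has_derivative frechet_derivative f (at x)) (at x)"
    using assms frechet_derivative_works by blast
  then interpret bounded_linear "frechet_derivative f (at x)"
    by (rule has_derivative_bounded_linear)
  have "frechet_derivative f (at x) v = gradient f x \<bullet> v" for v
  proof -
    have "frechet_derivative f (at x) v = frechet_derivative f (at x) (\<Sum>b\<in>Basis. (v \<bullet> b) *\<^sub>R b)"
      by (simp add: euclidean_representation)
    also have "\<dots> = (\<Sum>b\<in>Basis. frechet_derivative f (at x) b * (b \<bullet> v))"
      by (simp add: sum scaleR inner_commute mult.commute)
    also have "\<dots> = gradient f x \<bullet> v"
      by (simp add: gradient_def inner_sum_left)
    finally show ?thesis .
  qed
  then show ?thesis using d by (metis (no_types, lifting) ext)
qed

section \<open>Test functions\<close>

lemma test_functionsI: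
  assumes "\<And>k. C_k k f" "compact K" "K \<subseteq> \<Omega>" "\<And>x. x \<notin> K \<Longrightarrow> f x = 0"
  shows "f \<in> test_functions \<Omega>"
proof -
  have "closure {x. f x \<noteq> 0} \<subseteq> K"
    using assms(2,4) by (intro closure_minimal) (auto intro: compact_imp_closed)
  moreover from this have "compact (closure {x. f x \<noteq> 0})"
    using assms(2) by (metis closed_closure compact_Int_closed inf.absorb_iff2)
  ultimately show ?thesis using assms by (auto simp: test_functions_def)
qed

lemma test_functionsE:
  assumes "f \<in> test_functions \<Omega>"
  obtains K where "compact K" "K \<subseteq> \<Omega>" "\<And>x. x \<notin> K \<Longrightarrow> f x = 0" "\<And>x. x \<notin> K \<Longrightarrow> gradient f x = 0"
proof (rule that[of "closure {x. f x \<noteq> 0}"])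
  let ?K = "closure {x. f x \<noteq> 0}"
  show "compact ?K" "?K \<subseteq> \<Omega>" using assms by (auto simp: test_functions_def)
  show "f x = 0" if "x \<notin> ?K" for x
    using that closure_subset[of "{x. f x \<noteq> 0}"] by auto
  show "gradient f x = 0" if "x \<notin> ?K" for x
  proof (rule gradient_eqI)
    have "((\<lambda>_. 0) has_derivative (\<lambda>v. 0 \<bullet> v)) (at x)" by simp
    then show "(f has_derivative (\<lambda>v. 0 \<bullet> v)) (at x)"
      by (rule has_derivative_transform_within_open[of _ _ _ _ "- ?K"])
         (use that closure_subset[of "{x. f x \<noteq> 0}"] in auto)
  qed
qed

lemma test_functions_C_k: "f \<in> test_functions \<Omega> \<Longrightarrow> C_k k f"
  by (simp add: test_functions_def)

lemma test_functions_add: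
  assumes "f \<in> test_functions \<Omega>" "g \<in> test_functions \<Omega>"
  shows "(\<lambda>x. f x + g x) \<in> test_functions \<Omega>"
proof -
  obtain K where K: "compact K" "K \<subseteq> \<Omega>" "\<And>x. x \<notin> K \<Longrightarrow> f x = 0"
    by (rule test_functionsE[OF assms(1)]) blast
  obtain L where L: "compact L" "L \<subseteq> \<Omega>" "\<And>x. x \<notin> L \<Longrightarrow> g x = 0"
    by (rule test_functionsE[OF assms(2)]) blast
  show ?thesis
    by (rule test_functionsI[of _ "K \<union> L"]) (use K L assms in \<open>auto intro: C_k_add test_functions_C_k\<close>)
qed

lemma test_functions_mult:
  assumes "f \<in> test_functions \<Omega>" "\<And>k. C_k k g"
  shows "(\<lambda>x. f x * g x) \<in> test_functions \<Omega>"
proof -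
  obtain K where K: "compact K" "K \<subseteq> \<Omega>" "\<And>x. x \<notin> K \<Longrightarrow> f x = 0"
    by (rule test_functionsE[OF assms(1)]) blast
  show ?thesis
    by (rule test_functionsI[of _ K]) (use K assms in \<open>auto intro: C_k_mult test_functions_C_k\<close>)
qed

lemma test_functions_scale: "f \<in> test_functions \<Omega> \<Longrightarrow> (\<lambda>x. c * f x) \<in> test_functions \<Omega>"
  using test_functions_mult[OF _ C_k_const, of f \<Omega> c] by (simp add: mult.commute)

lemma test_functions_has_derivative:
  "f \<in> test_functions \<Omega> \<Longrightarrow> (f has_derivative (\<lambda>v. gradient f x \<bullet> v)) (at x)"
  using test_functions_C_k[of f \<Omega> "Suc 0"] by (auto intro: gradient_has_derivative)

lemma test_functions_continuous: "f \<in> test_functions \<Omega> \<Longrightarrow> continuous_on UNIV f"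
  using test_functions_C_k[of f \<Omega> 0] by simp

lemma gradient_continuous: "f \<in> test_functions \<Omega> \<Longrightarrow> continuous_on UNIV (gradient f)"
  using test_functions_C_k[of f \<Omega> "Suc 0"]
  unfolding gradient_def[abs_def] by (auto intro!: continuous_intros)

lemma gradient_add:
  assumes "f \<in> test_functions \<Omega>" "g \<in> test_functions \<Omega>"
  shows "gradient (\<lambda>x. f x + g x) x = gradient f x + gradient g x"
  using has_derivative_add[OF assms[THEN test_functions_has_derivative, of x]]
  by (intro gradient_eqI) (simp add: inner_add_left)

lemma gradient_scale:
  assumes "f \<in> test_functions \<Omega>"
  shows "gradient (\<lambda>x. c * f x) x = c *\<^sub>R gradient f x"
  using has_derivative_mult_right[OF test_functions_has_derivative[OF assms, of x], of c]
  by (intro gradient_eqI) simp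

section \<open>Translations, difference quotients and integration by parts\<close>

lemma integrable_compact_support:
  fixes f :: "'a::euclidean_space \<Rightarrow> 'b::{banach, second_countable_topology}"
  assumes "continuous_on UNIV f" "compact K" "\<And>x. x \<notin> K \<Longrightarrow> f x = 0"
  shows "integrable lborel f"
proof -
  have "integrable lborel (\<lambda>x. indicator K x *\<^sub>R f x)"
    using borel_integrable_compact[OF assms(2), of f] continuous_on_subset[OF assms(1)]
    by (simp add: set_integrable_def)
  moreover have "(\<lambda>x. indicator K x *\<^sub>R f x) = f"
    using assms(3) by (auto simp: indicator_def)
  ultimately show ?thesis by simp
qed

lemma lborel_integral_translate:
  fixes f :: "'a::euclidean_space \<Rightarrow> 'b::{banach, second_countable_topology}"
  assumes "f \<in> borel_measurable borel"
  shows "(LBINT x. f (x + c)) = (LBINT x. f x)"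
proof -
  have "(LBINT x. f x) = (\<integral>x. f x \<partial>distr lborel borel ((+) c))"
    by (simp add: lborel_distr_plus)
  also have "\<dots> = (LBINT x. f (c + x))"
    using assms by (intro integral_distr) auto
  finally show ?thesis by (simp add: add.commute)
qed

lemma lborel_integrable_translate:
  fixes f :: "'a::euclidean_space \<Rightarrow> 'b::{banach, second_countable_topology}"
  assumes "integrable lborel f"
  shows "integrable lborel (\<lambda>x. f (x + c))"
proof -
  have "integrable (distr lborel borel ((+) c)) f"
    using assms by (simp add: lborel_distr_plus)
  then have "integrable lborel (\<lambda>x. f (c + x))"
    using assms by (subst (asm) integrable_distr_eq) auto
  then show ?thesis by (simp add: add.commute)
qed

lemma difference_quotient_tendsto:
  assumes "f \<in> test_functions \<Omega>" "t \<longlonglongrightarrow> 0" "\<And>n::nat. t n \<noteq> 0"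
  shows "(\<lambda>n. (f (x + t n *\<^sub>R y) - f x) / t n) \<longlonglongrightarrow> gradient f x \<bullet> y"
proof -
  have "((\<lambda>s. x + s *\<^sub>R y) has_derivative (\<lambda>s. s *\<^sub>R y)) (at 0)"
    by (auto intro!: derivative_eq_intros)
  then have "((\<lambda>s. f (x + s *\<^sub>R y)) has_derivative (\<lambda>s. gradient f x \<bullet> (s *\<^sub>R y))) (at 0)"
    by (rule has_derivative_compose) (use test_functions_has_derivative[OF assms(1)] in simp)
  then have "((\<lambda>s. f (x + s *\<^sub>R y)) has_real_derivative (gradient f x \<bullet> y)) (at 0)"
    unfolding has_field_derivative_def by (rule has_derivative_eq_rhs) auto
  then have "((\<lambda>h. (f (x + h *\<^sub>R y) - f x) / h) \<longlongrightarrow> gradient f x \<bullet> y) (at 0)"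
    by (simp add: DERIV_def)
  moreover have "filterlim t (at 0) sequentially"
    using assms(2,3) by (simp add: filterlim_at)
  ultimately show ?thesis by (rule filterlim_compose)
qed

text \<open>Provides the dominating function: a Lipschitz constant on a ball that contains the
  support enlarged by \<open>norm y\<close>. At \<open>t = 0\<close> division by zero makes the
  quotient 0.\<close>

lemma difference_quotient_bound:
  assumes f: "f \<in> test_functions \<Omega>"
  obtains L R where "0 \<le> L"
    "\<And>x t. \<bar>t\<bar> \<le> 1 \<Longrightarrow> \<bar>(f (x + t *\<^sub>R y) - f x) / t\<bar> \<le> L * indicator (cball 0 R) x"
proof -
  obtain K where K: "compact K" "K \<subseteq> \<Omega>" "\<And>x. x \<notin> K \<Longrightarrow> f x = 0" "\<And>x. x \<notin> K \<Longrightarrow> gradient f x = 0"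
    by (rule test_functionsE[OF f]) blast
  have "compact (gradient f ` K)"
    using gradient_continuous[OF f] K(1) by (intro compact_continuous_image) (auto intro: continuous_on_subset)
  from compact_imp_bounded[OF this] obtain L0 where L0: "\<And>x. x \<in> K \<Longrightarrow> norm (gradient f x) \<le> L0"
    by (auto simp: bounded_iff)
  define L1 where "L1 = max L0 0"
  have L1: "norm (gradient f x) \<le> L1" for x
    using L0 K(4) by (cases "x \<in> K") (auto simp: L1_def le_max_iff_disj)
  have L1_0: "0 \<le> L1" by (simp add: L1_def)
  obtain R0 where R0: "\<And>x. x \<in> K \<Longrightarrow> norm x \<le> R0"
    using compact_imp_bounded[OF K(1)] by (auto simp: bounded_iff)
  have lip: "\<bar>f (x + v) - f x\<bar> \<le> L1 * norm v" for x v
  proof -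
    have "norm (f (x + v) - f x) \<le> L1 * norm (x + v - x)"
    proof (rule differentiable_bound[of UNIV])
      fix z show "(f has_derivative (\<lambda>v. gradient f z \<bullet> v)) (at z within UNIV)"
        using test_functions_has_derivative[OF f] by simp
      show "onorm (\<lambda>v. gradient f z \<bullet> v) \<le> L1"
      proof (rule onorm_bound[OF L1_0])
        fix v show "norm (gradient f z \<bullet> v) \<le> L1 * norm v"
          using Cauchy_Schwarz_ineq2[of "gradient f z" v] mult_right_mono[OF L1[of z] norm_ge_zero[of v]]
          by simp
      qed
    qed auto
    then show ?thesis by simp
  qed
  show ?thesis
  proof (rule that[of "L1 * norm y" "R0 + norm y"])
    show "0 \<le> L1 * norm y" using L1_0 by simp
    fix x and t :: real assume t: "\<bar>t\<bar> \<le> 1"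
    show "\<bar>(f (x + t *\<^sub>R y) - f x) / t\<bar> \<le> L1 * norm y * indicator (cball 0 (R0 + norm y)) x"
    proof (cases "norm x \<le> R0 + norm y")
      case True
      have "\<bar>(f (x + t *\<^sub>R y) - f x) / t\<bar> \<le> L1 * norm y"
        using lip[of x "t *\<^sub>R y"] L1_0 by (cases "t = 0") (auto simp: abs_divide divide_simps mult_ac)
      then show ?thesis using True by simp
    next
      case False
      have ty: "norm (t *\<^sub>R y) \<le> norm y" using t by (simp add: mult_left_le_one_le)
      have "norm x \<le> norm (x + t *\<^sub>R y) + norm (t *\<^sub>R y)"
        using norm_triangle_ineq4[of "x + t *\<^sub>R y" "t *\<^sub>R y"] by simp
      then have "x + t *\<^sub>R y \<notin> K" "x \<notin> K" using False R0[of x] R0[of "x + t *\<^sub>R y"] ty norm_ge_zero[of y] by auto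
      then show ?thesis using K(3) False by simp
    qed
  qed
qed

text \<open>Exponent 1 gives the vanishing integral of a gradient, exponent 2 the translation
  estimate and the passage from lattice sums to the energy. A zeroth power would destroy the compact
  support of the bound.\<close>

lemma difference_quotient_integral:
  assumes f: "f \<in> test_functions \<Omega>" and t: "t \<longlonglongrightarrow> 0" "\<And>n::nat. t n \<noteq> 0" "\<And>n. \<bar>t n\<bar> \<le> 1"
    and m: "m \<noteq> 0"
  shows "(\<lambda>n. LBINT x. ((f (x + t n *\<^sub>R y) - f x) / t n) ^ m) \<longlonglongrightarrow> (LBINT x. (gradient f x \<bullet> y) ^ m)"
proof -
  obtain L R where L: "0 \<le> L"
    "\<And>x t. \<bar>t\<bar> \<le> 1 \<Longrightarrow> \<bar>(f (x + t *\<^sub>R y) - f x) / t\<bar> \<le> L * indicator (cball 0 R) x"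
    by (rule difference_quotient_bound[OF f, of y]) blast
  have [measurable]: "f \<in> borel_measurable borel" "gradient f \<in> borel_measurable borel"
    using f by (auto intro: borel_measurable_continuous_onI test_functions_continuous gradient_continuous)
  show ?thesis
  proof (rule integral_dominated_convergence[where w = "\<lambda>x. L ^ m * indicator (cball 0 R) x"])
    have "emeasure lborel (cball (0::'a) R) < \<infinity>"
      by (rule emeasure_bounded_finite) auto
    then show "integrable lborel (\<lambda>x::'a. L ^ m * indicator (cball 0 R) x)"
      by (intro integrable_mult_right integrable_real_indicator) auto
    show "AE x in lborel. (\<lambda>n. ((f (x + t n *\<^sub>R y) - f x) / t n) ^ m) \<longlonglongrightarrow> (gradient f x \<bullet> y) ^ m"
      by (intro AE_I2 tendsto_power difference_quotient_tendsto[OF f t(1,2)])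
    fix n
    show "AE x in lborel. norm (((f (x + t n *\<^sub>R y) - f x) / t n) ^ m) \<le> L ^ m * indicator (cball 0 R) x"
    proof (rule AE_I2)
      fix x
      have "\<bar>(f (x + t n *\<^sub>R y) - f x) / t n\<bar> ^ m \<le> (L * indicator (cball 0 R) x) ^ m"
        by (intro power_mono L(2) t) auto
      then show "norm (((f (x + t n *\<^sub>R y) - f x) / t n) ^ m) \<le> L ^ m * indicator (cball 0 R) x"
        using m by (auto simp: power_abs indicator_def zero_power split: if_splits)
    qed
  qed auto
qed

lemma integrable_test_function: "f \<in> test_functions \<Omega> \<Longrightarrow> integrable lborel f"
  by (rule test_functionsE[of f \<Omega>])
     (auto intro: integrable_compact_support[OF test_functions_continuous])

text \<open>Translation invariance makes the integral of every difference quotient vanish; the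
  derivative is their limit.\<close>

lemma integral_gradient_eq_0:
  assumes f: "f \<in> test_functions \<Omega>"
  shows "(LBINT x. gradient f x \<bullet> y) = 0"
proof -
  define t where "t n = 1 / real (Suc n)" for n
  have t0: "t \<longlonglongrightarrow> 0" using LIMSEQ_Suc[OF lim_1_over_n] by (simp add: t_def[abs_def])
  have "(\<lambda>n. LBINT x. ((f (x + t n *\<^sub>R y) - f x) / t n) ^ 1) \<longlonglongrightarrow> (LBINT x. (gradient f x \<bullet> y) ^ 1)"
    by (rule difference_quotient_integral[OF f t0]) (auto simp: t_def)
  moreover have "(LBINT x. ((f (x + t n *\<^sub>R y) - f x) / t n) ^ 1) = 0" for n
  proof -
    have "(LBINT x. f (x + t n *\<^sub>R y) - f x) = 0"
      using lborel_integral_translate[OF borel_measurable_continuous_onI[OF test_functions_continuous[OF f]], of "t n *\<^sub>R y"]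
      by (subst Bochner_Integration.integral_diff)
         (auto intro: integrable_test_function[OF f] lborel_integrable_translate)
    then show ?thesis by simp
  qed
  ultimately show ?thesis by (auto simp only: LIMSEQ_const_iff power_one_right)
qed

lemma gradient_mult:
  assumes "f differentiable (at x)" "g differentiable (at x)"
  shows "gradient (\<lambda>x. f x * g x) x = f x *\<^sub>R gradient g x + g x *\<^sub>R gradient f x"
  using has_derivative_mult[OF assms[THEN gradient_has_derivative]]
  by (intro gradient_eqI) (simp add: inner_add_left mult.commute)

text \<open>Only one factor carries the compact support. This matters for Green's identity, where
  the other factor is a component of the gradient of \<psi>.\<close>

lemma integration_by_parts:
  assumes f: "f \<in> test_functions \<Omega>" and g: "\<And>k. C_k k g"
  shows "(LBINT x. f x * (gradient g x \<bullet> b)) = - (LBINT x. (gradient f x \<bullet> b) * g x)"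
proof -
  obtain K where K: "compact K" "K \<subseteq> \<Omega>" "\<And>x. x \<notin> K \<Longrightarrow> f x = 0" "\<And>x. x \<notin> K \<Longrightarrow> gradient f x = 0"
    by (rule test_functionsE[OF f]) blast
  have diff: "f differentiable (at x)" "g differentiable (at x)" for x
    using g[of "Suc 0"] test_functions_C_k[OF f, of "Suc 0"] by auto
  have cg: "continuous_on UNIV g" "continuous_on UNIV (gradient g)"
    using g[of 0] g[of "Suc 0"] by (auto simp: gradient_def[abs_def] intro!: continuous_intros)
  have "integrable lborel (\<lambda>x. f x * (gradient g x \<bullet> b))" "integrable lborel (\<lambda>x. (gradient f x \<bullet> b) * g x)"
    using K by (auto intro!: integrable_compact_support[OF _ K(1)] continuous_intros cg
       test_functions_continuous[OF f] gradient_continuous[OF f])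
  moreover have "(LBINT x. gradient (\<lambda>x. f x * g x) x \<bullet> b) = 0"
    by (rule integral_gradient_eq_0[OF test_functions_mult[OF f g]])
  ultimately show ?thesis
    by (simp add: gradient_mult diff inner_add_left mult.commute)
qed

section \<open>Averages over balls\<close>

lemma sqint_compact_support:
  assumes "continuous_on UNIV f" "compact K" "\<And>x. x \<notin> K \<Longrightarrow> f x = 0"
  shows "sqint lborel f"
proof -
  have "integrable lborel (\<lambda>x. (norm (f x))\<^sup>2)"
    using assms by (intro integrable_compact_support[OF _ assms(2)] continuous_intros) auto
  then show ?thesis
    using borel_measurable_continuous_onI[OF assms(1)] by (simp add: sqint_def)
qed

lemma sqint_test_function:
  assumes "f \<in> test_functions \<Omega>"
  shows "sqint lborel f" "sqint lborel (gradient f)"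
proof -
  obtain K where "compact K" "\<And>x. x \<notin> K \<Longrightarrow> f x = 0" "\<And>x. x \<notin> K \<Longrightarrow> gradient f x = 0"
    by (rule test_functionsE[OF assms]) blast
  then show "sqint lborel f" "sqint lborel (gradient f)"
    using assms by (auto intro: sqint_compact_support test_functions_continuous gradient_continuous)
qed

lemma sqint_translate:
  assumes "sqint lborel f"
  shows "sqint lborel (\<lambda>x. f (x + c))"
  using assms lborel_integrable_translate[of "\<lambda>x. (norm (f x))\<^sup>2"]
  by (auto simp: sqint_def intro: measurable_compose[rotated])

lemma sqint_real_diff:
  fixes f g :: "'x \<Rightarrow> real"
  assumes "sqint M f" "sqint M g"
  shows "integrable M (\<lambda>x. (f x - g x)\<^sup>2)"
  using sqint_diff[OF assms] by (simp add: sqint_def)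

lemma translation_estimate:
  assumes f: "f \<in> test_functions \<Omega>"
  shows "(LBINT x. (f (x + y) - f x)\<^sup>2) \<le> (LBINT x. (gradient f x \<bullet> y)\<^sup>2)"
proof -
  define t where "t n = 1 / real (Suc n)" for n
  have t0: "t \<longlonglongrightarrow> 0" using LIMSEQ_Suc[OF lim_1_over_n] by (simp add: t_def[abs_def])
  have t_pos: "t n > 0" for n by (simp add: t_def)
  have [measurable]: "f \<in> borel_measurable borel"
    using f by (auto intro: borel_measurable_continuous_onI test_functions_continuous)
  have lim: "(\<lambda>n. LBINT x. ((f (x + t n *\<^sub>R y) - f x) / t n)\<^sup>2) \<longlonglongrightarrow> (LBINT x. (gradient f x \<bullet> y)\<^sup>2)"
    by (rule difference_quotient_integral[OF f t0]) (auto simp: t_def)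
  \<comment> \<open>Split the translation by \<open>y\<close> into \<open>n + 1\<close> equal steps, each contributing the same integral.\<close>
  have le: "(LBINT x. (f (x + y) - f x)\<^sup>2) \<le> (LBINT x. ((f (x + t n *\<^sub>R y) - f x) / t n)\<^sup>2)" for n
  proof -
    define d where "d j x = (f (x + (t n * real (Suc j)) *\<^sub>R y) - f (x + (t n * real j) *\<^sub>R y))\<^sup>2" for j x
    have sq: "sqint lborel (\<lambda>x. f (x + c))" for c
      by (rule sqint_translate[OF sqint_test_function(1)[OF f]])
    have dint: "integrable lborel (d j)" for j
      unfolding d_def[abs_def] by (rule sqint_real_diff[OF sq sq])
    have d_eq: "(LBINT x. d j x) = (LBINT x. (f (x + t n *\<^sub>R y) - f x)\<^sup>2)" for j
    proof -
      have "(LBINT x. d j x) = (LBINT x. (\<lambda>x. (f (x + t n *\<^sub>R y) - f x)\<^sup>2) (x + (t n * real j) *\<^sub>R y))"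
        by (simp add: d_def algebra_simps)
      also have "\<dots> = (LBINT x. (f (x + t n *\<^sub>R y) - f x)\<^sup>2)"
        by (rule lborel_integral_translate) measurable
      finally show ?thesis .
    qed
    have "(LBINT x. (f (x + y) - f x)\<^sup>2) \<le> (LBINT x. real (Suc n) * (\<Sum>j<Suc n. d j x))"
    proof (rule integral_mono)
      show "integrable lborel (\<lambda>x. (f (x + y) - f x)\<^sup>2)"
        by (rule sqint_real_diff[OF sq sqint_test_function(1)[OF f]])
      show "integrable lborel (\<lambda>x. real (Suc n) * (\<Sum>j<Suc n. d j x))"
        by (intro integrable_mult_right Bochner_Integration.integrable_sum dint)
      fix x
      have "f (x + y) - f x = (\<Sum>j<Suc n. f (x + (t n * real (Suc j)) *\<^sub>R y) - f (x + (t n * real j) *\<^sub>R y))"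
        using sum_lessThan_telescope[of "\<lambda>j. f (x + (t n * real j) *\<^sub>R y)" "Suc n"]
        by (simp add: t_def)
      then show "(f (x + y) - f x)\<^sup>2 \<le> real (Suc n) * (\<Sum>j<Suc n. d j x)"
        using sum_squared_le_sum_of_squares[of "\<lambda>j. f (x + (t n * real (Suc j)) *\<^sub>R y) - f (x + (t n * real j) *\<^sub>R y)" "{..<Suc n}"]
        by (simp only: d_def card_lessThan mult.commute)
    qed
    also have "\<dots> = real (Suc n) * (LBINT x. (\<Sum>j<Suc n. d j x))"
      by (rule integral_mult_right_zero)
    also have "(LBINT x. (\<Sum>j<Suc n. d j x)) = (\<Sum>j<Suc n. LBINT x. d j x)"
      by (rule Bochner_Integration.integral_sum) (rule dint)
    also have "real (Suc n) * (\<Sum>j<Suc n. LBINT x. d j x) = (real (Suc n))\<^sup>2 * (LBINT x. (f (x + t n *\<^sub>R y) - f x)\<^sup>2)"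
      by (simp only: d_eq sum_constant card_lessThan power2_eq_square mult.assoc)
    also have "\<dots> = (LBINT x. ((f (x + t n *\<^sub>R y) - f x) / t n)\<^sup>2)"
      by (simp add: t_def power_mult_distrib mult.commute del: of_nat_Suc)
    finally show ?thesis .
  qed
  show ?thesis by (rule LIMSEQ_le_const[OF lim]) (use le in blast)
qed

lemma translation_estimate_norm:
  assumes f: "f \<in> test_functions \<Omega>"
  shows "(LBINT x. (f (x + y) - f x)\<^sup>2) \<le> (norm y)\<^sup>2 * (LBINT x. (norm (gradient f x))\<^sup>2)"
proof -
  have sq: "sqint lborel (gradient f)" by (rule sqint_test_function(2)[OF f])
  have pt: "(gradient f x \<bullet> y)\<^sup>2 \<le> (norm y)\<^sup>2 * (norm (gradient f x))\<^sup>2" for x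
    using Cauchy_Schwarz_ineq[of "gradient f x" y] by (simp add: power2_norm_eq_inner mult.commute)
  have "(LBINT x. (gradient f x \<bullet> y)\<^sup>2) \<le> (LBINT x. (norm y)\<^sup>2 * (norm (gradient f x))\<^sup>2)"
  proof (rule integral_mono')
    show "integrable lborel (\<lambda>x. (norm y)\<^sup>2 * (norm (gradient f x))\<^sup>2)"
      using sq by (simp add: sqint_def)
  qed (use pt in auto)
  with translation_estimate[OF f, of y] show ?thesis by simp
qed

text \<open>A mollification with the normalised indicator of a ball as kernel. Compactness uses
  three properties: a pointwise bound, equicontinuity, and L2-closeness to the function, each
  controlled by mass and energy.\<close>

definition ball_average :: "real \<Rightarrow> ('a::euclidean_space \<Rightarrow> real) \<Rightarrow> 'a \<Rightarrow> real" where
  "ball_average h f x = (LBINT y. indicator (ball 0 h) y * f (x + y)) / measure lborel (ball (0::'a) h)"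

lemma integrable_ball_indicator:
  fixes g :: "'a::euclidean_space \<Rightarrow> real"
  assumes "continuous_on UNIV g"
  shows "integrable lborel (\<lambda>y. indicator (ball 0 h) y * g y)"
proof -
  have "set_integrable lborel (cball 0 h) g"
    unfolding set_integrable_def
    using assms by (intro borel_integrable_compact) (auto intro: continuous_on_subset)
  then have "set_integrable lborel (ball 0 h) g"
    by (rule set_integrable_subset) auto
  then show ?thesis by (simp add: set_integrable_def)
qed

lemma ball_integral_squared:
  fixes g :: "'a::euclidean_space \<Rightarrow> real"
  assumes g: "continuous_on UNIV g"
  shows "(LBINT y. indicator (ball 0 h) y * g y)\<^sup>2
    \<le> measure lborel (ball (0::'a) h) * (LBINT y. indicator (ball 0 h) y * (g y)\<^sup>2)"
proof -
  have eq: "(\<lambda>y. (norm (indicator (ball 0 h) y * g y))\<^sup>2) = (\<lambda>y. indicator (ball 0 h) y * (g y)\<^sup>2)"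
    and eq2: "(\<lambda>y. indicator (ball 0 h) y \<bullet> (indicator (ball 0 h) y * g y)) = (\<lambda>y. indicator (ball 0 h) y * g y)"
    and eq3: "(\<lambda>y. (norm (indicator (ball 0 h) y :: real))\<^sup>2) = (indicator (ball (0::'a) h) :: 'a \<Rightarrow> real)"
    by (auto simp: indicator_def)
  have [measurable]: "g \<in> borel_measurable borel"
    using g by (rule borel_measurable_continuous_onI)
  have "integrable lborel (indicator (ball (0::'a) h) :: 'a \<Rightarrow> real)"
    by (intro integrable_real_indicator emeasure_bounded_finite) auto
  then have sq: "sqint lborel (indicator (ball (0::'a) h) :: 'a \<Rightarrow> real)"
    unfolding sqint_def eq3 by simp
  have "integrable lborel (\<lambda>y. indicator (ball 0 h) y * (g y)\<^sup>2)"
    using g by (intro integrable_ball_indicator continuous_intros)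
  moreover have "(\<lambda>y. indicator (ball 0 h) y * g y) \<in> borel_measurable lborel"
    using integrable_ball_indicator[OF g] by (rule borel_measurable_integrable)
  ultimately have sg: "sqint lborel (\<lambda>y. indicator (ball 0 h) y * g y)"
    unfolding sqint_def eq by simp
  show ?thesis
    using integral_Cauchy_Schwarz[OF sq sg] by (simp only: eq eq2 eq3) simp
qed

context
  fixes f :: "'a::euclidean_space \<Rightarrow> real" and \<Omega> and h :: real and V
  assumes f: "f \<in> test_functions \<Omega>" and h: "h > 0"
  defines "V \<equiv> measure lborel (ball (0::'a) h)"
begin

lemma ball_volume_pos: "V > 0"
  using content_ball_pos[OF h, of "0::'a"] by (simp add: V_def)

lemma f_translate_continuous: "continuous_on UNIV (\<lambda>y. f (x + y))"
  by (rule continuous_on_compose2[OF test_functions_continuous[OF f]]) (auto intro: continuous_intros)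

lemma f_measurable: "f \<in> borel_measurable borel"
  using f by (auto intro: borel_measurable_continuous_onI test_functions_continuous)

lemma pair_measurable:
  "(\<lambda>z. f (fst z + snd z)) \<in> borel_measurable borel"
  "(\<lambda>z::'a \<times> 'a. f (fst z)) \<in> borel_measurable borel"
  "(\<lambda>z::'a \<times> 'a. indicator (ball (0::'a) h) (snd z) :: real) \<in> borel_measurable borel"
proof -
  have "continuous_on UNIV (\<lambda>z. f (fst z + snd z))" "continuous_on UNIV (\<lambda>z::'a \<times> 'a. f (fst z))"
    by (rule continuous_on_compose2[OF test_functions_continuous[OF f]]; auto intro!: continuous_intros)+
  then show "(\<lambda>z. f (fst z + snd z)) \<in> borel_measurable borel"
    "(\<lambda>z::'a \<times> 'a. f (fst z)) \<in> borel_measurable borel"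
    by (auto intro: borel_measurable_continuous_onI)
  have "open (snd -` ball (0::'a) h :: ('a \<times> 'a) set)"
    by (intro open_vimage continuous_intros) auto
  then have "(indicator (snd -` ball (0::'a) h) :: 'a \<times> 'a \<Rightarrow> real) \<in> borel_measurable borel"
    by (intro borel_measurable_indicator) auto
  then show "(\<lambda>z::'a \<times> 'a. indicator (ball (0::'a) h) (snd z) :: real) \<in> borel_measurable borel"
    by (simp add: indicator_def[abs_def])
qed

lemma ball_average_measurable: "ball_average h f \<in> borel_measurable borel"
proof -
  note [measurable] = pair_measurable
  have "(\<lambda>z. indicator (ball 0 h) (snd z) * f (fst z + snd z)) \<in> borel_measurable borel"
    by measurable
  then have "(\<lambda>x. LBINT y. indicator (ball 0 h) y * f (x + y)) \<in> borel_measurable lborel"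
    by (intro lborel.borel_measurable_lebesgue_integral) (simp add: split_beta' lborel_prod)
  then show ?thesis unfolding ball_average_def[abs_def] by simp
qed

text \<open>Jensen's inequality for the uniform measure on the ball. The value \<open>a\<close> is
  left abstract so that it can be an average, a difference of two averages, or an average minus a
  value.\<close>

lemma ball_average_squared_le:
  fixes g :: "'a \<Rightarrow> real"
  assumes g: "continuous_on UNIV g" and eq: "a * V = (LBINT y. indicator (ball 0 h) y * g y)"
  shows "a\<^sup>2 \<le> (LBINT y. indicator (ball 0 h) y * (g y)\<^sup>2) / V"
proof -
  have "(LBINT y. indicator (ball 0 h) y * g y)\<^sup>2 \<le> V * (LBINT y. indicator (ball 0 h) y * (g y)\<^sup>2)"
    unfolding V_def by (rule ball_integral_squared[OF g])
  then have "(a * V)\<^sup>2 \<le> V * (LBINT y. indicator (ball 0 h) y * (g y)\<^sup>2)"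
    by (simp only: eq)
  then have "V * (a\<^sup>2 * V) \<le> V * (LBINT y. indicator (ball 0 h) y * (g y)\<^sup>2)"
    by (simp add: power_mult_distrib power2_eq_square mult_ac)
  then have "a\<^sup>2 * V \<le> (LBINT y. indicator (ball 0 h) y * (g y)\<^sup>2)"
    using ball_volume_pos by (simp add: mult_le_cancel_left_pos)
  then show ?thesis using ball_volume_pos by (simp add: pos_le_divide_eq)
qed

lemma ball_average_times: "ball_average h f x * V = (LBINT y. indicator (ball 0 h) y * f (x + y))"
  using ball_volume_pos by (simp add: ball_average_def V_def)

lemma ball_average_bound: "(ball_average h f x)\<^sup>2 \<le> (LBINT x. (f x)\<^sup>2) / V"
proof -
  note [measurable] = f_measurable
  have "(LBINT y. indicator (ball 0 h) y * (f (x + y))\<^sup>2) \<le> (LBINT y. (f (x + y))\<^sup>2)"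
    by (rule integral_mono')
       (use sqint_translate[OF sqint_test_function(1)[OF f], of x] in
        \<open>auto simp: sqint_def add.commute indicator_def\<close>)
  also have "\<dots> = (LBINT y. (f y)\<^sup>2)"
    using lborel_integral_translate[of "\<lambda>y. (f y)\<^sup>2" x] by (simp add: add.commute)
  finally show ?thesis
    using ball_average_squared_le[OF f_translate_continuous ball_average_times, of x] ball_volume_pos
    by (meson divide_right_mono less_imp_le order_trans)
qed

lemma ball_average_equicontinuous:
  "(ball_average h f x - ball_average h f x')\<^sup>2
     \<le> (norm (x - x'))\<^sup>2 * (LBINT x. (norm (gradient f x))\<^sup>2) / V"
proof -
  note [measurable] = f_measurable
  have c: "continuous_on UNIV (\<lambda>y. f (x + y) - f (x' + y))"
    by (intro continuous_intros f_translate_continuous)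
  have eq: "(ball_average h f x - ball_average h f x') * V
      = (LBINT y. indicator (ball 0 h) y * (f (x + y) - f (x' + y)))"
    unfolding left_diff_distrib right_diff_distrib ball_average_times
    by (rule Bochner_Integration.integral_diff[symmetric]) (intro integrable_ball_indicator f_translate_continuous)+
  have "(LBINT y. indicator (ball 0 h) y * (f (x + y) - f (x' + y))\<^sup>2)
      \<le> (LBINT y. (f (x + y) - f (x' + y))\<^sup>2)"
    by (rule integral_mono')
       (use sqint_real_diff[OF sqint_translate[OF sqint_test_function(1)[OF f], of x]
          sqint_translate[OF sqint_test_function(1)[OF f], of x']] in
        \<open>auto simp: add.commute indicator_def\<close>)
  also have "\<dots> = (LBINT y. (f (y + (x - x')) - f y)\<^sup>2)"
    using lborel_integral_translate[of "\<lambda>y. (f (y + (x - x')) - f y)\<^sup>2" x'] by (simp add: algebra_simps)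
  also have "\<dots> \<le> (norm (x - x'))\<^sup>2 * (LBINT x. (norm (gradient f x))\<^sup>2)"
    by (rule translation_estimate_norm[OF f])
  finally show ?thesis
    using ball_average_squared_le[OF c eq] ball_volume_pos
    by (meson divide_right_mono less_imp_le order_trans)
qed

lemma ball_average_zero:
  assumes "\<And>x. f x \<noteq> 0 \<Longrightarrow> norm x \<le> R" "R + h \<le> norm x"
  shows "ball_average h f x = 0"
proof -
  have z: "indicator (ball 0 h) y * f (x + y) = 0" for y
  proof (cases "norm y < h")
    case True
    then have "\<not> norm (x + y) \<le> R" using norm_diff_ineq[of x y] assms(2) by linarith
    then show ?thesis using assms(1) by auto
  qed auto
  show ?thesis unfolding ball_average_def z by simp
qed

lemma ball_average_diff_pointwise:
  "(ball_average h f x - f x)\<^sup>2 \<le> (LBINT y. indicator (ball 0 h) y * (f (x + y) - f x)\<^sup>2) / V"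
proof (rule ball_average_squared_le)
  show "continuous_on UNIV (\<lambda>y. f (x + y) - f x)"
    by (intro continuous_intros f_translate_continuous)
  have "(LBINT y. indicator (ball (0::'a) h) y * f x) = f x * V"
  proof -
    have "(LBINT y. indicator (ball (0::'a) h) y * f x) = (LBINT y. indicator (ball (0::'a) h) y) * f x"
      by (rule integral_mult_left_zero)
    also have "(LBINT y. indicator (ball (0::'a) h) y) = V"
      by (simp add: V_def)
    finally show ?thesis by simp
  qed
  then show "(ball_average h f x - f x) * V = (LBINT y. indicator (ball 0 h) y * (f (x + y) - f x))"
    unfolding left_diff_distrib right_diff_distrib ball_average_times
    by (simp only: Bochner_Integration.integral_diff[OF integrable_ball_indicator[OF f_translate_continuous]
          integrable_ball_indicator[OF continuous_on_const]])
qed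

text \<open>After Jensen and an exchange of the integrals, the inner integral is a translation by
  \<open>y\<close> with norm below \<open>h\<close>, hence at most h^2 times the energy. Nonnegative
  integrals are used because the same estimate has to establish integrability.\<close>

lemma ball_average_diff:
  "sqint lborel (\<lambda>x. ball_average h f x - f x)"
  "(LBINT x. (ball_average h f x - f x)\<^sup>2) \<le> h\<^sup>2 * (LBINT x. (norm (gradient f x))\<^sup>2)"
proof -
  note [measurable] = f_measurable ball_average_measurable
  let ?E = "LBINT x. (norm (gradient f x))\<^sup>2"
  have "(\<integral>\<^sup>+x. ennreal ((ball_average h f x - f x)\<^sup>2) \<partial>lborel)
    \<le> (\<integral>\<^sup>+x. (\<integral>\<^sup>+y. ennreal (indicator (ball 0 h) y * (f (x + y) - f x)\<^sup>2 / V) \<partial>lborel) \<partial>lborel)"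
  proof (rule nn_integral_mono)
    fix x
    have "integrable lborel (\<lambda>y. indicator (ball 0 h) y * (f (x + y) - f x)\<^sup>2 / V)"
      by (intro integrable_divide integrable_ball_indicator continuous_intros f_translate_continuous)
    then have "(\<integral>\<^sup>+y. ennreal (indicator (ball 0 h) y * (f (x + y) - f x)\<^sup>2 / V) \<partial>lborel)
      = ennreal (LBINT y. indicator (ball 0 h) y * (f (x + y) - f x)\<^sup>2 / V)"
      using ball_volume_pos by (intro nn_integral_eq_integral) auto
    then show "ennreal ((ball_average h f x - f x)\<^sup>2)
      \<le> (\<integral>\<^sup>+y. ennreal (indicator (ball 0 h) y * (f (x + y) - f x)\<^sup>2 / V) \<partial>lborel)"
      using ball_average_diff_pointwise[of x] by (simp add: ennreal_leI)
  qed
  also have "\<dots> = (\<integral>\<^sup>+y. (\<integral>\<^sup>+x. ennreal (indicator (ball 0 h) y * (f (x + y) - f x)\<^sup>2 / V) \<partial>lborel) \<partial>lborel)"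
  proof (rule lborel_pair.Fubini'[symmetric])
    note [measurable] = pair_measurable
    have "(\<lambda>z. ennreal (indicator (ball 0 h) (snd z) * (f (fst z + snd z) - f (fst z))\<^sup>2 / V)) \<in> borel_measurable borel"
      by measurable
    then show "(\<lambda>(x, y). ennreal (indicator (ball 0 h) y * (f (x + y) - f x)\<^sup>2 / V)) \<in> borel_measurable (lborel \<Otimes>\<^sub>M lborel)"
      by (simp add: split_beta' lborel_prod)
  qed
  also have "\<dots> \<le> (\<integral>\<^sup>+y. ennreal (h\<^sup>2 * ?E / V) * indicator (ball (0::'a) h) y \<partial>lborel)"
  proof (rule nn_integral_mono)
    fix y :: 'a
    show "(\<integral>\<^sup>+x. ennreal (indicator (ball 0 h) y * (f (x + y) - f x)\<^sup>2 / V) \<partial>lborel)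
      \<le> ennreal (h\<^sup>2 * ?E / V) * indicator (ball 0 h) y"
    proof (cases "norm y < h")
      case True
      have "(\<integral>\<^sup>+x. ennreal ((f (x + y) - f x)\<^sup>2 / V) \<partial>lborel) = ennreal (LBINT x. (f (x + y) - f x)\<^sup>2 / V)"
        using ball_volume_pos
        by (intro nn_integral_eq_integral integrable_divide sqint_real_diff sqint_translate sqint_test_function[OF f]) auto
      also have "(LBINT x. (f (x + y) - f x)\<^sup>2 / V) \<le> h\<^sup>2 * ?E / V"
      proof -
        have "(norm y)\<^sup>2 * ?E \<le> h\<^sup>2 * ?E"
          using True by (intro mult_right_mono power_mono) auto
        with translation_estimate_norm[OF f, of y] have "(LBINT x. (f (x + y) - f x)\<^sup>2) \<le> h\<^sup>2 * ?E" by linarith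
        then show ?thesis using ball_volume_pos by (simp add: divide_right_mono)
      qed
      finally show ?thesis using True by (simp add: ennreal_leI)
    qed simp
  qed
  also have "\<dots> = ennreal (h\<^sup>2 * ?E / V) * emeasure lborel (ball (0::'a) h)"
    by (rule nn_integral_cmult_indicator) auto
  also have "emeasure lborel (ball (0::'a) h) = ennreal V"
    unfolding V_def by (intro emeasure_eq_ennreal_measure) (use emeasure_bounded_finite[of "ball (0::'a) h"] in auto)
  also have "ennreal (h\<^sup>2 * ?E / V) * ennreal V = ennreal (h\<^sup>2 * ?E)"
    using ball_volume_pos by (simp flip: ennreal_mult)
  finally have le: "(\<integral>\<^sup>+x. ennreal ((ball_average h f x - f x)\<^sup>2) \<partial>lborel) \<le> ennreal (h\<^sup>2 * ?E)" .
  then have fin: "integrable lborel (\<lambda>x. (ball_average h f x - f x)\<^sup>2)"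
    by (intro integrableI_nonneg) (auto intro: le_less_trans)
  then show "sqint lborel (\<lambda>x. ball_average h f x - f x)"
    by (simp add: sqint_def)
  have "ennreal (LBINT x. (ball_average h f x - f x)\<^sup>2) \<le> ennreal (h\<^sup>2 * ?E)"
    using le nn_integral_eq_integral[OF fin] by simp
  then show "(LBINT x. (ball_average h f x - f x)\<^sup>2) \<le> h\<^sup>2 * ?E"
    by (subst (asm) ennreal_le_iff) auto
qed

end

section \<open>Rellich compactness\<close>

lemma abs_le_mult_of_squares:
  fixes a b c :: real
  assumes "a\<^sup>2 \<le> b\<^sup>2 * c" "0 \<le> b"
  shows "\<bar>a\<bar> \<le> b * sqrt c"
proof -
  have "sqrt (a\<^sup>2) \<le> sqrt (b\<^sup>2 * c)" using assms(1) by (rule real_sqrt_le_mono)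
  then show ?thesis using assms(2) by (simp add: real_sqrt_mult)
qed

text \<open>The Arzela-Ascoli pattern: a diagonal subsequence converges on a countable dense set for
  all radii at once, and equicontinuity carries convergence to every point.\<close>

lemma ball_averages_convergent_subsequence:
  fixes \<phi> :: "nat \<Rightarrow> 'a::euclidean_space \<Rightarrow> real" and h :: "nat \<Rightarrow> real"
  assumes \<phi>: "\<And>k. \<phi> k \<in> test_functions \<Omega>" and h: "\<And>m. h m > 0"
    and C1: "\<And>k. (LBINT x. (\<phi> k x)\<^sup>2) \<le> C"
    and C2: "\<And>k. (LBINT x. (norm (gradient (\<phi> k) x))\<^sup>2) \<le> C"
  obtains r where "strict_mono r" "\<And>m x. convergent (\<lambda>k. ball_average (h m) (\<phi> (r k)) x)"
proof -
  define V where "V m = measure lborel (ball (0::'a) (h m))" for m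
  have V: "V m > 0" for m using content_ball_pos[OF h, of "0::'a"] by (simp add: V_def)
  obtain D :: "'a set" where D: "countable D" "\<And>X. open X \<Longrightarrow> X \<noteq> {} \<Longrightarrow> \<exists>d\<in>D. d \<in> X"
    using countable_dense_exists by blast
  \<comment> \<open>The factor \<open>sqrt (V m)\<close> cancels the radius in
    \<open>ball_average_bound\<close>, so the single constant \<open>sqrt C\<close> bounds the whole
    doubly indexed family.\<close>
  define b where "b n p = sqrt (V (snd p)) * ball_average (h (snd p)) (\<phi> n) (fst p)" for n p
  have "norm (b n p) \<le> sqrt C" for n p
  proof -
    have "(b n p)\<^sup>2 \<le> C"
      using ball_average_bound[OF \<phi>[of n] h[of "snd p"], of "fst p"] C1[of n] V[of "snd p"]
      by (simp add: b_def power_mult_distrib pos_le_divide_eq mult.commute flip: V_def)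
    then show ?thesis using real_le_rsqrt[of "\<bar>b n p\<bar>" C] by simp
  qed
  then obtain r where r: "strict_mono r" "\<And>p. p \<in> D \<times> UNIV \<Longrightarrow> \<exists>l. (\<lambda>k. b (r k) p) \<longlonglongrightarrow> l"
    using function_convergent_subsequence[of "D \<times> UNIV" b "sqrt C"] D(1) by (metis countable_SIGMA countableI_type)
  have "convergent (\<lambda>k. ball_average (h m) (\<phi> (r k)) x)" for m x
  proof -
    let ?A = "\<lambda>k x. ball_average (h m) (\<phi> (r k)) x"
    have dense: "convergent (\<lambda>k. ?A k d)" if "d \<in> D" for d
    proof -
      have "convergent (\<lambda>k. b (r k) (d, m) * (1 / sqrt (V m)))"
        using r(2)[of "(d, m)"] that by (intro convergent_mult convergent_const) (auto simp: convergent_def)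
      moreover have "b (r k) (d, m) * (1 / sqrt (V m)) = ?A k d" for k
        using V[of m] by (simp add: b_def)
      ultimately show ?thesis by simp
    qed
    have lip: "\<bar>?A k x - ?A k d\<bar> \<le> norm (x - d) * sqrt (C / V m)" for k d
    proof (rule abs_le_mult_of_squares)
      have "(?A k x - ?A k d)\<^sup>2 \<le> (norm (x - d))\<^sup>2 * (LBINT x. (norm (gradient (\<phi> (r k)) x))\<^sup>2) / V m"
        unfolding V_def by (rule ball_average_equicontinuous[OF \<phi> h])
      also have "\<dots> \<le> (norm (x - d))\<^sup>2 * C / V m"
        using V[of m] C2[of "r k"] by (intro divide_right_mono mult_left_mono) auto
      finally show "(?A k x - ?A k d)\<^sup>2 \<le> (norm (x - d))\<^sup>2 * (C / V m)" by simp
    qed auto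
    have C0: "0 \<le> C" using C1[of 0] by (rule order_trans[rotated]) simp
    have "Cauchy (\<lambda>k. ?A k x)"
    proof (rule metric_CauchyI)
      fix e :: real assume e: "e > 0"
      define q where "q = sqrt (C / V m) + 1"
      define \<delta> where "\<delta> = e / (3 * q)"
      have s0: "0 \<le> sqrt (C / V m)" using C0 V[of m] by simp
      then have q: "q > 0" unfolding q_def by linarith
      have \<delta>: "\<delta> > 0" using e q by (simp add: \<delta>_def)
      then obtain d where d: "d \<in> D" "dist x d < \<delta>" using D(2)[of "ball x \<delta>"] by auto
      have small: "\<bar>?A k x - ?A k d\<bar> < e / 3" for k
      proof -
        have "norm (x - d) * sqrt (C / V m) \<le> \<delta> * sqrt (C / V m)"
          using d(2) s0 by (intro mult_right_mono) (auto simp: dist_norm)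
        also have "\<dots> < \<delta> * q" using \<delta> by (simp add: q_def)
        also have "\<dots> = e / 3" using q by (simp add: \<delta>_def)
        finally show ?thesis using lip[of k d] by linarith
      qed
      have "Cauchy (\<lambda>k. ?A k d)" using dense[OF d(1)] by (simp add: Cauchy_convergent_iff)
      then obtain M where M: "\<And>j k. j \<ge> M \<Longrightarrow> k \<ge> M \<Longrightarrow> dist (?A j d) (?A k d) < e / 3"
        using metric_CauchyD[of "\<lambda>k. ?A k d" "e/3"] e by auto
      have "dist (?A j x) (?A k x) < e" if "j \<ge> M" "k \<ge> M" for j k
        using M[OF that] small[of j] small[of k] unfolding dist_real_def by linarith
      then show "\<exists>M. \<forall>j\<ge>M. \<forall>k\<ge>M. dist (?A j x) (?A k x) < e" by blast
    qed
    then show ?thesis by (simp add: Cauchy_convergent_iff)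
  qed
  with r(1) show ?thesis by (rule that)
qed

text \<open>Extended by zero, the functions are L2-close to their ball averages uniformly in the
  index, by the energy bound. For a fixed radius the averages converge by dominated convergence,
  since boundedness of \<Omega> puts all supports into one ball.\<close>

lemma rellich:
  fixes \<phi> :: "nat \<Rightarrow> 'a::euclidean_space \<Rightarrow> real"
  assumes \<Omega>: "bounded \<Omega>" and \<phi>: "\<And>k. \<phi> k \<in> test_functions \<Omega>"
    and C1: "\<And>k. (LBINT x. (\<phi> k x)\<^sup>2) \<le> C"
    and C2: "\<And>k. (LBINT x. (norm (gradient (\<phi> k) x))\<^sup>2) \<le> C"
  obtains r :: "nat \<Rightarrow> nat" where "strict_mono r"
    "\<And>e. e > 0 \<Longrightarrow> \<exists>n. \<forall>j\<ge>n. \<forall>k\<ge>n. (LBINT x. (\<phi> (r j) x - \<phi> (r k) x)\<^sup>2) < e"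
proof -
  define h where "h m = 1 / real (Suc m)" for m
  have h: "h m > 0" "h m \<le> 1" for m by (auto simp: h_def)
  obtain r where r: "strict_mono r" "\<And>m x. convergent (\<lambda>k. ball_average (h m) (\<phi> (r k)) x)"
    by (rule ball_averages_convergent_subsequence[where h = h and \<phi> = \<phi>, OF \<phi> h(1) C1 C2]) blast
  define A where "A m k = ball_average (h m) (\<phi> (r k))" for m k
  define a where "a m x = lim (\<lambda>k. A m k x)" for m x
  have lim_a: "(\<lambda>k. A m k x) \<longlonglongrightarrow> a m x" for m x
    using r(2) by (simp add: a_def A_def convergent_LIMSEQ_iff)
  have [measurable]: "A m k \<in> borel_measurable borel" for m k
    unfolding A_def by (rule ball_average_measurable[OF \<phi> h(1)])
  have [measurable]: "a m \<in> borel_measurable borel" for m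
    by (rule borel_measurable_LIMSEQ_metric[OF _ lim_a]) simp
  obtain R where R: "\<And>x. x \<in> \<Omega> \<Longrightarrow> norm x \<le> R" using \<Omega> by (auto simp: bounded_iff)
  have R': "norm x \<le> R" if "\<phi> k x \<noteq> 0" for k x
    using test_functionsE[OF \<phi>[of k]] that R by (metis subsetD)
  define V where "V m = measure lborel (ball (0::'a) (h m))" for m
  have V: "V m > 0" for m using content_ball_pos[OF h(1), of "0::'a"] by (simp add: V_def)
  have A_bound: "(A m k x)\<^sup>2 \<le> C / V m" for m k x
    using ball_average_bound[OF \<phi>[of "r k"] h(1)[of m], of x] divide_right_mono[OF C1[of "r k"], of "V m"] V[of m]
    unfolding A_def V_def by linarith
  have A_zero: "A m k x = 0" if "\<not> norm x \<le> R + 1" for m k x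
    unfolding A_def
    by (rule ball_average_zero[OF \<phi>[of "r k"] h(1)[of m], of R]) (use R' that h(2)[of m] in auto)
  have a_bound: "(a m x)\<^sup>2 \<le> C / V m" for m x
    by (rule LIMSEQ_le_const2[OF tendsto_power[OF lim_a]]) (use A_bound in auto)
  have a_zero: "a m x = 0" if "\<not> norm x \<le> R + 1" for m x
    using lim_a[of m x] A_zero[OF that] by (simp add: LIMSEQ_const_iff)
  \<comment> \<open>The factor 4 comes from (a - b)^2 \<le> 2 a^2 + 2 b^2; the radius grows by 1
    because all averaging radii are at most 1.\<close>
  define w where "w m = (\<lambda>x::'a. 4 * (C / V m) * indicator (cball 0 (R + 1)) x)" for m
  have w_int: "integrable lborel (w m)" for m
    unfolding w_def
    by (intro integrable_mult_right integrable_real_indicator emeasure_bounded_finite) auto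
  have bound: "norm ((A m k x - a m x)\<^sup>2) \<le> w m x" for m k x
  proof (cases "norm x \<le> R + 1")
    case True
    have "(A m k x - a m x)\<^sup>2 \<le> 2 * (A m k x)\<^sup>2 + 2 * (a m x)\<^sup>2"
      using zero_le_power2[of "A m k x + a m x"] by (simp add: power2_eq_square algebra_simps)
    then show ?thesis using True A_bound[of m k x] a_bound[of m x] by (simp add: w_def)
  next
    case False
    then show ?thesis by (simp add: A_zero a_zero w_def)
  qed
  have A_lim: "(\<lambda>k. LBINT x. (A m k x - a m x)\<^sup>2) \<longlonglongrightarrow> 0" for m
  proof -
    have "(\<lambda>k. LBINT x. (A m k x - a m x)\<^sup>2) \<longlonglongrightarrow> (\<integral>x. 0 \<partial>(lborel :: 'a measure))"
    proof (rule integral_dominated_convergence[OF _ _ w_int[of m]])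
      show "AE x in lborel. (\<lambda>k. (A m k x - a m x)\<^sup>2) \<longlonglongrightarrow> 0"
      proof (rule AE_I2)
        fix x
        have "(\<lambda>k. (A m k x - a m x)\<^sup>2) \<longlonglongrightarrow> (a m x - a m x)\<^sup>2"
          by (intro tendsto_intros lim_a)
        then show "(\<lambda>k. (A m k x - a m x)\<^sup>2) \<longlonglongrightarrow> 0" by simp
      qed
    qed (use bound in auto)
    then show ?thesis by simp
  qed
  have A_int: "integrable lborel (\<lambda>x. (A m k x - a m x)\<^sup>2)" for m k
    by (rule Bochner_Integration.integrable_bound[OF w_int[of m]])
       (use bound[of m k] in \<open>auto intro: order_trans[OF _ abs_ge_self]\<close>)
  define I where "I m k = (LBINT x. (A m k x - a m x)\<^sup>2)" for m k
  \<comment> \<open>Split through the averages at both indices: three terms cost a factor 3, and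
    comparing the two averages with their limit costs another 2.\<close>
  have est: "(LBINT x. (\<phi> (r j) x - \<phi> (r k) x)\<^sup>2) \<le> 6 * (h m)\<^sup>2 * C + 6 * I m j + 6 * I m k" for j k m
  proof -
    define d where "d k x = (A m k x - \<phi> (r k) x)\<^sup>2" for k x
    have d_int: "integrable lborel (d k)" for k
      using ball_average_diff(1)[OF \<phi>[of "r k"] h(1)[of m]] by (simp add: sqint_def d_def[abs_def] A_def)
    have d_le: "(LBINT x. d k x) \<le> (h m)\<^sup>2 * C" for k
      using ball_average_diff(2)[OF \<phi>[of "r k"] h(1)[of m]] mult_left_mono[OF C2[of "r k"], of "(h m)\<^sup>2"]
      by (simp add: d_def A_def)
    have "(LBINT x. (\<phi> (r j) x - \<phi> (r k) x)\<^sup>2)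
      \<le> (LBINT x. 3 * d j x + 3 * d k x + 6 * (A m j x - a m x)\<^sup>2 + 6 * (A m k x - a m x)\<^sup>2)"
    proof (rule integral_mono)
      show "integrable lborel (\<lambda>x. (\<phi> (r j) x - \<phi> (r k) x)\<^sup>2)"
        by (rule sqint_real_diff[OF sqint_test_function(1)[OF \<phi>] sqint_test_function(1)[OF \<phi>]])
      show "integrable lborel (\<lambda>x. 3 * d j x + 3 * d k x + 6 * (A m j x - a m x)\<^sup>2 + 6 * (A m k x - a m x)\<^sup>2)"
        by (intro Bochner_Integration.integrable_add integrable_mult_right d_int A_int)
      fix x
      have "(p - q)\<^sup>2 \<le> 3 * (P - p)\<^sup>2 + 3 * (Q - q)\<^sup>2 + 6 * (P - s)\<^sup>2 + 6 * (Q - s)\<^sup>2" for p q P Q s :: real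
      proof -
        have 1: "(u + v + w)\<^sup>2 \<le> 3 * (u\<^sup>2 + v\<^sup>2 + w\<^sup>2)" for u v w :: real
          using zero_le_power2[of "u - v"] zero_le_power2[of "u - w"] zero_le_power2[of "v - w"]
          by (simp add: power2_eq_square algebra_simps)
        have 2: "(u + v)\<^sup>2 \<le> 2 * (u\<^sup>2 + v\<^sup>2)" for u v :: real
          using zero_le_power2[of "u - v"] by (simp add: power2_eq_square algebra_simps)
        show ?thesis
          using 1[of "p - P" "P - Q" "Q - q"] 2[of "P - s" "s - Q"]
          by (simp add: power2_commute[of p P] power2_commute[of s Q])
      qed
      then show "(\<phi> (r j) x - \<phi> (r k) x)\<^sup>2 \<le> 3 * d j x + 3 * d k x + 6 * (A m j x - a m x)\<^sup>2 + 6 * (A m k x - a m x)\<^sup>2"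
        by (simp add: d_def)
    qed
    also have "\<dots> = 3 * (LBINT x. d j x) + 3 * (LBINT x. d k x) + 6 * I m j + 6 * I m k"
      by (simp add: d_int A_int I_def)
    finally show ?thesis using d_le[of j] d_le[of k] by linarith
  qed
  have "\<exists>n. \<forall>j\<ge>n. \<forall>k\<ge>n. (LBINT x. (\<phi> (r j) x - \<phi> (r k) x)\<^sup>2) < e" if e: "e > 0" for e
  proof -
    have "(\<lambda>m. 6 * (h m)\<^sup>2 * C) \<longlonglongrightarrow> 6 * 0\<^sup>2 * C"
      using LIMSEQ_Suc[OF lim_1_over_n] unfolding h_def by (intro tendsto_intros) auto
    then have "(\<lambda>m. 6 * (h m)\<^sup>2 * C) \<longlonglongrightarrow> 0" by simp
    then have "\<forall>\<^sub>F m in sequentially. 6 * (h m)\<^sup>2 * C < e / 3" using e by (intro order_tendstoD) auto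
    then obtain m where m: "6 * (h m)\<^sup>2 * C < e / 3" using eventually_happens'[OF sequentially_bot] by blast
    have "\<forall>\<^sub>F k in sequentially. I m k < e / 18"
      using A_lim[of m] e unfolding I_def by (intro order_tendstoD) auto
    then obtain n where n: "\<And>k. k \<ge> n \<Longrightarrow> I m k < e / 18" by (auto simp: eventually_sequentially)
    have "(LBINT x. (\<phi> (r j) x - \<phi> (r k) x)\<^sup>2) < e" if "j \<ge> n" "k \<ge> n" for j k
      using est[of j k m] m n[OF that(1)] n[OF that(2)] by linarith
    then show ?thesis by blast
  qed
  with r(1) show ?thesis by (rule that)
qed

section \<open>The space of functions vanishing on the boundary\<close>

text \<open>Integrals run over the whole space, which changes nothing for test functions of \<Omega>
  and keeps translation invariance available.\<close>

definition poincare :: "'a::euclidean_space set \<Rightarrow> real \<Rightarrow> bool" where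
  "poincare \<Omega> m \<longleftrightarrow> (\<forall>\<phi>\<in>test_functions \<Omega>.
     m * (LBINT x. (\<phi> x)\<^sup>2) \<le> (LBINT x. (norm (gradient \<phi> x))\<^sup>2))"

lemma set_integral_eq_lebesgue_on:
  fixes F :: "'a::euclidean_space \<Rightarrow> 'b::{banach, second_countable_topology}"
  assumes "open \<Omega>"
  shows "(LINT x:\<Omega>|lebesgue. F x) = (\<integral>x. F x \<partial>lebesgue_on \<Omega>)"
  unfolding set_lebesgue_integral_def
  by (rule integral_restrict_space[symmetric]) (use assms in simp)

lemma integral_lebesgue_on_eq_lborel:
  fixes F :: "'a::euclidean_space \<Rightarrow> 'b::{banach, second_countable_topology}"
  assumes "open \<Omega>" "F \<in> borel_measurable borel" "\<And>x. x \<notin> \<Omega> \<Longrightarrow> F x = 0"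
  shows "(\<integral>x. F x \<partial>lebesgue_on \<Omega>) = (LBINT x. F x)"
proof -
  have "(\<integral>x. F x \<partial>lebesgue_on \<Omega>) = (\<integral>x. indicator \<Omega> x *\<^sub>R F x \<partial>lebesgue)"
    by (rule integral_restrict_space) (use assms in simp)
  also have "(\<lambda>x. indicator \<Omega> x *\<^sub>R F x) = F"
    using assms(3) by (auto simp: indicator_def)
  also have "(\<integral>x. F x \<partial>lebesgue) = (LBINT x. F x)"
    using assms(2) by (intro integral_completion) simp
  finally show ?thesis .
qed

lemma square_integrable_on_iff_sqint:
  assumes "open \<Omega>"
  shows "square_integrable_on F \<Omega> \<longleftrightarrow> sqint (lebesgue_on \<Omega>) F"
proof -
  have \<Omega>: "\<Omega> \<inter> space lebesgue \<in> sets lebesgue" using assms by simp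
  have "F \<in> borel_measurable (lebesgue_on \<Omega>) \<longleftrightarrow> set_borel_measurable lebesgue \<Omega> F"
    unfolding set_borel_measurable_def by (rule borel_measurable_restrict_space_iff[OF \<Omega>])
  moreover have "integrable (lebesgue_on \<Omega>) (\<lambda>x. (norm (F x))\<^sup>2) \<longleftrightarrow> set_integrable lebesgue \<Omega> (\<lambda>x. (norm (F x))\<^sup>2)"
    unfolding set_integrable_def by (rule integrable_restrict_space[OF \<Omega>])
  ultimately show ?thesis by (auto simp: square_integrable_on_def sqint_def)
qed

lemma sqint_lebesgue_on:
  assumes "open \<Omega>" "sqint lborel F"
  shows "sqint (lebesgue_on \<Omega>) F"
proof -
  have "F \<in> borel_measurable lebesgue" "integrable lebesgue (\<lambda>x. (norm (F x))\<^sup>2)"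
    using assms(2) by (auto simp: sqint_def integrable_completion intro: measurable_completion)
  then show ?thesis
    using assms(1) integrable_mult_indicator[of \<Omega> lebesgue "\<lambda>x. (norm (F x))\<^sup>2"]
    by (auto simp: sqint_def integrable_restrict_space intro!: measurable_restrict_space1)
qed

lemma test_function_zero_outside:
  assumes "\<phi> \<in> test_functions \<Omega>" "x \<notin> \<Omega>"
  shows "\<phi> x = 0" "gradient \<phi> x = 0"
  by (rule test_functionsE[OF assms(1)], use assms(2) in blast)+

lemma test_measurable:
  assumes "\<phi> \<in> test_functions \<Omega>"
  shows "\<phi> \<in> borel_measurable borel" "gradient \<phi> \<in> borel_measurable borel"
  using assms by (auto intro: borel_measurable_continuous_onI test_functions_continuous gradient_continuous)

context
  fixes \<Omega> :: "'a::euclidean_space set" and M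
  assumes \<Omega>: "open \<Omega>"
  defines "M \<equiv> lebesgue_on \<Omega>"
begin

lemma sqint_test_M:
  assumes "\<phi> \<in> test_functions \<Omega>"
  shows "sqint M \<phi>" "sqint M (gradient \<phi>)"
  unfolding M_def by (intro sqint_lebesgue_on[OF \<Omega>] sqint_test_function[OF assms])+

text \<open>The weak-gradient identity holds for test functions by integration by parts and is
  preserved by L2 limits of both components, so approximation alone places a pair in the Sobolev
  space.\<close>

lemma H1_0I:
  assumes u: "sqint M u" and g: "sqint M g" and \<phi>: "\<And>k. \<phi> k \<in> test_functions \<Omega>"
    and lim_u: "(\<lambda>k::nat. \<integral>x. (norm (\<phi> k x - u x))\<^sup>2 \<partial>M) \<longlonglongrightarrow> 0"
    and lim_g: "(\<lambda>k. \<integral>x. (norm (gradient (\<phi> k) x - g x))\<^sup>2 \<partial>M) \<longlonglongrightarrow> 0"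
  shows "H1_0 \<Omega> u g"
proof -
  have "weak_gradient \<Omega> u g"
    unfolding weak_gradient_def
  proof (intro ballI)
    fix \<psi> :: "'a \<Rightarrow> real" and b :: 'a
    assume \<psi>: "\<psi> \<in> test_functions \<Omega>" and b: "b \<in> Basis"
    note [measurable] = test_measurable[OF \<psi>] test_measurable[OF \<phi>]
    have s1: "sqint M (\<lambda>x. gradient \<psi> x \<bullet> b)"
    proof -
      obtain K where "compact K" "\<And>x. x \<notin> K \<Longrightarrow> gradient \<psi> x = 0"
        by (rule test_functionsE[OF \<psi>]) blast
      then show ?thesis unfolding M_def
        by (intro sqint_lebesgue_on[OF \<Omega>] sqint_compact_support continuous_intros gradient_continuous[OF \<psi>]) auto
    qed
    have s2: "sqint M (\<lambda>x. \<psi> x *\<^sub>R b)"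
    proof -
      obtain K where "compact K" "\<And>x. x \<notin> K \<Longrightarrow> \<psi> x = 0"
        by (rule test_functionsE[OF \<psi>]) blast
      then show ?thesis unfolding M_def
        by (intro sqint_lebesgue_on[OF \<Omega>] sqint_compact_support continuous_intros test_functions_continuous[OF \<psi>]) auto
    qed
    have l1: "(\<lambda>k. \<integral>x. \<phi> k x \<bullet> (gradient \<psi> x \<bullet> b) \<partial>M) \<longlonglongrightarrow> (\<integral>x. u x \<bullet> (gradient \<psi> x \<bullet> b) \<partial>M)"
      by (rule tendsto_integral_inner[OF sqint_test_M(1)[OF \<phi>] u s1 lim_u])
    have l2: "(\<lambda>k. \<integral>x. gradient (\<phi> k) x \<bullet> (\<psi> x *\<^sub>R b) \<partial>M) \<longlonglongrightarrow> (\<integral>x. g x \<bullet> (\<psi> x *\<^sub>R b) \<partial>M)"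
      by (rule tendsto_integral_inner[OF sqint_test_M(2)[OF \<phi>] g s2 lim_g])
    have parts: "(\<integral>x. \<phi> k x \<bullet> (gradient \<psi> x \<bullet> b) \<partial>M) = - (\<integral>x. gradient (\<phi> k) x \<bullet> (\<psi> x *\<^sub>R b) \<partial>M)" for k
    proof -
      have "(\<integral>x. \<phi> k x \<bullet> (gradient \<psi> x \<bullet> b) \<partial>M) = (LBINT x. \<phi> k x * (gradient \<psi> x \<bullet> b))"
        unfolding M_def inner_real_def
        by (rule integral_lebesgue_on_eq_lborel[OF \<Omega>]) (use test_function_zero_outside[OF \<phi>] in auto)
      also have "\<dots> = - (LBINT x. (gradient (\<phi> k) x \<bullet> b) * \<psi> x)"
        by (rule integration_by_parts[OF \<phi>]) (rule test_functions_C_k[OF \<psi>])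
      also have "(LBINT x. (gradient (\<phi> k) x \<bullet> b) * \<psi> x) = (\<integral>x. gradient (\<phi> k) x \<bullet> (\<psi> x *\<^sub>R b) \<partial>M)"
        unfolding M_def inner_scaleR_right mult.commute[of _ "\<psi> _"]
        by (rule integral_lebesgue_on_eq_lborel[OF \<Omega>, symmetric]) (use test_function_zero_outside[OF \<psi>] in auto)
      finally show ?thesis .
    qed
    have "(\<integral>x. u x \<bullet> (gradient \<psi> x \<bullet> b) \<partial>M) = - (\<integral>x. g x \<bullet> (\<psi> x *\<^sub>R b) \<partial>M)"
      using l1 tendsto_minus[OF l2] unfolding parts by (rule LIMSEQ_unique)
    then show "(LINT x:\<Omega>|lebesgue. u x * (gradient \<psi> x \<bullet> b)) = - (LINT x:\<Omega>|lebesgue. (g x \<bullet> b) * \<psi> x)"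
      by (simp add: set_integral_eq_lebesgue_on[OF \<Omega>] M_def mult.commute)
  qed
  moreover have "(\<lambda>k. (\<integral>x. (u x - \<phi> k x)\<^sup>2 \<partial>M) + (\<integral>x. (norm (g x - gradient (\<phi> k) x))\<^sup>2 \<partial>M)) \<longlonglongrightarrow> 0 + 0"
    using lim_u lim_g by (intro tendsto_add) (simp_all add: norm_minus_commute power2_commute)
  ultimately show ?thesis
    using u g \<phi>
    by (auto simp: H1_0_def H1_def square_integrable_on_iff_sqint[OF \<Omega>] set_integral_eq_lebesgue_on[OF \<Omega>] M_def)
qed

lemma H1_0E:
  assumes "H1_0 \<Omega> u g"
  obtains \<phi> where "sqint M u" "sqint M g" "\<And>k. \<phi> k \<in> test_functions \<Omega>"
    "(\<lambda>k::nat. \<integral>x. (norm (\<phi> k x - u x))\<^sup>2 \<partial>M) \<longlonglongrightarrow> 0"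
    "(\<lambda>k. \<integral>x. (norm (gradient (\<phi> k) x - g x))\<^sup>2 \<partial>M) \<longlonglongrightarrow> 0"
proof -
  have ug: "sqint M u" "sqint M g"
    using assms by (auto simp: H1_0_def H1_def square_integrable_on_iff_sqint[OF \<Omega>] M_def)
  obtain \<phi> where \<phi>: "\<And>k. \<phi> k \<in> test_functions \<Omega>"
    and lim: "(\<lambda>k::nat. (\<integral>x. (u x - \<phi> k x)\<^sup>2 \<partial>M) + (\<integral>x. (norm (g x - gradient (\<phi> k) x))\<^sup>2 \<partial>M)) \<longlonglongrightarrow> 0"
    using assms by (auto simp: H1_0_def set_integral_eq_lebesgue_on[OF \<Omega>] M_def)
  show ?thesis
  proof (rule that[OF ug \<phi>])
    show "(\<lambda>k::nat. \<integral>x. (norm (\<phi> k x - u x))\<^sup>2 \<partial>M) \<longlonglongrightarrow> 0"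
    proof (rule Lim_null_comparison[OF always_eventually lim], rule allI)
      fix k
      have "0 \<le> (\<integral>x. (norm (g x - gradient (\<phi> k) x))\<^sup>2 \<partial>M)" by simp
      then show "norm (\<integral>x. (norm (\<phi> k x - u x))\<^sup>2 \<partial>M)
        \<le> (\<integral>x. (u x - \<phi> k x)\<^sup>2 \<partial>M) + (\<integral>x. (norm (g x - gradient (\<phi> k) x))\<^sup>2 \<partial>M)"
        by (simp add: power2_commute[of "\<phi> k _"])
    qed
    show "(\<lambda>k. \<integral>x. (norm (gradient (\<phi> k) x - g x))\<^sup>2 \<partial>M) \<longlonglongrightarrow> 0"
    proof (rule Lim_null_comparison[OF always_eventually lim], rule allI)
      fix k
      have "0 \<le> (\<integral>x. (u x - \<phi> k x)\<^sup>2 \<partial>M)" by simp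
      then show "norm (\<integral>x. (norm (gradient (\<phi> k) x - g x))\<^sup>2 \<partial>M)
        \<le> (\<integral>x. (u x - \<phi> k x)\<^sup>2 \<partial>M) + (\<integral>x. (norm (g x - gradient (\<phi> k) x))\<^sup>2 \<partial>M)"
        by (simp add: norm_minus_commute[of "gradient (\<phi> k) _"])
    qed
  qed
qed

lemma test_integral_M:
  assumes "\<phi> \<in> test_functions \<Omega>"
  shows "(\<integral>x. (norm (\<phi> x))\<^sup>2 \<partial>M) = (LBINT x. (\<phi> x)\<^sup>2)"
    "(\<integral>x. (norm (gradient \<phi> x))\<^sup>2 \<partial>M) = (LBINT x. (norm (gradient \<phi> x))\<^sup>2)"
proof -
  note [measurable] = test_measurable[OF assms]
  show "(\<integral>x. (norm (gradient \<phi> x))\<^sup>2 \<partial>M) = (LBINT x. (norm (gradient \<phi> x))\<^sup>2)"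
    unfolding M_def
    by (rule integral_lebesgue_on_eq_lborel[OF \<Omega>]) (auto simp: test_function_zero_outside[OF assms])
  have "(\<integral>x. (\<phi> x)\<^sup>2 \<partial>M) = (LBINT x. (\<phi> x)\<^sup>2)"
    unfolding M_def
    by (rule integral_lebesgue_on_eq_lborel[OF \<Omega>]) (auto simp: test_function_zero_outside[OF assms])
  then show "(\<integral>x. (norm (\<phi> x))\<^sup>2 \<partial>M) = (LBINT x. (\<phi> x)\<^sup>2)" by simp
qed

lemma poincare_H1_0:
  assumes "poincare \<Omega> m" "H1_0 \<Omega> u g"
  shows "m * (\<integral>x. (norm (u x))\<^sup>2 \<partial>M) \<le> (\<integral>x. (norm (g x))\<^sup>2 \<partial>M)"
proof -
  obtain \<phi> where u: "sqint M u" and g: "sqint M g" and \<phi>: "\<And>k. \<phi> k \<in> test_functions \<Omega>"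
    and lim: "(\<lambda>k::nat. \<integral>x. (norm (\<phi> k x - u x))\<^sup>2 \<partial>M) \<longlonglongrightarrow> 0"
    "(\<lambda>k. \<integral>x. (norm (gradient (\<phi> k) x - g x))\<^sup>2 \<partial>M) \<longlonglongrightarrow> 0"
    by (rule H1_0E[OF assms(2)]) blast
  show ?thesis
  proof (rule LIMSEQ_le)
    show "(\<lambda>k. m * (\<integral>x. (norm (\<phi> k x))\<^sup>2 \<partial>M)) \<longlonglongrightarrow> m * (\<integral>x. (norm (u x))\<^sup>2 \<partial>M)"
      by (intro tendsto_mult tendsto_const tendsto_integral_norm_squared[OF sqint_test_M(1)[OF \<phi>] u lim(1)])
    show "(\<lambda>k. \<integral>x. (norm (gradient (\<phi> k) x))\<^sup>2 \<partial>M) \<longlonglongrightarrow> (\<integral>x. (norm (g x))\<^sup>2 \<partial>M)"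
      by (rule tendsto_integral_norm_squared[OF sqint_test_M(2)[OF \<phi>] g lim(2)])
    show "\<exists>N. \<forall>k\<ge>N. m * (\<integral>x. (norm (\<phi> k x))\<^sup>2 \<partial>M) \<le> (\<integral>x. (norm (gradient (\<phi> k) x))\<^sup>2 \<partial>M)"
      using assms(1) \<phi> by (auto simp only: poincare_def test_integral_M[OF \<phi>])
  qed
qed

text \<open>Testing the weak equation with the eigenfunction itself shows that \<open>l\<close> is
  its Rayleigh quotient.\<close>

lemma dirichlet_eigenvalue_ge:
  assumes "poincare \<Omega> m" "dirichlet_eigenvalue \<Omega> l"
  shows "m \<le> l"
proof -
  obtain u g where ug: "H1_0 \<Omega> u g" and nz: "\<not> (AE x in lebesgue. x \<in> \<Omega> \<longrightarrow> u x = 0)"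
    and eq: "\<And>v h. H1_0 \<Omega> v h \<Longrightarrow> (LINT x:\<Omega>|lebesgue. g x \<bullet> h x) = l * (LINT x:\<Omega>|lebesgue. u x * v x)"
    using assms(2) by (auto simp: dirichlet_eigenvalue_def)
  have u: "sqint M u" by (rule H1_0E[OF ug]) blast
  have "(\<integral>x. (norm (g x))\<^sup>2 \<partial>M) = l * (\<integral>x. (norm (u x))\<^sup>2 \<partial>M)"
    using eq[OF ug] unfolding set_integral_eq_lebesgue_on[OF \<Omega>] M_def[symmetric] power2_norm_eq_inner by simp
  with poincare_H1_0[OF assms(1) ug]
  have "m * (\<integral>x. (norm (u x))\<^sup>2 \<partial>M) \<le> l * (\<integral>x. (norm (u x))\<^sup>2 \<partial>M)" by simp
  moreover have "(\<integral>x. (norm (u x))\<^sup>2 \<partial>M) > 0"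
  proof -
    have "(\<integral>x. (norm (u x))\<^sup>2 \<partial>M) \<noteq> 0"
    proof
      assume "(\<integral>x. (norm (u x))\<^sup>2 \<partial>M) = 0"
      then have "AE x in M. (norm (u x))\<^sup>2 = 0"
        using u by (subst (asm) integral_nonneg_eq_0_iff_AE) (auto simp: sqint_def)
      then have "AE x in M. u x = 0" by simp
      then have "AE x in lebesgue. x \<in> \<Omega> \<longrightarrow> u x = 0"
        unfolding M_def using \<Omega> by (subst (asm) AE_restrict_space_iff) auto
      with nz show False by simp
    qed
    moreover have "(\<integral>x. (norm (u x))\<^sup>2 \<partial>M) \<ge> 0" by simp
    ultimately show ?thesis by linarith
  qed
  ultimately show ?thesis by (simp add: mult_le_cancel_right_pos)
qed

end

section \<open>The first eigenvalue as a Poincare constant\<close>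

lemma integral_pos_on_ball:
  fixes f :: "'a::euclidean_space \<Rightarrow> real"
  assumes int: "integrable lborel f" and nonneg: "\<And>x. 0 \<le> f x"
    and \<rho>: "\<rho> > 0" and pos: "\<And>x. x \<in> ball c \<rho> \<Longrightarrow> 0 < f x"
  shows "0 < (LBINT x. f x)"
proof -
  have "(LBINT x. f x) \<noteq> 0"
  proof
    assume "(LBINT x. f x) = 0"
    then have "AE x in lborel. f x = 0"
      using int nonneg by (subst (asm) integral_nonneg_eq_0_iff_AE) auto
    then have "AE x in lborel. x \<notin> ball c \<rho>"
      by eventually_elim (use pos in fastforce)
    then have "emeasure lborel (ball c \<rho>) = 0"
      by (subst (asm) AE_iff_measurable[of "ball c \<rho>"]) auto
    then show False using content_ball_pos[OF \<rho>, of c] by (simp add: measure_def)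
  qed
  moreover have "0 \<le> (LBINT x. f x)" using nonneg by simp
  ultimately show ?thesis by linarith
qed

lemma bump_test_function:
  fixes \<Omega> :: "'a::euclidean_space set"
  assumes "open \<Omega>" "\<Omega> \<noteq> {}"
  obtains \<phi> where "\<phi> \<in> test_functions \<Omega>" "(LBINT x. (\<phi> x)\<^sup>2) > 0"
proof -
  obtain c where "c \<in> \<Omega>" using assms(2) by blast
  then obtain \<rho> where \<rho>: "\<rho> > 0" "cball c \<rho> \<subseteq> \<Omega>" using assms(1) open_contains_cball by blast
  define \<phi> where "\<phi> x = flat 1 (\<rho>\<^sup>2 + (- 1) * (norm (x - c))\<^sup>2)" for x
  have \<phi>: "\<phi> \<in> test_functions \<Omega>"
  proof (rule test_functionsI)
    show "C_k k \<phi>" for k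
      unfolding \<phi>_def by (intro C_k_compose[OF C_k_flat] C_k_add C_k_const C_k_mult C_k_norm_squared)
    show "compact (cball c \<rho>)" by simp
    show "cball c \<rho> \<subseteq> \<Omega>" by (rule \<rho>)
    fix x assume "x \<notin> cball c \<rho>"
    then have "\<rho> < norm (x - c)" by (simp add: dist_norm norm_minus_commute)
    then have "\<rho>\<^sup>2 \<le> (norm (x - c))\<^sup>2" using \<rho> by (intro power_mono) auto
    then show "\<phi> x = 0" by (simp add: \<phi>_def flat_def)
  qed
  have pos: "(\<phi> x)\<^sup>2 > 0" if "x \<in> ball c \<rho>" for x
  proof -
    have "norm (x - c) < \<rho>" using that by (simp add: dist_norm norm_minus_commute)
    then have "(norm (x - c))\<^sup>2 < \<rho>\<^sup>2" by (intro power_strict_mono) auto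
    then show ?thesis by (simp add: \<phi>_def flat_def)
  qed
  have int: "integrable lborel (\<lambda>x. (\<phi> x)\<^sup>2)"
    using sqint_test_function(1)[OF \<phi>] by (simp add: sqint_def)
  have "(LBINT x. (\<phi> x)\<^sup>2) > 0"
    by (rule integral_pos_on_ball[OF int _ \<rho>(1)]) (use pos in auto)
  with \<phi> show ?thesis by (rule that)
qed

section \<open>The minimisation problem\<close>

definition energy :: "('a::euclidean_space \<Rightarrow> real) \<Rightarrow> real" where
  "energy \<phi> = (LBINT x. (norm (gradient \<phi> x))\<^sup>2)"

definition mass :: "('a::euclidean_space \<Rightarrow> real) \<Rightarrow> real" where
  "mass \<phi> = (LBINT x. (\<phi> x)\<^sup>2)"

lemma mass_energy_scale:
  assumes "\<phi> \<in> test_functions \<Omega>"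
  shows "mass (\<lambda>x. c * \<phi> x) = c\<^sup>2 * mass \<phi>" "energy (\<lambda>x. c * \<phi> x) = c\<^sup>2 * energy \<phi>"
  by (simp_all add: mass_def energy_def gradient_scale[OF assms] power_mult_distrib)

lemma mass_energy_parallelogram:
  fixes \<phi> \<psi> :: "'a::euclidean_space \<Rightarrow> real"
  assumes \<phi>: "\<phi> \<in> test_functions \<Omega>" and \<psi>: "\<psi> \<in> test_functions \<Omega>"
  shows "mass (\<lambda>x. \<phi> x + \<psi> x) + (LBINT x. (\<phi> x - \<psi> x)\<^sup>2) = 2 * mass \<phi> + 2 * mass \<psi>"
    "energy (\<lambda>x. \<phi> x + \<psi> x) + (LBINT x. (norm (gradient \<phi> x - gradient \<psi> x))\<^sup>2) = 2 * energy \<phi> + 2 * energy \<psi>"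
proof -
  show "mass (\<lambda>x. \<phi> x + \<psi> x) + (LBINT x. (\<phi> x - \<psi> x)\<^sup>2) = 2 * mass \<phi> + 2 * mass \<psi>"
    using integral_norm_add_squared[OF sqint_test_function(1)[OF \<phi>] sqint_test_function(1)[OF \<psi>], of 1]
      integral_norm_add_squared[OF sqint_test_function(1)[OF \<phi>] sqint_test_function(1)[OF \<psi>], of "-1"]
    by (simp add: mass_def)
  show "energy (\<lambda>x. \<phi> x + \<psi> x) + (LBINT x. (norm (gradient \<phi> x - gradient \<psi> x))\<^sup>2) = 2 * energy \<phi> + 2 * energy \<psi>"
    using integral_norm_add_squared[OF sqint_test_function(2)[OF \<phi>] sqint_test_function(2)[OF \<psi>], of 1]
      integral_norm_add_squared[OF sqint_test_function(2)[OF \<phi>] sqint_test_function(2)[OF \<psi>], of "-1"]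
    by (simp add: energy_def gradient_add[OF \<phi> \<psi>])
qed

lemma mass_nonneg [simp]: "0 \<le> mass \<phi>" and energy_nonneg [simp]: "0 \<le> energy \<phi>"
  by (simp_all add: mass_def energy_def)

lemma poincare_iff: "poincare \<Omega> m \<longleftrightarrow> (\<forall>\<phi>\<in>test_functions \<Omega>. m * mass \<phi> \<le> energy \<phi>)"
  by (simp add: poincare_def mass_def energy_def)

text \<open>The end of the ray of admissible constants is the infimum of the energy over unit mass,
  and a normalised minimising sequence comes with it.\<close>

lemma poincare_constant_least:
  fixes \<Omega> :: "'a::euclidean_space set"
  assumes "open \<Omega>" "\<Omega> \<noteq> {}"
  obtains m \<phi> where "\<And>m'. poincare \<Omega> m' \<longleftrightarrow> m' \<le> m" "0 \<le> m"
    "\<And>k::nat. \<phi> k \<in> test_functions \<Omega>" "\<And>k. mass (\<phi> k) = 1" "\<And>k. energy (\<phi> k) < m + 1 / real (Suc k)"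
proof -
  define S where "S = {energy \<phi> | \<phi>. \<phi> \<in> test_functions \<Omega> \<and> mass \<phi> = 1}"
  have normalize: "energy \<phi> / mass \<phi> \<in> S" if \<phi>: "\<phi> \<in> test_functions \<Omega>" "mass \<phi> \<noteq> 0" for \<phi>
  proof -
    let ?c = "1 / sqrt (mass \<phi>)"
    have "mass (\<lambda>x. ?c * \<phi> x) = 1" "energy (\<lambda>x. ?c * \<phi> x) = energy \<phi> / mass \<phi>"
      using \<phi>(2) by (simp_all only: mass_energy_scale[OF \<phi>(1)] power_divide real_sqrt_pow2[OF mass_nonneg], simp_all)
    then show ?thesis unfolding S_def using test_functions_scale[OF \<phi>(1), of ?c] by (auto intro!: exI[of _ "\<lambda>x. ?c * \<phi> x"])
  qed
  obtain \<phi>0 where "\<phi>0 \<in> test_functions \<Omega>" "mass \<phi>0 > 0"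
    using bump_test_function[OF assms] by (auto simp: mass_def)
  then have ne: "S \<noteq> {}" using normalize[of \<phi>0] by auto
  have bdd: "bdd_below S" unfolding S_def by (rule bdd_belowI[of _ 0]) auto
  define m where "m = Inf S"
  have "\<exists>\<phi>. \<phi> \<in> test_functions \<Omega> \<and> mass \<phi> = 1 \<and> energy \<phi> < m + 1 / real (Suc k)" for k
  proof -
    have "Inf S < m + 1 / real (Suc k)" by (simp add: m_def)
    then obtain s where "s \<in> S" "s < m + 1 / real (Suc k)" using cInf_less_iff[OF ne bdd] by blast
    then show ?thesis unfolding S_def by blast
  qed
  then obtain \<phi> where \<phi>: "\<And>k. \<phi> k \<in> test_functions \<Omega>" "\<And>k. mass (\<phi> k) = 1"
    "\<And>k. energy (\<phi> k) < m + 1 / real (Suc k)" by metis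
  have poi: "poincare \<Omega> m' \<longleftrightarrow> m' \<le> m" for m'
  proof
    assume "poincare \<Omega> m'"
    then have "m' \<le> s" if "s \<in> S" for s using that by (auto simp: S_def poincare_iff)
    then show "m' \<le> m" unfolding m_def by (rule cInf_greatest[OF ne])
  next
    assume le: "m' \<le> m"
    show "poincare \<Omega> m'"
      unfolding poincare_iff
    proof
      fix \<phi> assume \<phi>: "\<phi> \<in> test_functions \<Omega>"
      show "m' * mass \<phi> \<le> energy \<phi>"
      proof (cases "mass \<phi> = 0")
        case False
        have "m' \<le> energy \<phi> / mass \<phi>"
          using le cInf_lower[OF normalize[OF \<phi> False] bdd] by (simp add: m_def)
        moreover have "mass \<phi> > 0" using False mass_nonneg[of \<phi>] by linarith
        ultimately show ?thesis by (simp add: pos_le_divide_eq)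
      qed simp
    qed
  qed
  have "0 \<le> m" unfolding m_def by (rule cInf_greatest[OF ne]) (auto simp: S_def)
  from poi this \<phi> show ?thesis by (rule that)
qed

text \<open>Rellich makes the functions Cauchy in L2; minimality together with the parallelogram law
  makes their gradients Cauchy as well. Both limits are therefore strong, and the limit pair is in
  \<open>H1_0\<close> with mass 1.\<close>

lemma dirichlet_eigenvalue_of_minimizing_sequence:
  fixes \<Omega> :: "'a::euclidean_space set"
  assumes \<Omega>: "open \<Omega>" "bounded \<Omega>" and m: "poincare \<Omega> m" "0 \<le> m"
    and \<phi>0: "\<And>k::nat. \<phi>0 k \<in> test_functions \<Omega>" "\<And>k. mass (\<phi>0 k) = 1"
    and energy0: "\<And>k. energy (\<phi>0 k) < m + 1 / real (Suc k)"
  shows "dirichlet_eigenvalue \<Omega> m"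
proof -
  have bound: "(LBINT x. (\<phi>0 k x)\<^sup>2) \<le> m + 1" "(LBINT x. (norm (gradient (\<phi>0 k) x))\<^sup>2) \<le> m + 1" for k
  proof -
    have "1 / real (Suc k) \<le> 1" by simp
    then have "energy (\<phi>0 k) \<le> m + 1" using energy0[of k] by linarith
    then show "(LBINT x. (\<phi>0 k x)\<^sup>2) \<le> m + 1" "(LBINT x. (norm (gradient (\<phi>0 k) x))\<^sup>2) \<le> m + 1"
      using \<phi>0(2)[of k] m(2) by (simp_all add: mass_def energy_def)
  qed
  obtain r :: "nat \<Rightarrow> nat" where r: "strict_mono r"
    and r_Cauchy: "\<And>e. e > 0 \<Longrightarrow> \<exists>n. \<forall>j\<ge>n. \<forall>k\<ge>n. (LBINT x. (\<phi>0 (r j) x - \<phi>0 (r k) x)\<^sup>2) < e"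
    by (rule rellich[where \<phi> = \<phi>0, OF \<Omega>(2) \<phi>0(1) bound]) blast
  define \<phi> where "\<phi> k = \<phi>0 (r k)" for k
  have \<phi>: "\<phi> k \<in> test_functions \<Omega>" "mass (\<phi> k) = 1" for k by (simp_all add: \<phi>_def \<phi>0)
  have energy: "energy (\<phi> k) < m + 1 / real (Suc k)" for k
  proof -
    have "1 / real (Suc (r k)) \<le> 1 / real (Suc k)"
      using seq_suble[OF r, of k] by (simp add: frac_le)
    then show ?thesis using energy0[of "r k"] by (simp add: \<phi>_def)
  qed
  have energy_ge: "m \<le> energy (\<phi> k)" for k
    using m(1) \<phi>[of k] by (fastforce simp: poincare_iff)
  \<comment> \<open>When two members are L2-close, their sum has mass near 4, so its energy is at
    least about \<open>4 * m\<close>. This nearly exhausts the parallelogram total, and little is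
    left for the difference of the gradients.\<close>
  have grad_diff: "(LBINT x. (norm (gradient (\<phi> j) x - gradient (\<phi> k) x))\<^sup>2)
     \<le> 2 / real (Suc j) + 2 / real (Suc k) + m * (LBINT x. (\<phi> j x - \<phi> k x)\<^sup>2)" for j k
  proof -
    have "m * mass (\<lambda>x. \<phi> j x + \<phi> k x) \<le> energy (\<lambda>x. \<phi> j x + \<phi> k x)"
      using m(1) test_functions_add[OF \<phi>(1) \<phi>(1)] by (simp add: poincare_iff)
    moreover have "mass (\<lambda>x. \<phi> j x + \<phi> k x) = 4 - (LBINT x. (\<phi> j x - \<phi> k x)\<^sup>2)"
      using mass_energy_parallelogram(1)[OF \<phi>(1) \<phi>(1), of j k] \<phi>(2) by simp
    ultimately have "4 * m - m * (LBINT x. (\<phi> j x - \<phi> k x)\<^sup>2) \<le> energy (\<lambda>x. \<phi> j x + \<phi> k x)"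
      by (simp add: right_diff_distrib mult.commute)
    moreover have "2 * energy (\<phi> j) + 2 * energy (\<phi> k) \<le> 4 * m + 2 / real (Suc j) + 2 / real (Suc k)"
    proof -
      have "2 / real (Suc i) = 2 * (1 / real (Suc i))" for i by simp
      from this[of j] this[of k] show ?thesis using energy[of j] energy[of k] by linarith
    qed
    ultimately show ?thesis
      using mass_energy_parallelogram(2)[OF \<phi>(1) \<phi>(1), of j k] by linarith
  qed
  let ?M = "lebesgue_on \<Omega>"
  note [measurable] = test_measurable[OF \<phi>(1)]
  have diff_M: "(\<integral>x. (norm (\<phi> j x - \<phi> k x))\<^sup>2 \<partial>?M) = (LBINT x. (\<phi> j x - \<phi> k x)\<^sup>2)"
    "(\<integral>x. (norm (gradient (\<phi> j) x - gradient (\<phi> k) x))\<^sup>2 \<partial>?M)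
      = (LBINT x. (norm (gradient (\<phi> j) x - gradient (\<phi> k) x))\<^sup>2)" for j k
  proof -
    show "(\<integral>x. (norm (\<phi> j x - \<phi> k x))\<^sup>2 \<partial>?M) = (LBINT x. (\<phi> j x - \<phi> k x)\<^sup>2)"
      unfolding real_norm_def power2_abs
      by (rule integral_lebesgue_on_eq_lborel[OF \<Omega>(1)])
         (measurable, simp add: test_function_zero_outside[OF \<phi>(1)])
    show "(\<integral>x. (norm (gradient (\<phi> j) x - gradient (\<phi> k) x))\<^sup>2 \<partial>?M)
      = (LBINT x. (norm (gradient (\<phi> j) x - gradient (\<phi> k) x))\<^sup>2)"
      by (rule integral_lebesgue_on_eq_lborel[OF \<Omega>(1)])
         (measurable, simp add: test_function_zero_outside[OF \<phi>(1)])
  qed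
  have Cauchy_u: "\<exists>n. \<forall>j\<ge>n. \<forall>k\<ge>n. (\<integral>x. (norm (\<phi> j x - \<phi> k x))\<^sup>2 \<partial>?M) < e" if "e > 0" for e
    using r_Cauchy[OF that] by (simp only: diff_M) (simp add: \<phi>_def)
  obtain u where u: "sqint ?M u" and lim_u: "(\<lambda>k. \<integral>x. (norm (\<phi> k x - u x))\<^sup>2 \<partial>?M) \<longlonglongrightarrow> 0"
    by (rule L2_complete[where F = \<phi>, OF sqint_test_M(1)[OF \<Omega>(1) \<phi>(1)] Cauchy_u]) blast
  have Cauchy_g: "\<exists>n. \<forall>j\<ge>n. \<forall>k\<ge>n. (\<integral>x. (norm (gradient (\<phi> j) x - gradient (\<phi> k) x))\<^sup>2 \<partial>?M) < e" if e: "e > 0" for e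
  proof -
    \<comment> \<open>The denominator uses \<open>m + 1\<close> because \<open>m\<close> may be
      0.\<close>
    obtain n1 where n1: "\<And>j k. j \<ge> n1 \<Longrightarrow> k \<ge> n1 \<Longrightarrow> (LBINT x. (\<phi> j x - \<phi> k x)\<^sup>2) < e / (3 * (m + 1))"
      using r_Cauchy[of "e / (3 * (m + 1))"] e m(2) by (auto simp: \<phi>_def)
    have "(\<lambda>k. 2 / real (Suc k)) \<longlonglongrightarrow> 0"
      using LIMSEQ_Suc[OF lim_const_over_n[of 2]] by simp
    then have "\<forall>\<^sub>F k in sequentially. 2 / real (Suc k) < e / 3" using e by (intro order_tendstoD) auto
    then obtain n2 where n2: "\<And>k. k \<ge> n2 \<Longrightarrow> 2 / real (Suc k) < e / 3" by (auto simp: eventually_sequentially)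
    have "(\<integral>x. (norm (gradient (\<phi> j) x - gradient (\<phi> k) x))\<^sup>2 \<partial>?M) < e" if "j \<ge> max n1 n2" "k \<ge> max n1 n2" for j k
    proof -
      let ?d = "LBINT x. (\<phi> j x - \<phi> k x)\<^sup>2"
      have "m * ?d \<le> (m + 1) * ?d" by (intro mult_right_mono) auto
      also have "\<dots> \<le> (m + 1) * (e / (3 * (m + 1)))"
        using n1[of j k] that m(2) by (intro mult_left_mono) auto
      also have "\<dots> = e / 3"
      proof -
        have "q * (e / (3 * q)) = e / 3" if "q > 0" for q :: real using that by simp
        from this[of "m + 1"] show ?thesis using m(2) by linarith
      qed
      finally show ?thesis
        unfolding diff_M using grad_diff[of j k] n2[of j] n2[of k] that by linarith
    qed
    then show ?thesis by blast
  qed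
  obtain g where g: "sqint ?M g"
    and lim_g: "(\<lambda>k. \<integral>x. (norm (gradient (\<phi> k) x - g x))\<^sup>2 \<partial>?M) \<longlonglongrightarrow> 0"
    by (rule L2_complete[where F = "\<lambda>k. gradient (\<phi> k)", OF sqint_test_M(2)[OF \<Omega>(1) \<phi>(1)] Cauchy_g]) blast
  have ug: "H1_0 \<Omega> u g"
    by (rule H1_0I[OF \<Omega>(1) u g \<phi>(1) lim_u lim_g])
  have mass_M: "(\<integral>x. (norm (\<phi> k x))\<^sup>2 \<partial>?M) = 1"
    and energy_M: "(\<integral>x. (norm (gradient (\<phi> k) x))\<^sup>2 \<partial>?M) = energy (\<phi> k)" for k
    using test_integral_M[OF \<Omega>(1) \<phi>(1)[of k]] \<phi>(2)[of k] unfolding mass_def energy_def by simp_all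
  have mass_u: "(\<integral>x. (norm (u x))\<^sup>2 \<partial>?M) = 1"
    using tendsto_integral_norm_squared[OF sqint_test_M(1)[OF \<Omega>(1) \<phi>(1)] u lim_u]
    unfolding mass_M by (simp add: LIMSEQ_const_iff)
  have energy_lim: "(\<lambda>k. energy (\<phi> k)) \<longlonglongrightarrow> m"
  proof (rule tendsto_sandwich[where f = "\<lambda>_. m" and h = "\<lambda>k. m + 1 / real (Suc k)"])
    show "(\<lambda>k. m + 1 / real (Suc k)) \<longlonglongrightarrow> m"
      using tendsto_add[OF tendsto_const[of m] LIMSEQ_Suc[OF lim_1_over_n]] by simp
    show "\<forall>\<^sub>F k in sequentially. energy (\<phi> k) \<le> m + 1 / real (Suc k)"
      using energy by (intro always_eventually allI less_imp_le)
  qed (use energy_ge in auto)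
  \<comment> \<open>Energy minus \<open>m\<close> times mass is nonnegative at \<phi>_k + t \<psi>.
    In the limit its constant term vanishes, which forces the linear coefficient \<open>?b\<close>
    to vanish too.\<close>
  have test_eq: "(\<integral>x. g x \<bullet> gradient \<psi> x \<partial>?M) = m * (\<integral>x. u x \<bullet> \<psi> x \<partial>?M)" if \<psi>: "\<psi> \<in> test_functions \<Omega>" for \<psi>
  proof -
    let ?b = "(\<integral>x. g x \<bullet> gradient \<psi> x \<partial>?M) - m * (\<integral>x. u x \<bullet> \<psi> x \<partial>?M)"
    let ?c = "(\<integral>x. (norm (gradient \<psi> x))\<^sup>2 \<partial>?M) - m * (\<integral>x. (norm (\<psi> x))\<^sup>2 \<partial>?M)"
    let ?Q = "\<lambda>t k. (energy (\<phi> k) - m) + 2 * t * ((\<integral>x. gradient (\<phi> k) x \<bullet> gradient \<psi> x \<partial>?M) - m * (\<integral>x. \<phi> k x \<bullet> \<psi> x \<partial>?M)) + t\<^sup>2 * ?c"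
    note sq = sqint_test_M[OF \<Omega>(1) \<phi>(1)] sqint_test_M[OF \<Omega>(1) \<psi>]
    have "0 \<le> 0 + 2 * t * ?b + t\<^sup>2 * ?c" for t
    proof (rule LIMSEQ_le_const)
      have "(\<lambda>k. ?Q t k)
         \<longlonglongrightarrow> (m - m) + 2 * t * ?b + t\<^sup>2 * ?c"
        by (intro tendsto_intros energy_lim tendsto_integral_inner[OF sq(1) u sq(3) lim_u]
              tendsto_integral_inner[OF sq(2) g sq(4) lim_g])
      then show "(\<lambda>k. ?Q t k)
         \<longlonglongrightarrow> 0 + 2 * t * ?b + t\<^sup>2 * ?c" by simp
      have "0 \<le> ?Q t k" for k
      proof -
        have t\<psi>: "(\<lambda>x. t * \<psi> x) \<in> test_functions \<Omega>" by (rule test_functions_scale[OF \<psi>])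
        have sum: "(\<lambda>x. \<phi> k x + t * \<psi> x) \<in> test_functions \<Omega>" by (rule test_functions_add[OF \<phi>(1) t\<psi>])
        have "m * (\<integral>x. (norm (\<phi> k x + t * \<psi> x))\<^sup>2 \<partial>?M) \<le> (\<integral>x. (norm (gradient (\<lambda>x. \<phi> k x + t * \<psi> x) x))\<^sup>2 \<partial>?M)"
          unfolding test_integral_M[OF \<Omega>(1) sum] using m(1) sum by (simp add: poincare_def)
        also have "(\<lambda>x. gradient (\<lambda>x. \<phi> k x + t * \<psi> x) x) = (\<lambda>x. gradient (\<phi> k) x + t *\<^sub>R gradient \<psi> x)"
          using gradient_add[OF \<phi>(1) t\<psi>] gradient_scale[OF \<psi>] by auto
        also have "(\<integral>x. (norm (gradient (\<phi> k) x + t *\<^sub>R gradient \<psi> x))\<^sup>2 \<partial>?M) = energy (\<phi> k)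
            + 2 * t * (\<integral>x. gradient (\<phi> k) x \<bullet> gradient \<psi> x \<partial>?M) + t\<^sup>2 * (\<integral>x. (norm (gradient \<psi> x))\<^sup>2 \<partial>?M)"
          unfolding energy_M[symmetric] by (rule integral_norm_add_squared[OF sq(2) sq(4)])
        also have "(\<integral>x. (norm (\<phi> k x + t * \<psi> x))\<^sup>2 \<partial>?M) = 1
            + 2 * t * (\<integral>x. \<phi> k x \<bullet> \<psi> x \<partial>?M) + t\<^sup>2 * (\<integral>x. (norm (\<psi> x))\<^sup>2 \<partial>?M)"
          using integral_norm_add_squared[OF sq(1) sq(3), of k t] unfolding mass_M by simp
        finally show ?thesis by (simp add: algebra_simps)
      qed
      then show "\<exists>N. \<forall>k\<ge>N. 0 \<le> ?Q t k"
        by blast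
    qed
    then have "?b\<^sup>2 \<le> 0 * ?c" by (rule quadratic_nonneg_discriminant)
    then show ?thesis by simp
  qed
  \<comment> \<open>Both sides are continuous in the H1 norm, so the equation passes from test
    functions to their closure.\<close>
  have eigen: "(\<integral>x. g x \<bullet> h x \<partial>?M) = m * (\<integral>x. u x \<bullet> v x \<partial>?M)" if "H1_0 \<Omega> v h" for v h
  proof -
    obtain \<psi> where v: "sqint ?M v" and h: "sqint ?M h" and \<psi>: "\<And>k. \<psi> k \<in> test_functions \<Omega>"
      and lim: "(\<lambda>k::nat. \<integral>x. (norm (\<psi> k x - v x))\<^sup>2 \<partial>?M) \<longlonglongrightarrow> 0"
      "(\<lambda>k. \<integral>x. (norm (gradient (\<psi> k) x - h x))\<^sup>2 \<partial>?M) \<longlonglongrightarrow> 0"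
      by (rule H1_0E[OF \<Omega>(1) \<open>H1_0 \<Omega> v h\<close>]) blast
    note sq = sqint_test_M[OF \<Omega>(1) \<psi>]
    have l1: "(\<lambda>k. m * (\<integral>x. \<psi> k x \<bullet> u x \<partial>?M)) \<longlonglongrightarrow> m * (\<integral>x. v x \<bullet> u x \<partial>?M)"
      by (intro tendsto_intros tendsto_integral_inner[OF sq(1) v u lim(1)])
    have l2: "(\<lambda>k. \<integral>x. gradient (\<psi> k) x \<bullet> g x \<partial>?M) \<longlonglongrightarrow> (\<integral>x. h x \<bullet> g x \<partial>?M)"
      by (rule tendsto_integral_inner[OF sq(2) h g lim(2)])
    have eq: "(\<integral>x. gradient (\<psi> k) x \<bullet> g x \<partial>?M) = m * (\<integral>x. \<psi> k x \<bullet> u x \<partial>?M)" for k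
      using test_eq[OF \<psi>[of k]] by (simp add: inner_commute mult.commute)
    from l2 have "(\<integral>x. h x \<bullet> g x \<partial>?M) = m * (\<integral>x. v x \<bullet> u x \<partial>?M)"
      unfolding eq using l1 by (rule LIMSEQ_unique)
    then show ?thesis by (simp add: inner_commute mult.commute)
  qed
  have "\<not> (AE x in lebesgue. x \<in> \<Omega> \<longrightarrow> u x = 0)"
  proof
    assume "AE x in lebesgue. x \<in> \<Omega> \<longrightarrow> u x = 0"
    then have "AE x in ?M. u x = 0"
      using \<Omega>(1) by (subst AE_restrict_space_iff) auto
    then have "(\<integral>x. (norm (u x))\<^sup>2 \<partial>?M) = (\<integral>x. 0 \<partial>?M)"
      using u by (intro integral_cong_AE) (auto simp: sqint_def)
    then show False using mass_u by simp
  qed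
  moreover have "(LINT x:\<Omega>|lebesgue. g x \<bullet> h x) = m * (LINT x:\<Omega>|lebesgue. u x * v x)" if "H1_0 \<Omega> v h" for v h
    using eigen[OF that] by (simp add: set_integral_eq_lebesgue_on[OF \<Omega>(1)])
  ultimately show ?thesis
    unfolding dirichlet_eigenvalue_def using ug by blast
qed

text \<open>\<open>LEAST\<close> is meaningful on the reals once a minimum is attained: the optimal
  constant is itself an eigenvalue, and every eigenvalue lies above it.\<close>

theorem poincare_iff_le_lambda1:
  fixes \<Omega> :: "'a::euclidean_space set"
  assumes "open \<Omega>" "bounded \<Omega>" "\<Omega> \<noteq> {}"
  shows "poincare \<Omega> m' \<longleftrightarrow> m' \<le> lambda1 \<Omega>"
proof -
  obtain m \<phi> where m: "\<And>m'. poincare \<Omega> m' \<longleftrightarrow> m' \<le> m" "0 \<le> m"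
    and \<phi>: "\<And>k::nat. \<phi> k \<in> test_functions \<Omega>" "\<And>k. mass (\<phi> k) = 1" "\<And>k. energy (\<phi> k) < m + 1 / real (Suc k)"
    by (rule poincare_constant_least[OF assms(1,3)]) blast
  have "poincare \<Omega> m" using m(1) by simp
  then have "dirichlet_eigenvalue \<Omega> m"
    by (rule dirichlet_eigenvalue_of_minimizing_sequence[OF assms(1,2) _ m(2) \<phi>])
  then have "lambda1 \<Omega> = m"
    unfolding lambda1_def
    by (rule Least_equality) (rule dirichlet_eigenvalue_ge[OF assms(1) \<open>poincare \<Omega> m\<close>])
  then show ?thesis using m(1) by simp
qed

section \<open>Neighbour sums and killed averages\<close>

text \<open>With \<open>X = \<alpha> i * \<beta> j\<close> and \<open>Y = \<alpha> j * \<beta> i\<close> both at most \<open>k = M * K i j\<close>, expanding \<open>(k - X) * (k - Y) \<ge> 0\<close>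
  gives \<open>X + Y \<le> k + X * Y / k\<close>, and \<open>X * Y\<close> is controlled by the diagonal. The loss is quadratic in \<open>\<delta>\<close>,
  so of fourth order in the mesh.\<close>

lemma product_of_sums_le:
  fixes \<alpha> \<beta> c :: "'i \<Rightarrow> real" and K :: "'i \<Rightarrow> 'i \<Rightarrow> real"
  assumes nonneg: "\<And>i. i \<in> I \<Longrightarrow> 0 \<le> \<alpha> i" "\<And>i. i \<in> I \<Longrightarrow> 0 \<le> \<beta> i" "\<And>i. i \<in> I \<Longrightarrow> 0 \<le> c i" and M: "0 \<le> M"
    and le: "\<And>i j. i \<in> I \<Longrightarrow> j \<in> I \<Longrightarrow> \<alpha> i * \<beta> j \<le> M * K i j" and sym: "\<And>i j. K i j = K j i"
    and diag: "\<And>i. i \<in> I \<Longrightarrow> K i i = (c i)\<^sup>2"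
    and near: "\<And>i j. i \<in> I \<Longrightarrow> j \<in> I \<Longrightarrow> \<bar>K i j - c i * c j\<bar> \<le> \<delta>"
    and K: "0 < \<kappa>" "\<And>i j. i \<in> I \<Longrightarrow> j \<in> I \<Longrightarrow> \<kappa> \<le> K i j"
  shows "(\<Sum>i\<in>I. \<alpha> i) * (\<Sum>i\<in>I. \<beta> i) \<le> M * ((\<Sum>i\<in>I. c i)\<^sup>2 + (real (card I))\<^sup>2 * \<delta>\<^sup>2 / \<kappa>)"
proof -
  have pair: "\<alpha> i * \<beta> j + \<alpha> j * \<beta> i \<le> M * (2 * (c i * c j) + \<delta>\<^sup>2 / \<kappa>)" if ij: "i \<in> I" "j \<in> I" for i j
  proof (cases "M = 0")
    case True
    then show ?thesis using le[OF ij] le[OF ij(2,1)] by simp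
  next
    case False
    then have M': "M > 0" using M by simp
    define X Y k p where "X = \<alpha> i * \<beta> j" "Y = \<alpha> j * \<beta> i" "k = K i j" "p = c i * c j"
    note defs = X_Y_k_p_def
    have k: "\<kappa> \<le> k" "0 < k" using K(2)[OF ij] K(1) by (auto simp: defs)
    have "X \<le> M * k" "Y \<le> M * k" using le[OF ij] le[OF ij(2,1)] sym[of i j] by (auto simp: defs)
    then have "0 \<le> (M * k - X) * (M * k - Y)" by simp
    moreover have "X * Y \<le> M\<^sup>2 * p\<^sup>2"
    proof -
      have "X * Y = (\<alpha> i * \<beta> i) * (\<alpha> j * \<beta> j)" by (simp add: defs)
      also have "\<dots> \<le> (M * (c i)\<^sup>2) * (M * (c j)\<^sup>2)"
        by (rule mult_mono) (use le[of i i] le[of j j] ij nonneg M in \<open>auto simp: diag\<close>)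
      finally show ?thesis by (simp add: defs power2_eq_square mult_ac)
    qed
    ultimately have "M * (k * (X + Y)) \<le> M * (M * (k\<^sup>2 + p\<^sup>2))"
      by (simp add: power2_eq_square algebra_simps)
    then have "k * (X + Y) \<le> M * (k\<^sup>2 + p\<^sup>2)" using M' by (simp add: mult_le_cancel_left_pos)
    also have "\<dots> = M * (2 * p * k + (k - p)\<^sup>2)" by (simp add: power2_eq_square algebra_simps)
    finally have 1: "k * (X + Y) \<le> M * (2 * p * k + (k - p)\<^sup>2)" .
    have "(k - p)\<^sup>2 \<le> \<delta>\<^sup>2" using near[OF ij] by (simp add: defs abs_le_square_iff[symmetric])
    also have "\<delta>\<^sup>2 \<le> k * (\<delta>\<^sup>2 / \<kappa>)" using k K(1) mult_right_mono[OF k(1), of "\<delta>\<^sup>2 / \<kappa>"] by simp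
    finally have "M * (2 * p * k + (k - p)\<^sup>2) \<le> M * (2 * p * k + k * (\<delta>\<^sup>2 / \<kappa>))"
      using M by (intro mult_left_mono) auto
    with 1 have "k * (X + Y) \<le> k * (M * (2 * p + \<delta>\<^sup>2 / \<kappa>))" by (simp add: algebra_simps)
    then have "X + Y \<le> M * (2 * p + \<delta>\<^sup>2 / \<kappa>)" using k(2) by (simp add: mult_le_cancel_left_pos)
    then show ?thesis by (simp add: defs)
  qed
  \<comment> \<open>Symmetrise the double sum, since only \<alpha>_i \<beta>_j + \<alpha>_j
    \<beta>_i is bounded well.\<close>
  have dbl: "2 * ((\<Sum>i\<in>I. \<alpha> i) * (\<Sum>i\<in>I. \<beta> i)) = (\<Sum>i\<in>I. \<Sum>j\<in>I. \<alpha> i * \<beta> j + \<alpha> j * \<beta> i)"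
    by (simp add: sum.distrib sum_product sum.swap[of "\<lambda>i j. \<alpha> j * \<beta> i"])
  have "(\<Sum>i\<in>I. \<Sum>j\<in>I. \<alpha> i * \<beta> j + \<alpha> j * \<beta> i) \<le> (\<Sum>i\<in>I. \<Sum>j\<in>I. M * (2 * (c i * c j) + \<delta>\<^sup>2 / \<kappa>))"
    by (intro sum_mono pair)
  also have "\<dots> = M * (2 * (\<Sum>i\<in>I. c i)\<^sup>2 + (real (card I))\<^sup>2 * (\<delta>\<^sup>2 / \<kappa>))"
    by (simp add: sum.distrib sum_product power2_eq_square mult.assoc flip: sum_distrib_left)
  also have "\<dots> \<le> M * (2 * (\<Sum>i\<in>I. c i)\<^sup>2 + 2 * ((real (card I))\<^sup>2 * (\<delta>\<^sup>2 / \<kappa>)))"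
  proof (rule mult_left_mono[OF _ M])
    have "0 \<le> (real (card I))\<^sup>2 * (\<delta>\<^sup>2 / \<kappa>)" using K(1) by simp
    then show "2 * (\<Sum>i\<in>I. c i)\<^sup>2 + (real (card I))\<^sup>2 * (\<delta>\<^sup>2 / \<kappa>)
      \<le> 2 * (\<Sum>i\<in>I. c i)\<^sup>2 + 2 * ((real (card I))\<^sup>2 * (\<delta>\<^sup>2 / \<kappa>))" by linarith
  qed
  also have "\<dots> = 2 * (M * ((\<Sum>i\<in>I. c i)\<^sup>2 + (real (card I))\<^sup>2 * \<delta>\<^sup>2 / \<kappa>))"
    by (simp add: algebra_simps)
  finally show ?thesis unfolding dbl[symmetric] by (subst (asm) mult_le_cancel_left_pos) auto
qed

text \<open>Successive ratios do not decrease, so an initial ratio above \<open>Q\<close> would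
  persist and eventually beat \<open>C * Q ^ k\<close>. The constant \<open>C\<close> disappears
  from the conclusion, so a crude prefactor in a bound on iterates does no harm.\<close>

lemma log_convex_growth:
  fixes a :: "nat \<Rightarrow> real"
  assumes nonneg: "\<And>k. 0 \<le> a k" and convex: "\<And>k. (a (Suc k))\<^sup>2 \<le> a k * a (Suc (Suc k))"
    and bound: "\<And>k. a k \<le> C * Q ^ k" and Q: "Q > 0"
  shows "a 1 \<le> Q * a 0"
proof (rule ccontr)
  assume neg: "\<not> a 1 \<le> Q * a 0"
  have a0: "a 0 > 0"
  proof (rule ccontr)
    assume "\<not> a 0 > 0"
    then have "a 0 = 0" using nonneg[of 0] by simp
    then show False using convex[of 0] neg by simp
  qed
  define \<rho> where "\<rho> = a 1 / a 0"
  have \<rho>: "\<rho> > Q" using neg a0 by (simp add: \<rho>_def pos_less_divide_eq)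
  have step: "a k > 0 \<and> a (Suc k) \<ge> \<rho> * a k" for k
  proof (induction k)
    case 0
    then show ?case using a0 by (simp add: \<rho>_def)
  next
    case (Suc k)
    have pos: "a (Suc k) > 0" using Suc \<rho> Q mult_pos_pos[of \<rho> "a k"] by linarith
    have "\<rho> * a (Suc k) * a k = (\<rho> * a k) * a (Suc k)" by simp
    also have "\<dots> \<le> a (Suc k) * a (Suc k)" using Suc pos by (intro mult_right_mono) auto
    also have "\<dots> \<le> a (Suc (Suc k)) * a k" using convex[of k] by (simp add: power2_eq_square mult.commute)
    finally have "\<rho> * a (Suc k) \<le> a (Suc (Suc k))" using Suc by (simp add: mult_le_cancel_right_pos)
    with pos show ?case by simp
  qed
  have low: "\<rho> ^ k * a 0 \<le> a k" for k
  proof (induction k)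
    case (Suc k)
    have "\<rho> ^ Suc k * a 0 = \<rho> * (\<rho> ^ k * a 0)" by simp
    also have "\<dots> \<le> \<rho> * a k" using Suc \<rho> Q by (intro mult_left_mono) auto
    also have "\<dots> \<le> a (Suc k)" using step by simp
    finally show ?case .
  qed simp
  have "1 < \<rho> / Q" using \<rho> Q by simp
  then obtain k where k: "C / a 0 < (\<rho> / Q) ^ k" using real_arch_pow by blast
  have "\<rho> ^ k * a 0 \<le> C * Q ^ k" using low[of k] bound[of k] by linarith
  then have "(\<rho> / Q) ^ k \<le> C / a 0" using a0 Q by (simp add: power_divide divide_simps mult.commute)
  with k show False by simp
qed

section \<open>Lattice operators\<close>

definition dirs :: "('a::euclidean_space \<times> real) set" where
  "dirs = Basis \<times> {1, -1}"

definition shift :: "real \<Rightarrow> 'a::euclidean_space \<times> real \<Rightarrow> 'a" where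
  "shift h i = (h * snd i) *\<^sub>R fst i"

lemma finite_dirs [simp]: "finite dirs" and card_dirs: "card (dirs :: ('a::euclidean_space \<times> real) set) = 2 * DIM('a)"
  by (auto simp: dirs_def card_cartesian_product)

lemma norm_shift: "i \<in> dirs \<Longrightarrow> 0 \<le> h \<Longrightarrow> norm (shift h i) = h"
  by (auto simp: dirs_def shift_def)

lemma sum_dirs: "(\<Sum>i\<in>dirs. F (shift h i)) = (\<Sum>b\<in>Basis. F (h *\<^sub>R b) + F (- (h *\<^sub>R b)))"
proof -
  have "(\<Sum>i\<in>dirs. F (shift h i)) = (\<Sum>b\<in>Basis. \<Sum>s\<in>{1, -1}. F ((h * s) *\<^sub>R b))"
    unfolding dirs_def shift_def sum.cartesian_product by (simp only: split_beta')
  then show ?thesis by simp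
qed

lemma sum_dirs_minus: "(\<Sum>i\<in>dirs. F (- shift h i)) = (\<Sum>i\<in>dirs. F (shift h i))"
  using sum_dirs[of "\<lambda>v. F (- v)" h] sum_dirs[of F h] by (simp add: add.commute)

definition neighbour_sum :: "real \<Rightarrow> ('a::euclidean_space \<Rightarrow> real) \<Rightarrow> 'a \<Rightarrow> real" where
  "neighbour_sum h u x = (\<Sum>i\<in>dirs. u (x + shift h i))"

text \<open>The sum is not divided by the number 2N of neighbours; the normalisation sits in the
  growth rate \<open>q\<close>, which is 2N up to a term of order h^2.\<close>

definition killed_step :: "'a::euclidean_space set \<Rightarrow> real \<Rightarrow> ('a \<Rightarrow> real) \<Rightarrow> 'a \<Rightarrow> real" where
  "killed_step \<Omega> h u x = indicator \<Omega> x * neighbour_sum h u x"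

lemma sqint_sum:
  assumes "\<And>i. i \<in> I \<Longrightarrow> sqint M (F i)"
  shows "sqint M (\<lambda>x. \<Sum>i\<in>I. F i x)"
  using assms
proof (induction I rule: infinite_finite_induct)
  case (insert i I)
  then show ?case using sqint_add[of M "F i" "\<lambda>x. \<Sum>i\<in>I. F i x"] by simp
qed (auto simp: sqint_def)

lemma sqint_neighbour_sum: "sqint lborel u \<Longrightarrow> sqint lborel (neighbour_sum h u)"
  unfolding neighbour_sum_def[abs_def] by (intro sqint_sum sqint_translate)

lemma sqint_indicator:
  fixes u :: "'a::euclidean_space \<Rightarrow> real"
  assumes "\<Omega> \<in> sets borel" "sqint lborel u"
  shows "sqint lborel (\<lambda>x. indicator \<Omega> x * u x)"
proof -
  have "(\<lambda>x. (norm (indicator \<Omega> x * u x))\<^sup>2) = (\<lambda>x. indicator \<Omega> x *\<^sub>R (norm (u x))\<^sup>2)"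
    by (auto simp: indicator_def)
  moreover have "integrable lborel (\<lambda>x. indicator \<Omega> x *\<^sub>R (norm (u x))\<^sup>2)"
    using assms by (intro integrable_mult_indicator) (auto simp: sqint_def)
  moreover have "(\<lambda>x. indicator \<Omega> x * u x) \<in> borel_measurable lborel"
    using assms by (auto simp: sqint_def)
  ultimately show ?thesis by (simp add: sqint_def)
qed

lemma sqint_killed_step: "\<Omega> \<in> sets borel \<Longrightarrow> sqint lborel u \<Longrightarrow> sqint lborel (killed_step \<Omega> h u)"
  unfolding killed_step_def[abs_def] by (intro sqint_indicator sqint_neighbour_sum)

lemma integral_neighbour_sum:
  fixes u v :: "'a::euclidean_space \<Rightarrow> real"
  assumes "sqint lborel u" "sqint lborel v"
  shows "(LBINT x. u x * neighbour_sum h v x) = (\<Sum>i\<in>dirs. LBINT x. u x * v (x + shift h i))"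
proof -
  have "integrable lborel (\<lambda>x. u x * v (x + c))" for c
    using sqint_inner[OF assms(1) sqint_translate[OF assms(2)]] by simp
  then show ?thesis
    by (simp add: neighbour_sum_def sum_distrib_left Bochner_Integration.integral_sum)
qed

text \<open>Translating each integral moves the shift to the other factor with reversed sign, and
  the set of directions is symmetric.\<close>

lemma neighbour_sum_selfadjoint:
  fixes u v :: "'a::euclidean_space \<Rightarrow> real"
  assumes u: "sqint lborel u" and v: "sqint lborel v"
  shows "(LBINT x. u x * neighbour_sum h v x) = (LBINT x. neighbour_sum h u x * v x)"
proof -
  have [measurable]: "u \<in> borel_measurable borel" "v \<in> borel_measurable borel"
    using u v by (auto simp: sqint_def)
  have sh: "(LBINT x. u x * v (x + c)) = (LBINT x. v x * u (x + - c))" for c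
    using lborel_integral_translate[of "\<lambda>x. v x * u (x + - c)" c] by (simp add: mult.commute)
  have "(LBINT x. u x * neighbour_sum h v x) = (\<Sum>i\<in>dirs. LBINT x. v x * u (x + - shift h i))"
    by (simp only: integral_neighbour_sum[OF u v] sh)
  also have "\<dots> = (\<Sum>i\<in>dirs. LBINT x. v x * u (x + shift h i))"
    by (rule sum_dirs_minus)
  also have "\<dots> = (LBINT x. v x * neighbour_sum h u x)"
    by (simp only: integral_neighbour_sum[OF v u])
  finally show ?thesis by (simp add: mult.commute)
qed

text \<open>Converts an upper bound \<open>q\<close> for the quadratic form of the neighbour sum
  into the lower bound 2N - q for the discrete Dirichlet energy.\<close>

lemma Dirichlet_form_neighbour_sum:
  fixes u :: "'a::euclidean_space \<Rightarrow> real"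
  assumes u: "sqint lborel u"
  shows "(\<Sum>b\<in>Basis. LBINT x. (u (x + h *\<^sub>R b) - u x)\<^sup>2)
     = 2 * DIM('a) * (LBINT x. (u x)\<^sup>2) - (LBINT x. u x * neighbour_sum h u x)"
proof -
  have [measurable]: "u \<in> borel_measurable borel"
    using u by (auto simp: sqint_def)
  have sq: "(LBINT x. (u (x + c) - u x)\<^sup>2) = 2 * (LBINT x. (u x)\<^sup>2) - 2 * (LBINT x. u x * u (x + c))" for c
    using integral_norm_add_squared[OF sqint_translate[OF u, of c] u, of "-1"]
      lborel_integral_translate[of "\<lambda>x. (u x)\<^sup>2" c] by (simp add: mult.commute)
  have sh: "(LBINT x. u x * u (x + - c)) = (LBINT x. u x * u (x + c))" for c
    using lborel_integral_translate[of "\<lambda>x. u x * u (x + - c)" c] by (simp add: mult.commute)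
  have "(LBINT x. u x * neighbour_sum h u x) = (\<Sum>b\<in>Basis. 2 * (LBINT x. u x * u (x + h *\<^sub>R b)))"
    unfolding integral_neighbour_sum[OF u u] sum_dirs[of "\<lambda>c. LBINT x. u x * u (x + c)"] sh by simp
  then show ?thesis
    unfolding sq by (simp add: sum_subtractf)
qed

text \<open>Iterating the self-adjoint step makes the squared masses log-convex, so a pointwise bound on the
  iterates controls the spectral radius.\<close>

lemma killed_step_quadratic_form_le:
  fixes \<Omega> :: "'a::euclidean_space set" and u :: "'a \<Rightarrow> real"
  assumes \<Omega>: "open \<Omega>" "bounded \<Omega>" and u: "sqint lborel u" "\<And>x. x \<notin> \<Omega> \<Longrightarrow> u x = 0" and q: "q > 0"
    and bound: "\<And>k x. (((killed_step \<Omega> h) ^^ k) u x)\<^sup>2 \<le> C * (q\<^sup>2) ^ k"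
  shows "(LBINT x. u x * neighbour_sum h u x) \<le> q * (LBINT x. (u x)\<^sup>2)"
proof -
  define w where "w k = ((killed_step \<Omega> h) ^^ k) u" for k
  have w_Suc: "w (Suc k) = killed_step \<Omega> h (w k)" for k by (simp add: w_def)
  have w0: "w 0 = u" by (simp add: w_def)
  have sets: "\<Omega> \<in> sets borel" using \<Omega>(1) by simp
  have sq: "sqint lborel (w k)" for k
    by (induction k) (simp_all add: w0 w_Suc u sqint_killed_step sets)
  have zero: "w k x = 0" if "x \<notin> \<Omega>" for k x
    using that by (cases k) (simp_all add: w0 w_Suc u killed_step_def)
  \<comment> \<open>Every iterate vanishes off \<Omega>, so inside an inner product with one the
    killing factor is invisible; this makes the killed operator symmetric on the iterates.\<close>
  have step: "(LBINT x. w j x * neighbour_sum h v x) = (LBINT x. w j x * killed_step \<Omega> h v x)" for j v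
  proof (rule Bochner_Integration.integral_cong[OF refl])
    fix x show "w j x * neighbour_sum h v x = w j x * killed_step \<Omega> h v x"
      by (cases "x \<in> \<Omega>") (auto simp: zero killed_step_def)
  qed
  define a where "a k = (LBINT x. (w k x)\<^sup>2)" for k
  have CS: "(LBINT x. w j x * w k x)\<^sup>2 \<le> a j * a k" for j k
    using integral_Cauchy_Schwarz[OF sq sq, of j k] by (simp add: a_def)
  have convex: "(a (Suc k))\<^sup>2 \<le> a k * a (Suc (Suc k))" for k
  proof -
    have "a (Suc k) = (LBINT x. w (Suc k) x * neighbour_sum h (w k) x)"
      by (simp only: a_def step w_Suc[symmetric] power2_eq_square)
    also have "\<dots> = (LBINT x. neighbour_sum h (w (Suc k)) x * w k x)"
      by (rule neighbour_sum_selfadjoint[OF sq sq])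
    also have "\<dots> = (LBINT x. w k x * w (Suc (Suc k)) x)"
      using step[of k "w (Suc k)"] by (simp add: w_Suc[of "Suc k"] mult.commute)
    finally show ?thesis using CS by simp
  qed
  \<comment> \<open>Finite volume of \<Omega> turns the pointwise bound into a bound on the squared
    mass.\<close>
  have upper: "a k \<le> (C * measure lborel \<Omega>) * (q\<^sup>2) ^ k" for k
  proof -
    have fin: "emeasure lborel \<Omega> < \<infinity>" using \<Omega>(2) by (rule emeasure_bounded_finite)
    have "a k \<le> (LBINT x. C * (q\<^sup>2) ^ k * indicator \<Omega> x)"
      unfolding a_def
    proof (rule integral_mono)
      show "integrable lborel (\<lambda>x. (w k x)\<^sup>2)" using sq[of k] by (simp add: sqint_def)
      show "integrable lborel (\<lambda>x. C * (q\<^sup>2) ^ k * indicator \<Omega> x)"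
        using fin sets by (intro integrable_mult_right integrable_real_indicator) auto
      fix x show "(w k x)\<^sup>2 \<le> C * (q\<^sup>2) ^ k * indicator \<Omega> x"
        using bound[of k x] zero[of x k] by (cases "x \<in> \<Omega>") (auto simp: w_def)
    qed
    also have "\<dots> = (C * measure lborel \<Omega>) * (q\<^sup>2) ^ k"
      by simp
    finally show ?thesis .
  qed
  have "a 1 \<le> q\<^sup>2 * a 0"
    by (rule log_convex_growth[OF _ convex upper]) (use q in \<open>auto simp: a_def\<close>)
  moreover have "(LBINT x. u x * neighbour_sum h u x)\<^sup>2 \<le> a 0 * a 1"
    using CS[of 0 1] step[of 0 u] by (simp add: w0 w_Suc)
  ultimately have "(LBINT x. u x * neighbour_sum h u x)\<^sup>2 \<le> a 0 * (q\<^sup>2 * a 0)"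
    using mult_left_mono[of "a 1" "q\<^sup>2 * a 0" "a 0"] by (simp add: a_def)
  also have "\<dots> = (q * a 0)\<^sup>2" by (simp add: power2_eq_square)
  finally have "(LBINT x. u x * neighbour_sum h u x) \<le> q * a 0"
    using power2_le_imp_le[of _ "q * a 0"] q by (simp add: a_def)
  then show ?thesis by (simp add: a_def w0)
qed

section \<open>The radial comparison function\<close>

text \<open>A radial comparison function \<open>\<psi> x = D 0 (|x|\<^sup>2)\<close>; the differential equation for \<open>D 0\<close> says
  \<open>\<Delta> \<psi> = - \<mu> \<psi>\<close>.\<close>

locale radial_profile =
  fixes D :: "nat \<Rightarrow> real \<Rightarrow> real" and \<mu> :: real and N :: nat
  assumes deriv: "\<And>n s. (D n has_real_derivative D (Suc n) s) (at s)"
    and ode: "\<And>s. 4 * s * D 2 s + 2 * real N * D 1 s = - \<mu> * D 0 s"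
begin

lemma D_continuous: "continuous_on A (D n)"
  using deriv DERIV_isCont by (blast intro: continuous_at_imp_continuous_on)

text \<open>The argument is a squared norm, and 9 = 3^2 covers points of norm at most 2 displaced by
  at most 1.\<close>

lemma D_bounded: obtains B where "B \<ge> 0" "\<And>s. -1 \<le> s \<Longrightarrow> s \<le> 9 \<Longrightarrow> \<bar>D n s\<bar> \<le> B"
proof -
  have "compact (D n ` {-1..9})"
    by (intro compact_continuous_image D_continuous) simp
  from compact_imp_bounded[OF this] obtain B where "\<forall>s\<in>{-1..9}. \<bar>D n s\<bar> \<le> B"
    by (auto simp: bounded_iff)
  moreover from this have "0 \<le> B" by (meson abs_ge_zero atLeastAtMost_iff order_trans neg_le_0_iff_le zero_le_numeral zero_le_one)
  ultimately show ?thesis by (auto intro: that)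
qed

lemma taylor_2:
  obtains B where "B \<ge> 0" "\<And>s t. -1 \<le> s \<Longrightarrow> s \<le> 9 \<Longrightarrow> -1 \<le> s + t \<Longrightarrow> s + t \<le> 9 \<Longrightarrow>
    \<bar>D 0 (s + t) - D 0 s - t * D 1 s\<bar> \<le> B * t\<^sup>2"
proof -
  obtain B where B: "B \<ge> 0" "\<And>s. -1 \<le> s \<Longrightarrow> s \<le> 9 \<Longrightarrow> \<bar>D 2 s\<bar> \<le> B" by (rule D_bounded[of 2]) blast
  have "\<bar>D 0 (s + t) - D 0 s - t * D 1 s\<bar> \<le> B * t\<^sup>2"
    if st: "-1 \<le> s" "s \<le> 9" "-1 \<le> s + t" "s + t \<le> 9" for s t
  proof (cases "t = 0")
    case False
    have "\<exists>r. (if s + t < s then s + t < r \<and> r < s else s < r \<and> r < s + t) \<and>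
      D 0 (s + t) = (\<Sum>m<2. D m s / fact m * (s + t - s) ^ m) + D 2 r / fact 2 * (s + t - s) ^ 2"
      by (rule Taylor[where a = "-1" and b = 9]) (use st False deriv in auto)
    then obtain r where range: "if s + t < s then s + t < r \<and> r < s else s < r \<and> r < s + t"
      and eq0: "D 0 (s + t) = (\<Sum>m<2. D m s / fact m * (s + t - s) ^ m) + D 2 r / fact 2 * (s + t - s) ^ 2"
      by blast
    have r: "-1 \<le> r" "r \<le> 9" using range st by (auto split: if_splits)
    have eq: "D 0 (s + t) - D 0 s - t * D 1 s = D 2 r / 2 * t\<^sup>2"
      using eq0 by (simp add: eval_nat_numeral algebra_simps)
    have "\<bar>D 2 r / 2 * t\<^sup>2\<bar> = \<bar>D 2 r\<bar> / 2 * t\<^sup>2" by (simp add: abs_mult)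
    also have "\<dots> \<le> B * t\<^sup>2" using B(1) B(2)[OF r] by (intro mult_right_mono) auto
    finally show ?thesis unfolding eq .
  qed simp
  with B(1) show ?thesis by (rule that)
qed

lemma taylor_3:
  obtains B where "B \<ge> 0" "\<And>s t. -1 \<le> s \<Longrightarrow> s \<le> 9 \<Longrightarrow> -1 \<le> s + t \<Longrightarrow> s + t \<le> 9 \<Longrightarrow>
    D 0 (s + t) \<le> D 0 s + t * D 1 s + t\<^sup>2 / 2 * D 2 s + B * \<bar>t\<bar> ^ 3"
proof -
  obtain B where B: "B \<ge> 0" "\<And>s. -1 \<le> s \<Longrightarrow> s \<le> 9 \<Longrightarrow> \<bar>D 3 s\<bar> \<le> B" by (rule D_bounded[of 3]) blast
  have "D 0 (s + t) \<le> D 0 s + t * D 1 s + t\<^sup>2 / 2 * D 2 s + B * \<bar>t\<bar> ^ 3"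
    if st: "-1 \<le> s" "s \<le> 9" "-1 \<le> s + t" "s + t \<le> 9" for s t
  proof (cases "t = 0")
    case False
    have "\<exists>r. (if s + t < s then s + t < r \<and> r < s else s < r \<and> r < s + t) \<and>
      D 0 (s + t) = (\<Sum>m<3. D m s / fact m * (s + t - s) ^ m) + D 3 r / fact 3 * (s + t - s) ^ 3"
      by (rule Taylor[where a = "-1" and b = 9]) (use st False deriv in auto)
    then obtain r where range: "if s + t < s then s + t < r \<and> r < s else s < r \<and> r < s + t"
      and eq0: "D 0 (s + t) = (\<Sum>m<3. D m s / fact m * (s + t - s) ^ m) + D 3 r / fact 3 * (s + t - s) ^ 3"
      by blast
    have r: "-1 \<le> r" "r \<le> 9" using range st by (auto split: if_splits)
    have eq: "D 0 (s + t) = D 0 s + t * D 1 s + t\<^sup>2 / 2 * D 2 s + D 3 r / 6 * t ^ 3"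
      using eq0 by (simp add: eval_nat_numeral algebra_simps)
    have "D 3 r / 6 * t ^ 3 \<le> \<bar>D 3 r / 6 * t ^ 3\<bar>" by simp
    also have "\<dots> = \<bar>D 3 r\<bar> / 6 * \<bar>t\<bar> ^ 3" by (simp add: abs_mult power_abs)
    also have "\<dots> \<le> B * \<bar>t\<bar> ^ 3" using B(1) B(2)[OF r] by (intro mult_right_mono) auto
    finally show ?thesis unfolding eq by simp
  qed simp
  with B(1) show ?thesis by (rule that)
qed

definition \<psi> :: "'a::euclidean_space \<Rightarrow> real" where "\<psi> x = D 0 ((norm x)\<^sup>2)"

lemma norm_squared_add: "(norm (m + d :: 'a::euclidean_space))\<^sup>2 = (norm m)\<^sup>2 + (2 * (m \<bullet> d) + (norm d)\<^sup>2)"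
  by (simp add: power2_norm_eq_inner inner_add_left inner_add_right inner_commute)

text \<open>With \<open>p\<close> and \<open>q\<close> the increments of \<psi> at
  \<open>m + d\<close> and \<open>m - d\<close>, the first-order terms cancel in
  \<open>p + q\<close>, and \<open>p * q\<close> is a product of two terms of order h. Both
  contributions are O(h^2).\<close>

lemma midpoint_estimate:
  obtains C where "C \<ge> 0" "\<And>(m::'a::euclidean_space) d h. norm m \<le> 2 \<Longrightarrow> norm d \<le> h \<Longrightarrow> h \<le> 1 \<Longrightarrow>
    \<bar>(\<psi> m)\<^sup>2 - \<psi> (m + d) * \<psi> (m - d)\<bar> \<le> C * h\<^sup>2"
proof -
  obtain B where B: "B \<ge> 0" "\<And>s t. -1 \<le> s \<Longrightarrow> s \<le> 9 \<Longrightarrow> -1 \<le> s + t \<Longrightarrow> s + t \<le> 9 \<Longrightarrow>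
    \<bar>D 0 (s + t) - D 0 s - t * D 1 s\<bar> \<le> B * t\<^sup>2" by (rule taylor_2) blast
  obtain B0 where B0: "B0 \<ge> 0" "\<And>s. -1 \<le> s \<Longrightarrow> s \<le> 9 \<Longrightarrow> \<bar>D 0 s\<bar> \<le> B0" by (rule D_bounded[of 0]) blast
  obtain B1 where B1: "B1 \<ge> 0" "\<And>s. -1 \<le> s \<Longrightarrow> s \<le> 9 \<Longrightarrow> \<bar>D 1 s\<bar> \<le> B1" by (rule D_bounded[of 1]) blast
  \<comment> \<open>The argument of \<open>D 0\<close> changes by at most 2 * 2h + h^2 \<le> 5h,
    hence the 5 and its square 25; the first summand bounds \<psi>(m)(p + q), the second p
    q.\<close>
  define C where "C = B0 * (2 * B1 + 50 * B) + (5 * B1 + 25 * B)\<^sup>2"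
  have "C \<ge> 0" using B(1) B0(1) B1(1) by (simp add: C_def)
  moreover have "\<bar>(\<psi> m)\<^sup>2 - \<psi> (m + d) * \<psi> (m - d)\<bar> \<le> C * h\<^sup>2"
    if m: "norm m \<le> 2" and d: "norm d \<le> h" and h: "h \<le> 1" for m d :: "'a" and h
  proof -
    have h0: "0 \<le> h" using d norm_ge_zero[of d] by linarith
    define s where "s = (norm m)\<^sup>2"
    define t where "t v = 2 * (m \<bullet> v) + (norm v)\<^sup>2" for v
    have s: "0 \<le> s" "s \<le> 9" using m power_mono[OF m, of 2] by (auto simp: s_def)
    have main: "-1 \<le> s + t v" "s + t v \<le> 9" "\<bar>t v\<bar> \<le> 5 * h" if v: "norm v \<le> h" for v
    proof -
      have "s + t v = (norm (m + v))\<^sup>2" by (simp add: s_def t_def norm_squared_add)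
      moreover have "norm (m + v) \<le> 3" using norm_triangle_ineq[of m v] m v h by linarith
      ultimately show "-1 \<le> s + t v" "s + t v \<le> 9" using power_mono[of "norm (m + v)" 3 2]
        by (auto intro: order_trans[of _ 0])
      have "\<bar>m \<bullet> v\<bar> \<le> norm m * norm v" by (rule Cauchy_Schwarz_ineq2)
      also have "\<dots> \<le> 2 * h" using m v by (intro mult_mono) auto
      finally have 1: "\<bar>m \<bullet> v\<bar> \<le> 2 * h" .
      have "(norm v)\<^sup>2 \<le> h * 1" unfolding power2_eq_square using v h h0 by (intro mult_mono) auto
      then show "\<bar>t v\<bar> \<le> 5 * h" using 1 zero_le_power2[of "norm v"] unfolding t_def by linarith
    qed
    define r where "r v = D 0 (s + t v) - D 0 s - t v * D 1 s" for v
    have r: "\<bar>r v\<bar> \<le> 25 * B * h\<^sup>2" if v: "norm v \<le> h" for v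
    proof -
      have "\<bar>r v\<bar> \<le> B * (t v)\<^sup>2" unfolding r_def using B(2)[of s "t v"] s main[OF v] by simp
      also have "\<dots> \<le> B * (5 * h)\<^sup>2"
        using power_mono[OF main(3)[OF v], of 2] B(1) by (intro mult_left_mono) auto
      finally show ?thesis by (simp add: power_mult_distrib)
    qed
    define p q where "p = \<psi> (m + d) - \<psi> m" and "q = \<psi> (m - d) - \<psi> m"
    have \<psi>m: "\<psi> m = D 0 s" by (simp add: \<psi>_def s_def)
    have \<psi>v: "\<psi> (m + v) = D 0 s + t v * D 1 s + r v" for v
      by (simp add: r_def \<psi>_def s_def t_def norm_squared_add)
    have p: "p = t d * D 1 s + r d" and q: "q = t (- d) * D 1 s + r (- d)"
      using \<psi>v[of d] \<psi>v[of "- d"] by (simp_all add: p_def q_def \<psi>m)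
    have d': "norm (- d) \<le> h" using d by simp
    have D1: "\<bar>D 1 s\<bar> \<le> B1" and D0: "\<bar>D 0 s\<bar> \<le> B0" using B1(2)[of s] B0(2)[of s] s by auto
    have d2: "(norm d)\<^sup>2 \<le> h\<^sup>2" using d by (intro power_mono) auto
    have hh: "h\<^sup>2 \<le> h" using h h0 by (simp add: power2_eq_square mult_left_le)
    have sum: "\<bar>p + q\<bar> \<le> (2 * B1 + 50 * B) * h\<^sup>2"
    proof -
      have "p + q = 2 * (norm d)\<^sup>2 * D 1 s + (r d + r (- d))" by (simp add: p q t_def algebra_simps)
      moreover have "\<bar>2 * (norm d)\<^sup>2 * D 1 s\<bar> \<le> 2 * h\<^sup>2 * B1"
        unfolding abs_mult using d2 D1 by (intro mult_mono) auto
      ultimately show ?thesis using r[OF d] r[OF d'] by (simp add: algebra_simps)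
    qed
    have single: "\<bar>t v * D 1 s + r v\<bar> \<le> (5 * B1 + 25 * B) * h" if v: "norm v \<le> h" for v
    proof -
      have "\<bar>t v * D 1 s\<bar> \<le> 5 * h * B1" unfolding abs_mult using main(3)[OF v] D1 by (intro mult_mono) auto
      moreover have "25 * B * h\<^sup>2 \<le> 25 * B * h" using hh B(1) by (intro mult_left_mono) auto
      ultimately show ?thesis using r[OF v] by (simp add: algebra_simps)
    qed
    have "\<bar>p * q\<bar> \<le> ((5 * B1 + 25 * B) * h) * ((5 * B1 + 25 * B) * h)"
      unfolding abs_mult p q using single[OF d] single[OF d'] by (intro mult_mono) auto
    moreover have "\<bar>\<psi> m * (p + q)\<bar> \<le> B0 * ((2 * B1 + 50 * B) * h\<^sup>2)"
      unfolding abs_mult \<psi>m using D0 sum B0(1) by (intro mult_mono) auto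
    moreover have "(\<psi> m)\<^sup>2 - \<psi> (m + d) * \<psi> (m - d) = - (\<psi> m * (p + q)) - p * q"
      by (simp add: p_def q_def power2_eq_square algebra_simps)
    ultimately show ?thesis by (simp add: C_def power2_eq_square algebra_simps)
  qed
  ultimately show ?thesis by (rule that)
qed

text \<open>In the third-order expansion opposite directions cancel the odd terms, and summing over
  the basis turns the second-order part into the left side of \<open>ode\<close>.\<close>

lemma discrete_laplacian_estimate:
  assumes N: "N = DIM('a::euclidean_space)"
  obtains C where "C \<ge> 0" "\<And>(z::'a) h. norm z \<le> 1 \<Longrightarrow> 0 \<le> h \<Longrightarrow> h \<le> 1 \<Longrightarrow>
    neighbour_sum h \<psi> z \<le> (2 * real N - \<mu> * h\<^sup>2) * \<psi> z + C * h ^ 3"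
proof -
  obtain B where B: "B \<ge> 0" "\<And>s t. -1 \<le> s \<Longrightarrow> s \<le> 9 \<Longrightarrow> -1 \<le> s + t \<Longrightarrow> s + t \<le> 9 \<Longrightarrow>
    D 0 (s + t) \<le> D 0 s + t * D 1 s + t\<^sup>2 / 2 * D 2 s + B * \<bar>t\<bar> ^ 3" by (rule taylor_3) blast
  obtain B2 where B2: "B2 \<ge> 0" "\<And>s. -1 \<le> s \<Longrightarrow> s \<le> 9 \<Longrightarrow> \<bar>D 2 s\<bar> \<le> B2" by (rule D_bounded[of 2]) blast
  define C where "C = real N * (B2 + 54 * B)"
  have "C \<ge> 0" using B(1) B2(1) by (simp add: C_def)
  moreover have "neighbour_sum h \<psi> z \<le> (2 * real N - \<mu> * h\<^sup>2) * \<psi> z + C * h ^ 3"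
    if z: "norm z \<le> 1" and h: "0 \<le> h" "h \<le> 1" for z :: 'a and h
  proof -
    define s where "s = (norm z)\<^sup>2"
    have s: "0 \<le> s" "s \<le> 9" using power_mono[OF z, of 2] by (auto simp: s_def)
    have h43: "h ^ 4 \<le> h ^ 3" using h by (intro power_decreasing) auto
    have one: "\<psi> (z + v) \<le> D 0 s + t * D 1 s + t\<^sup>2 / 2 * D 2 s + 27 * B * h ^ 3"
      if v: "norm v = h" and t: "t = 2 * (z \<bullet> v) + h\<^sup>2" for v t
    proof -
      have eq: "(norm (z + v))\<^sup>2 = s + t" by (simp add: s_def t v norm_squared_add)
      have "norm (z + v) \<le> 3" using norm_triangle_ineq[of z v] z v h by linarith
      then have st: "0 \<le> s + t" "s + t \<le> 9" using power_mono[of "norm (z + v)" 3 2] by (auto simp flip: eq)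
      have "\<bar>z \<bullet> v\<bar> \<le> norm z * norm v" by (rule Cauchy_Schwarz_ineq2)
      also have "\<dots> \<le> 1 * h" using z v by (intro mult_mono) auto
      finally have "\<bar>z \<bullet> v\<bar> \<le> h" by simp
      moreover have "h\<^sup>2 \<le> h" using h by (simp add: power2_eq_square mult_left_le)
      ultimately have "\<bar>t\<bar> \<le> 3 * h" unfolding t using zero_le_power2[of h] by linarith
      then have "\<bar>t\<bar> ^ 3 \<le> (3 * h) ^ 3" by (intro power_mono) auto
      then have "B * \<bar>t\<bar> ^ 3 \<le> B * (27 * h ^ 3)" using B(1) by (intro mult_left_mono) (auto simp: power_mult_distrib)
      then show ?thesis using B(2)[of s t] s st by (simp add: \<psi>_def eq)
    qed
    have two: "\<psi> (z + h *\<^sub>R b) + \<psi> (z + - (h *\<^sub>R b)) \<le> 2 * D 0 s + 2 * h\<^sup>2 * D 1 s + 4 * h\<^sup>2 * (z \<bullet> b)\<^sup>2 * D 2 s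
       + (B2 + 54 * B) * h ^ 3" if b: "b \<in> Basis" for b
    proof -
      define y where "y = z \<bullet> b"
      have nb: "norm (h *\<^sub>R b) = h" "norm (- (h *\<^sub>R b)) = h" using b h by auto
      have "\<psi> (z + h *\<^sub>R b) + \<psi> (z + - (h *\<^sub>R b))
        \<le> (D 0 s + (2 * h * y + h\<^sup>2) * D 1 s + (2 * h * y + h\<^sup>2)\<^sup>2 / 2 * D 2 s + 27 * B * h ^ 3)
         + (D 0 s + (- 2 * h * y + h\<^sup>2) * D 1 s + (- 2 * h * y + h\<^sup>2)\<^sup>2 / 2 * D 2 s + 27 * B * h ^ 3)"
        by (intro add_mono one nb) (simp_all add: y_def)
      also have "\<dots> = 2 * D 0 s + 2 * h\<^sup>2 * D 1 s + 4 * h\<^sup>2 * y\<^sup>2 * D 2 s + h ^ 4 * D 2 s + 54 * B * h ^ 3"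
        by (simp add: power2_eq_square power4_eq_xxxx field_simps)
      \<comment> \<open>The quartic remainder of the squared increments is absorbed into the cubic
        error, as h \<le> 1.\<close>
      also have "h ^ 4 * D 2 s \<le> h ^ 3 * B2"
      proof -
        have "h ^ 4 * D 2 s \<le> h ^ 4 * B2" using B2(2)[of s] s by (intro mult_left_mono) auto
        also have "\<dots> \<le> h ^ 3 * B2" using h43 B2(1) by (rule mult_right_mono)
        finally show ?thesis .
      qed
      finally show ?thesis by (simp add: y_def algebra_simps)
    qed
    have "neighbour_sum h \<psi> z = (\<Sum>b\<in>Basis. \<psi> (z + h *\<^sub>R b) + \<psi> (z + - (h *\<^sub>R b)))"
      unfolding neighbour_sum_def by (rule sum_dirs)
    also have "\<dots> \<le> (\<Sum>b\<in>Basis. 2 * D 0 s + 2 * h\<^sup>2 * D 1 s + 4 * h\<^sup>2 * (z \<bullet> b)\<^sup>2 * D 2 s + (B2 + 54 * B) * h ^ 3)"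
      by (intro sum_mono two)
    also have "\<dots> = 2 * real N * D 0 s + h\<^sup>2 * (4 * (\<Sum>b\<in>Basis. (z \<bullet> b)\<^sup>2) * D 2 s + 2 * real N * D 1 s) + C * h ^ 3"
      by (simp add: sum.distrib N C_def sum_distrib_left sum_distrib_right algebra_simps)
    also have "(\<Sum>b\<in>Basis. (z \<bullet> b)\<^sup>2) = s"
      unfolding s_def power2_norm_eq_inner by (subst euclidean_inner) (simp add: power2_eq_square)
    also have "4 * s * D 2 s + 2 * real N * D 1 s = - \<mu> * D 0 s" by (rule ode)
    finally have "neighbour_sum h \<psi> z \<le> 2 * real N * D 0 s + h\<^sup>2 * (- \<mu> * D 0 s) + C * h ^ 3" .
    moreover have "\<psi> z = D 0 s" by (simp add: \<psi>_def s_def)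
    ultimately show ?thesis by (simp add: algebra_simps)
  qed
  ultimately show ?thesis by (rule that)
qed

end

section \<open>Two-point comparison\<close>

context radial_profile
begin

text \<open>Lattice neighbours of a point of the unit ball may leave it by \<open>h\<close>, so
  positivity must survive on a slightly larger ball.\<close>

lemma profile_lower_bound:
  assumes pos: "\<forall>s\<in>{0..1}. D 0 s > 0"
  obtains \<kappa> \<delta> where "\<kappa> > 0" "\<delta> > 0" "\<delta> \<le> 1" "\<And>x::'a::euclidean_space. norm x \<le> 1 + \<delta> \<Longrightarrow> \<kappa> \<le> \<psi> x"
proof -
  obtain s0 where s0: "s0 \<in> {0..1::real}" "\<And>s. s \<in> {0..1} \<Longrightarrow> D 0 s0 \<le> D 0 s"
    using continuous_attains_inf[of "{0..1::real}" "D 0"] D_continuous by auto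
  define \<kappa> where "\<kappa> = D 0 s0 / 2"
  have \<kappa>: "\<kappa> > 0" using bspec[OF pos s0(1)] by (simp add: \<kappa>_def)
  have "uniformly_continuous_on {0..9} (D 0)"
    by (intro compact_uniformly_continuous D_continuous) simp
  then obtain d where d: "d > 0" "\<And>s s'. s \<in> {0..9} \<Longrightarrow> s' \<in> {0..9} \<Longrightarrow> dist s' s < d \<Longrightarrow> dist (D 0 s') (D 0 s) < \<kappa>"
    using \<kappa> unfolding uniformly_continuous_on_def by meson
  define \<delta> where "\<delta> = min 1 (d / 4)"
  have \<delta>: "\<delta> > 0" "\<delta> \<le> 1" "\<delta> \<le> d / 4" using d(1) by (auto simp: \<delta>_def)
  have "\<kappa> \<le> \<psi> x" if x: "norm x \<le> 1 + \<delta>" for x :: 'a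
  proof -
    define s where "s = (norm x)\<^sup>2"
    have s1: "0 \<le> s" by (simp add: s_def)
    have "s \<le> (1 + \<delta>)\<^sup>2" unfolding s_def using x by (intro power_mono) auto
    also have "\<dots> \<le> 1 + 3 * \<delta>" using \<delta>(1,2) by (simp add: power2_eq_square algebra_simps mult_left_le)
    finally have s2: "s \<le> 1 + 3 * \<delta>" .
    have "dist (min s 1) s < d" using s2 \<delta> d(1) by (auto simp: dist_real_def min_def)
    then have "dist (D 0 (min s 1)) (D 0 s) < \<kappa>"
      using s1 s2 \<delta> by (intro d(2)) auto
    moreover have "2 * \<kappa> \<le> D 0 (min s 1)" using s0(2)[of "min s 1"] s1 by (simp add: \<kappa>_def)
    ultimately show ?thesis by (simp add: \<psi>_def s_def[symmetric] dist_real_def)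
  qed
  with \<kappa> \<delta>(1,2) show ?thesis by (rule that)
qed

text \<open>One induction step, with the functions abstracted: z is (x - y)/2,
  \<open>\<alpha> i\<close> the value at x + shift i, \<open>\<beta> j\<close> the value at y -
  shift j. The opposite signs make half the difference of the moved points z + (shift i + shift
  j)/2. The type argument fixes the space in which \<open>z\<close> ranges.\<close>

definition two_point_contraction :: "'a::euclidean_space itself \<Rightarrow> real \<Rightarrow> real \<Rightarrow> bool" where
  "two_point_contraction T h q \<longleftrightarrow>
    (\<forall>(z::'a) M \<alpha> \<beta>. norm z \<le> 1 \<longrightarrow> 0 \<le> M \<longrightarrow> (\<forall>i\<in>dirs. 0 \<le> \<alpha> i \<and> 0 \<le> \<beta> i) \<longrightarrow>
      (\<forall>i\<in>dirs. \<forall>j\<in>dirs. \<alpha> i * \<beta> j \<le> M * (\<psi> (z + (1/2) *\<^sub>R (shift h i + shift h j)))\<^sup>2) \<longrightarrow>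
      (\<Sum>i\<in>dirs. \<alpha> i) * (\<Sum>i\<in>dirs. \<beta> i) \<le> M * (q * \<psi> z)\<^sup>2)"

text \<open>A budget at order h^2: of the gain \<epsilon> h^2 \<psi>(z), half absorbs the cubic
  Taylor error. The other half, after squaring, outweighs the off-diagonal loss of order
  h^4.\<close>

lemma comparison_step:
  assumes N: "N = DIM('a::euclidean_space)" and pos: "\<forall>s\<in>{0..1}. D 0 s > 0" and \<epsilon>: "\<epsilon> > 0"
  shows "\<forall>\<^sub>F h in at_right 0. 0 < 2 * real N - (\<mu> - \<epsilon>) * h\<^sup>2 \<and>
    two_point_contraction TYPE('a) h (2 * real N - (\<mu> - \<epsilon>) * h\<^sup>2)"
proof -
  obtain \<kappa> \<delta> where \<kappa>: "\<kappa> > 0" and \<delta>: "\<delta> > 0" "\<delta> \<le> 1" and low: "\<And>x::'a. norm x \<le> 1 + \<delta> \<Longrightarrow> \<kappa> \<le> \<psi> x"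
    by (rule profile_lower_bound[OF pos]) blast+
  obtain C where C: "C \<ge> 0" "\<And>(m::'a) d h. norm m \<le> 2 \<Longrightarrow> norm d \<le> h \<Longrightarrow> h \<le> 1 \<Longrightarrow>
    \<bar>(\<psi> m)\<^sup>2 - \<psi> (m + d) * \<psi> (m - d)\<bar> \<le> C * h\<^sup>2" by (rule midpoint_estimate[where 'a = 'a]) blast
  obtain C1 where C1: "C1 \<ge> 0" "\<And>(z::'a) h. norm z \<le> 1 \<Longrightarrow> 0 \<le> h \<Longrightarrow> h \<le> 1 \<Longrightarrow>
    neighbour_sum h \<psi> z \<le> (2 * real N - \<mu> * h\<^sup>2) * \<psi> z + C1 * h ^ 3"
    by (rule discrete_laplacian_estimate[OF N]) blast
  have N1: "real N \<ge> 1" using N DIM_positive[where 'a = 'a] by simp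
  \<comment> \<open>From \<open>product_of_sums_le\<close> with (2N)^2 pairs, error C h^2 and lower
    bound \<kappa>^2 for the kernel: the loss is E h^4.\<close>
  define E where "E = 4 * (real N)\<^sup>2 * C\<^sup>2 / \<kappa>\<^sup>2"
  have t: "((\<lambda>h. h) \<longlongrightarrow> (0::real)) (at_right 0)" by (rule tendsto_ident_at)
  have "\<forall>\<^sub>F h in at_right 0. h < \<delta>" using t \<delta> by (intro order_tendstoD) auto
  moreover have "((\<lambda>h. C1 * h) \<longlongrightarrow> C1 * 0) (at_right 0)" by (intro tendsto_intros t)
  then have "\<forall>\<^sub>F h in at_right 0. C1 * h < \<epsilon> * \<kappa> / 2" using \<epsilon> \<kappa> by (intro order_tendstoD) auto
  moreover have "((\<lambda>h. (\<mu> - \<epsilon>) * h\<^sup>2) \<longlongrightarrow> (\<mu> - \<epsilon>) * 0\<^sup>2) (at_right 0)" by (intro tendsto_intros t)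
  then have "\<forall>\<^sub>F h in at_right 0. (\<mu> - \<epsilon>) * h\<^sup>2 < real N" using N1 by (intro order_tendstoD) auto
  moreover have "((\<lambda>h. E * h\<^sup>2) \<longlongrightarrow> E * 0\<^sup>2) (at_right 0)" by (intro tendsto_intros t)
  then have "\<forall>\<^sub>F h in at_right 0. E * h\<^sup>2 < \<epsilon> * \<kappa>\<^sup>2 * real N / 2" using \<epsilon> \<kappa> N1 by (intro order_tendstoD) auto
  moreover have "\<forall>\<^sub>F h in at_right 0. h > (0::real)" by (simp add: eventually_at_right_less)
  ultimately show ?thesis
  proof eventually_elim
    case (elim h)
    then have h: "h < \<delta>" "C1 * h < \<epsilon> * \<kappa> / 2" "(\<mu> - \<epsilon>) * h\<^sup>2 < real N" "E * h\<^sup>2 < \<epsilon> * \<kappa>\<^sup>2 * real N / 2" "h > 0"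
      by auto
    define q where "q = 2 * real N - (\<mu> - \<epsilon>) * h\<^sup>2"
    have q: "q > real N" using h(3) by (simp add: q_def)
    have "(\<Sum>i\<in>dirs. \<alpha> i) * (\<Sum>i\<in>dirs. \<beta> i) \<le> M * (q * \<psi> z)\<^sup>2"
      if z: "norm z \<le> 1" and M: "0 \<le> M" and nn: "\<forall>i\<in>dirs. 0 \<le> \<alpha> i \<and> 0 \<le> \<beta> i"
        and le: "\<forall>i\<in>dirs. \<forall>j\<in>dirs. \<alpha> i * \<beta> j \<le> M * (\<psi> (z + (1/2) *\<^sub>R (shift h i + shift h j)))\<^sup>2"
      for z :: 'a and M \<alpha> \<beta>
    proof -
      define K where "K i j = (\<psi> (z + (1/2) *\<^sub>R (shift h i + shift h j)))\<^sup>2" for i j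
      define c where "c i = \<psi> (z + shift h i)" for i
      have mid: "norm (z + (1/2) *\<^sub>R (shift h i + shift h j)) \<le> 1 + h" if "i \<in> dirs" "j \<in> dirs" for i j
      proof -
        have "norm (shift h i + shift h j) \<le> h + h"
          using norm_triangle_ineq[of "shift h i" "shift h j"] norm_shift[OF that(1)] norm_shift[OF that(2)] h by simp
        then show ?thesis using norm_triangle_ineq[of z "(1/2) *\<^sub>R (shift h i + shift h j)"] z by simp
      qed
      have c_low: "\<kappa> \<le> c i" if "i \<in> dirs" for i
        unfolding c_def using norm_triangle_ineq[of z "shift h i"] norm_shift[OF that, of h] z h by (intro low) simp
      have Csum: "(\<Sum>i\<in>dirs. \<alpha> i) * (\<Sum>i\<in>dirs. \<beta> i)
        \<le> M * ((\<Sum>i\<in>dirs. c i)\<^sup>2 + (real (card (dirs :: ('a \<times> real) set)))\<^sup>2 * (C * h\<^sup>2)\<^sup>2 / \<kappa>\<^sup>2)"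
      proof (rule product_of_sums_le[where K = K])
        fix i j :: "'a \<times> real" assume ij: "i \<in> dirs" "j \<in> dirs"
        show "\<alpha> i * \<beta> j \<le> M * K i j" using le ij by (simp add: K_def)
        have "\<kappa> \<le> \<psi> (z + (1/2) *\<^sub>R (shift h i + shift h j))" using mid[OF ij] h by (intro low) simp
        then show "\<kappa>\<^sup>2 \<le> K i j" unfolding K_def using \<kappa> by (intro power_mono) auto
        let ?m = "z + (1/2) *\<^sub>R (shift h i + shift h j)" and ?d = "(1/2) *\<^sub>R (shift h i - shift h j)"
        have "norm (shift h i - shift h j) \<le> h + h"
          using norm_triangle_ineq4[of "shift h i" "shift h j"] norm_shift[OF ij(1)] norm_shift[OF ij(2)] h by simp
        then have "norm ?d \<le> h" by simp
        moreover have "norm ?m \<le> 2" using mid[OF ij] h \<delta> by linarith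
        ultimately have "\<bar>(\<psi> ?m)\<^sup>2 - \<psi> (?m + ?d) * \<psi> (?m - ?d)\<bar> \<le> C * h\<^sup>2"
          using h \<delta> by (intro C(2)) auto
        moreover have "?m + ?d = z + shift h i" "?m - ?d = z + shift h j"
          by (simp_all add: scaleR_add_right scaleR_diff_right flip: scaleR_add_left scaleR_left_diff_distrib)
        ultimately show "\<bar>K i j - c i * c j\<bar> \<le> C * h\<^sup>2" by (simp only: K_def c_def)
      next
        fix i j :: "'a \<times> real"
        show "K i j = K j i" by (simp add: K_def add.commute)
      next
        fix i :: "'a \<times> real" assume "i \<in> dirs"
        have "(1/2) *\<^sub>R (shift h i + shift h i) = shift h i"
          by (simp add: scaleR_add_right flip: scaleR_add_left)
        then show "K i i = (c i)\<^sup>2" by (simp add: K_def c_def)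
      qed (use nn M \<kappa> c_low in \<open>auto intro: order_trans[OF less_imp_le]\<close>)
      have pz: "\<kappa> \<le> \<psi> z" using z \<delta> by (intro low) simp
      \<comment> \<open>What remains of the gain after the cubic error is paid.\<close>
      define \<eta> where "\<eta> = \<epsilon> * \<kappa> / 2 * h\<^sup>2"
      have \<eta>: "\<eta> \<ge> 0" using \<epsilon> \<kappa> by (simp add: \<eta>_def)
      have sum_c: "(\<Sum>i\<in>dirs. c i) \<le> q * \<psi> z - \<eta>"
      proof -
        have "(\<Sum>i\<in>dirs. c i) \<le> (2 * real N - \<mu> * h\<^sup>2) * \<psi> z + C1 * h ^ 3"
          using C1(2)[OF z, of h] h \<delta> by (simp add: neighbour_sum_def c_def)
        also have "\<dots> = q * \<psi> z - \<epsilon> * h\<^sup>2 * \<psi> z + (C1 * h) * h\<^sup>2"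
          by (simp add: q_def power2_eq_square power3_eq_cube algebra_simps)
        also have "\<dots> \<le> q * \<psi> z - \<epsilon> * h\<^sup>2 * \<kappa> + (\<epsilon> * \<kappa> / 2) * h\<^sup>2"
          using h(2) pz \<epsilon> by (intro add_mono diff_left_mono mult_left_mono mult_right_mono) auto
        finally show ?thesis by (simp add: \<eta>_def algebra_simps)
      qed
      have sum_nonneg: "0 \<le> (\<Sum>i\<in>dirs. c i)" using c_low \<kappa> by (intro sum_nonneg) (auto intro: order_trans[OF less_imp_le])
      have "(\<Sum>i\<in>dirs. c i)\<^sup>2 \<le> (q * \<psi> z - \<eta>)\<^sup>2" using sum_c sum_nonneg by (intro power_mono)
      also have "\<dots> = (q * \<psi> z)\<^sup>2 - \<eta> * (q * \<psi> z) - \<eta> * (q * \<psi> z - \<eta>)"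
        by (simp add: power2_eq_square algebra_simps)
      also have "\<dots> \<le> (q * \<psi> z)\<^sup>2 - \<eta> * (q * \<psi> z)"
        using \<eta> sum_c sum_nonneg by simp
      also have "\<dots> \<le> (q * \<psi> z)\<^sup>2 - \<eta> * (real N * \<kappa>)"
        using \<eta> q pz \<kappa> N1 by (intro diff_left_mono mult_left_mono mult_mono) auto
      also have "\<eta> * (real N * \<kappa>) = (\<epsilon> * \<kappa>\<^sup>2 * real N / 2) * h\<^sup>2"
        by (simp add: \<eta>_def power2_eq_square)
      finally have s1: "(\<Sum>i\<in>dirs. c i)\<^sup>2 \<le> (q * \<psi> z)\<^sup>2 - (\<epsilon> * \<kappa>\<^sup>2 * real N / 2) * h\<^sup>2" .
      have "(real (card (dirs :: ('a \<times> real) set)))\<^sup>2 * (C * h\<^sup>2)\<^sup>2 / \<kappa>\<^sup>2 = (E * h\<^sup>2) * h\<^sup>2"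
        by (simp add: card_dirs N E_def power_mult_distrib power2_eq_square)
      also have "\<dots> \<le> (\<epsilon> * \<kappa>\<^sup>2 * real N / 2) * h\<^sup>2"
        using h(4) by (intro mult_right_mono) auto
      finally have "(\<Sum>i\<in>dirs. c i)\<^sup>2 + (real (card (dirs :: ('a \<times> real) set)))\<^sup>2 * (C * h\<^sup>2)\<^sup>2 / \<kappa>\<^sup>2 \<le> (q * \<psi> z)\<^sup>2"
        using s1 by linarith
      with Csum show ?thesis using mult_left_mono[OF _ M] by (meson order_trans)
    qed
    then show ?case using q N1 by (auto simp: q_def two_point_contraction_def)
  qed
qed

text \<open>The bound is claimed for all points, not only those of \<Omega>, because the neighbours
  of a point of \<Omega> may lie outside. Only for two points of \<Omega> does the contraction have
  to be applied, and there the diameter puts half their difference into the unit ball.\<close>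

lemma killed_iterates_bound:
  fixes \<Omega> :: "'a::euclidean_space set"
  assumes q: "0 < q" and step: "two_point_contraction TYPE('a) h q"
    and diam: "\<And>x y. x \<in> \<Omega> \<Longrightarrow> y \<in> \<Omega> \<Longrightarrow> dist x y \<le> 2"
    and u: "\<And>x. 0 \<le> u x" "\<And>x y. u x * u y \<le> M * (\<psi> ((1/2) *\<^sub>R (x - y)))\<^sup>2" and M: "0 \<le> M"
  shows "0 \<le> ((killed_step \<Omega> h) ^^ k) u x \<and>
    ((killed_step \<Omega> h) ^^ k) u x * ((killed_step \<Omega> h) ^^ k) u y \<le> M * (q\<^sup>2) ^ k * (\<psi> ((1/2) *\<^sub>R (x - y)))\<^sup>2"
proof (induction k arbitrary: x y)
  case 0
  then show ?case using u by simp
next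
  case (Suc k)
  define w where "w = ((killed_step \<Omega> h) ^^ k) u"
  have w: "0 \<le> w x" "w x * w y \<le> M * (q\<^sup>2) ^ k * (\<psi> ((1/2) *\<^sub>R (x - y)))\<^sup>2" for x y
    using Suc.IH unfolding w_def by auto
  have nn: "0 \<le> killed_step \<Omega> h w x" for x
    unfolding killed_step_def neighbour_sum_def by (intro mult_nonneg_nonneg sum_nonneg w) auto
  have "killed_step \<Omega> h w x * killed_step \<Omega> h w y \<le> M * (q\<^sup>2) ^ Suc k * (\<psi> ((1/2) *\<^sub>R (x - y)))\<^sup>2"
  proof (cases "x \<in> \<Omega> \<and> y \<in> \<Omega>")
    case True
    let ?z = "(1/2) *\<^sub>R (x - y)"
    \<comment> \<open>The neighbours of y are listed with reversed sign; by symmetry of the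
      directions the sum is unchanged.\<close>
    have "(\<Sum>i\<in>dirs. w (x + shift h i)) * (\<Sum>i\<in>dirs. w (y - shift h i)) \<le> M * (q\<^sup>2) ^ k * (q * \<psi> ?z)\<^sup>2"
    proof (rule step[unfolded two_point_contraction_def, rule_format])
      show "norm ?z \<le> 1" using diam[of x y] True by (simp add: dist_norm)
      show "0 \<le> M * (q\<^sup>2) ^ k" using M by simp
      show "0 \<le> w (x + shift h i) \<and> 0 \<le> w (y - shift h i)" for i using w(1) by blast
      show "w (x + shift h i) * w (y - shift h j)
        \<le> M * (q\<^sup>2) ^ k * (\<psi> (?z + (1/2) *\<^sub>R (shift h i + shift h j)))\<^sup>2" for i j
      proof -
        have "?z + (1/2) *\<^sub>R (shift h i + shift h j) = (1/2) *\<^sub>R ((x + shift h i) - (y - shift h j))"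
          by (simp add: scaleR_add_right scaleR_diff_right)
        then show "w (x + shift h i) * w (y - shift h j) \<le> M * (q\<^sup>2) ^ k * (\<psi> (?z + (1/2) *\<^sub>R (shift h i + shift h j)))\<^sup>2"
          using w(2)[of "x + shift h i" "y - shift h j"] by simp
      qed
    qed
    moreover have "(\<Sum>i\<in>dirs. w (y - shift h i)) = neighbour_sum h w y"
      using sum_dirs_minus[of "\<lambda>v. w (y + v)" h] by (simp add: neighbour_sum_def)
    ultimately show ?thesis
      using True by (simp add: killed_step_def neighbour_sum_def power_mult_distrib mult_ac)
  next
    case False
    then show ?thesis using M by (auto simp: killed_step_def)
  qed
  then show ?case using nn by (simp add: w_def)
qed

text \<open>The two-point bound on the diagonal x = y is a pointwise bound on the iterates. It
  controls the quadratic form of the neighbour sum, and hence the discrete energy from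
  below.\<close>

lemma discrete_poincare:
  fixes \<Omega> :: "'a::euclidean_space set"
  assumes N: "N = DIM('a)" and pos: "\<forall>s\<in>{0..1}. D 0 s > 0" and \<epsilon>: "\<epsilon> > 0"
    and \<Omega>: "open \<Omega>" "bounded \<Omega>" and diam: "\<And>x y. x \<in> \<Omega> \<Longrightarrow> y \<in> \<Omega> \<Longrightarrow> dist x y \<le> 2"
    and \<phi>: "\<phi> \<in> test_functions \<Omega>"
  shows "\<forall>\<^sub>F h in at_right 0. (\<mu> - \<epsilon>) * h\<^sup>2 * mass \<phi> \<le> (\<Sum>b\<in>Basis. LBINT x. (\<phi> (x + h *\<^sub>R b) - \<phi> x)\<^sup>2)"
  using comparison_step[OF N pos \<epsilon>]
proof eventually_elim
  case (elim h)
  define q where "q = 2 * real N - (\<mu> - \<epsilon>) * h\<^sup>2"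
  have q: "0 < q" and step: "two_point_contraction TYPE('a) h q"
    using elim by (simp_all add: q_def)
  obtain \<kappa> \<delta> where \<kappa>: "\<kappa> > 0" and \<delta>: "\<delta> > 0" and low: "\<And>x::'a. norm x \<le> 1 + \<delta> \<Longrightarrow> \<kappa> \<le> \<psi> x"
    by (rule profile_lower_bound[OF pos]) blast+
  \<comment> \<open>The product bound needs nonnegative functions; passing to the modulus keeps the
    mass and does not increase the discrete energy.\<close>
  define u where "u x = \<bar>\<phi> x\<bar>" for x
  have u0: "u x = 0" if "x \<notin> \<Omega>" for x using test_function_zero_outside[OF \<phi> that] by (simp add: u_def)
  have squ: "sqint lborel u"
    using sqint_test_function(1)[OF \<phi>] unfolding u_def[abs_def] by (auto simp: sqint_def)
  obtain P where P: "\<And>x. u x \<le> P" "0 \<le> P"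
  proof -
    obtain K where K: "compact K" "\<And>x. x \<notin> K \<Longrightarrow> \<phi> x = 0" by (rule test_functionsE[OF \<phi>]) blast
    have "compact (\<phi> ` K)"
      using test_functions_continuous[OF \<phi>] K(1) by (intro compact_continuous_image) (auto intro: continuous_on_subset)
    from compact_imp_bounded[OF this] obtain P0 where P0: "\<And>x. x \<in> K \<Longrightarrow> \<bar>\<phi> x\<bar> \<le> P0"
      by (auto simp: bounded_iff)
    show ?thesis
      by (rule that[of "max P0 0"]) (use P0 K(2) in \<open>force simp: u_def le_max_iff_disj\<close>)+
  qed
  \<comment> \<open>Products of values of \<open>u\<close> are at most P^2, and \<psi> is at least
    \<kappa> wherever two points of \<Omega> can place it.\<close>
  define M where "M = P\<^sup>2 / \<kappa>\<^sup>2"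
  have M: "0 \<le> M" by (simp add: M_def)
  have init: "u x * u y \<le> M * (\<psi> ((1/2) *\<^sub>R (x - y)))\<^sup>2" for x y
  proof (cases "x \<in> \<Omega> \<and> y \<in> \<Omega>")
    case True
    have "norm ((1/2) *\<^sub>R (x - y)) \<le> 1 + \<delta>" using diam[of x y] True \<delta> by (simp add: dist_norm)
    then have "\<kappa>\<^sup>2 \<le> (\<psi> ((1/2) *\<^sub>R (x - y)))\<^sup>2" using low \<kappa> by (intro power_mono) auto
    then have "M * \<kappa>\<^sup>2 \<le> M * (\<psi> ((1/2) *\<^sub>R (x - y)))\<^sup>2" using M by (rule mult_left_mono)
    moreover have "u x * u y \<le> P * P" using P by (intro mult_mono) (auto simp: u_def)
    ultimately show ?thesis using \<kappa> by (simp add: M_def power2_eq_square)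
  next
    case False
    then show ?thesis using u0 M by auto
  qed
  have bound: "(((killed_step \<Omega> h) ^^ k) u x)\<^sup>2 \<le> (M * (\<psi> (0::'a))\<^sup>2) * (q\<^sup>2) ^ k" for k x
  proof -
    have "((killed_step \<Omega> h) ^^ k) u x * ((killed_step \<Omega> h) ^^ k) u x
        \<le> M * (q\<^sup>2) ^ k * (\<psi> ((1/2) *\<^sub>R (x - x)))\<^sup>2"
      by (rule conjunct2, rule killed_iterates_bound[OF q])
         (fact step diam init M | simp add: u_def)+
    then show ?thesis by (simp add: power2_eq_square mult_ac)
  qed
  have "(LBINT x. u x * neighbour_sum h u x) \<le> q * (LBINT x. (u x)\<^sup>2)"
    by (rule killed_step_quadratic_form_le[OF \<Omega> squ u0 q bound])
  then have "(2 * real N - q) * (LBINT x. (u x)\<^sup>2) \<le> (\<Sum>b\<in>Basis. LBINT x. (u (x + h *\<^sub>R b) - u x)\<^sup>2)"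
    unfolding Dirichlet_form_neighbour_sum[OF squ] N by (simp add: left_diff_distrib)
  also have "\<dots> \<le> (\<Sum>b\<in>Basis. LBINT x. (\<phi> (x + h *\<^sub>R b) - \<phi> x)\<^sup>2)"
  proof (intro sum_mono integral_mono)
    fix b :: 'a
    note sq = sqint_test_function(1)[OF \<phi>]
    show "integrable lborel (\<lambda>x. (u (x + h *\<^sub>R b) - u x)\<^sup>2)" by (rule sqint_real_diff[OF sqint_translate[OF squ] squ])
    show "integrable lborel (\<lambda>x. (\<phi> (x + h *\<^sub>R b) - \<phi> x)\<^sup>2)" by (rule sqint_real_diff[OF sqint_translate[OF sq] sq])
    fix x show "(u (x + h *\<^sub>R b) - u x)\<^sup>2 \<le> (\<phi> (x + h *\<^sub>R b) - \<phi> x)\<^sup>2"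
      unfolding u_def abs_le_square_iff[symmetric] by simp
  qed
  also have "(LBINT x. (u x)\<^sup>2) = mass \<phi>" by (simp add: u_def mass_def)
  finally show ?case by (simp add: q_def)
qed

theorem poincare_diameter:
  fixes \<Omega> :: "'a::euclidean_space set"
  assumes N: "N = DIM('a)" and pos: "\<forall>s\<in>{0..1}. D 0 s > 0"
    and \<Omega>: "open \<Omega>" "bounded \<Omega>" and diam: "\<And>x y. x \<in> \<Omega> \<Longrightarrow> y \<in> \<Omega> \<Longrightarrow> dist x y \<le> 2"
  shows "poincare \<Omega> \<mu>"
  unfolding poincare_iff
proof
  fix \<phi> assume \<phi>: "\<phi> \<in> test_functions \<Omega>"
  define t where "t n = 1 / real (Suc n)" for n
  have t0: "t \<longlonglongrightarrow> 0" using LIMSEQ_Suc[OF lim_1_over_n] by (simp add: t_def[abs_def])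
  have tpos: "t n > 0" for n by (simp add: t_def)
  then have tne: "t n \<noteq> 0" for n by (metis less_irrefl)
  have t_right: "filterlim t (at_right 0) sequentially"
    using t0 tpos tne by (simp add: filterlim_at)
  have lim: "(\<lambda>n. \<Sum>b\<in>Basis. LBINT x. ((\<phi> (x + t n *\<^sub>R b) - \<phi> x) / t n)\<^sup>2) \<longlonglongrightarrow> energy \<phi>"
  proof -
    have "(\<lambda>n. \<Sum>b\<in>Basis. LBINT x. ((\<phi> (x + t n *\<^sub>R b) - \<phi> x) / t n)\<^sup>2)
        \<longlonglongrightarrow> (\<Sum>b\<in>Basis. LBINT x. (gradient \<phi> x \<bullet> b)\<^sup>2)"
      by (intro tendsto_sum difference_quotient_integral[OF \<phi> t0]) (auto simp: t_def)
    also have "(\<Sum>b\<in>Basis. LBINT x. (gradient \<phi> x \<bullet> b)\<^sup>2) = (LBINT x. (\<Sum>b\<in>Basis. (gradient \<phi> x \<bullet> b)\<^sup>2))"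
    proof (rule Bochner_Integration.integral_sum[symmetric])
      fix b :: 'a
      obtain K where "compact K" "\<And>x. x \<notin> K \<Longrightarrow> gradient \<phi> x = 0" by (rule test_functionsE[OF \<phi>]) blast
      then show "integrable lborel (\<lambda>x. (gradient \<phi> x \<bullet> b)\<^sup>2)"
        by (intro integrable_compact_support[where K = K] continuous_intros gradient_continuous[OF \<phi>]) auto
    qed
    also have "(\<lambda>x. \<Sum>b\<in>Basis. (gradient \<phi> x \<bullet> b)\<^sup>2) = (\<lambda>x. (norm (gradient \<phi> x))\<^sup>2)"
      unfolding power2_norm_eq_inner by (subst (2) euclidean_inner) (simp add: power2_eq_square)
    finally show ?thesis by (simp add: energy_def)
  qed
  have "(\<mu> - \<epsilon>) * mass \<phi> \<le> energy \<phi>" if \<epsilon>: "\<epsilon> > 0" for \<epsilon>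
  proof (rule tendsto_lowerbound[OF lim])
    have "\<forall>\<^sub>F n in sequentially. (\<mu> - \<epsilon>) * (t n)\<^sup>2 * mass \<phi> \<le> (\<Sum>b\<in>Basis. LBINT x. (\<phi> (x + t n *\<^sub>R b) - \<phi> x)\<^sup>2)"
      by (rule eventually_compose_filterlim[OF discrete_poincare[OF N pos \<epsilon> \<Omega> diam \<phi>] t_right])
    then show "\<forall>\<^sub>F n in sequentially. (\<mu> - \<epsilon>) * mass \<phi> \<le> (\<Sum>b\<in>Basis. LBINT x. ((\<phi> (x + t n *\<^sub>R b) - \<phi> x) / t n)\<^sup>2)"
    proof eventually_elim
      case (elim n)
      have "(\<mu> - \<epsilon>) * mass \<phi> \<le> (\<Sum>b\<in>Basis. LBINT x. (\<phi> (x + t n *\<^sub>R b) - \<phi> x)\<^sup>2) / (t n)\<^sup>2"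
        using elim tpos[of n] by (subst pos_le_divide_eq) (auto simp: mult_ac)
      then show ?case by (simp add: power_divide sum_divide_distrib)
    qed
  qed simp
  then have le: "\<mu> * mass \<phi> \<le> energy \<phi> + \<epsilon> * mass \<phi>" if "\<epsilon> > 0" for \<epsilon>
    using that by (fastforce simp: left_diff_distrib)
  show "\<mu> * mass \<phi> \<le> energy \<phi>"
  proof (rule field_le_epsilon)
    fix e :: real assume e: "e > 0"
    define \<epsilon> where "\<epsilon> = e / (mass \<phi> + 1)"
    have m1: "mass \<phi> + 1 > 0" using mass_nonneg[of \<phi>] by linarith
    have "\<epsilon> > 0" using e m1 by (simp add: \<epsilon>_def)
    moreover have "\<epsilon> * mass \<phi> \<le> \<epsilon> * (mass \<phi> + 1)" using \<open>\<epsilon> > 0\<close> by (intro mult_left_mono) auto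
    moreover have "\<epsilon> * (mass \<phi> + 1) = e" using m1 by (simp add: \<epsilon>_def)
    ultimately show "\<mu> * mass \<phi> \<le> energy \<phi> + e" using le[of \<epsilon>] by linarith
  qed
qed

end

section \<open>The unit ball\<close>

text \<open>For positive \<open>t\<close> this is t exp(-\<epsilon>/t), a smooth substitute for the
  positive part. Its derivative (1 + \<epsilon>/t) exp(-\<epsilon>/t) lies in [0,1] because 1 + x
  \<le> exp x.\<close>

definition cutoff :: "real \<Rightarrow> real \<Rightarrow> real" where
  "cutoff \<epsilon> t = t * flat 1 (t / \<epsilon>)"

definition cutoff' :: "real \<Rightarrow> real \<Rightarrow> real" where
  "cutoff' \<epsilon> t = flat 1 (t / \<epsilon>) + t * (flat [:0, 0, 1:] (t / \<epsilon>) / \<epsilon>)"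

lemma C_k_cutoff: "C_k k (cutoff \<epsilon>)"
proof -
  have "C_k k (\<lambda>t. t / \<epsilon>)" using C_k_linear[of "\<lambda>t. t / \<epsilon>"] bounded_linear_divide by blast
  then show ?thesis unfolding cutoff_def[abs_def]
    by (intro C_k_mult C_k_compose[OF C_k_flat] C_k_linear[OF bounded_linear_ident])
qed

lemma cutoff_has_derivative: "\<epsilon> > 0 \<Longrightarrow> (cutoff \<epsilon> has_real_derivative cutoff' \<epsilon> t) (at t)"
  unfolding cutoff_def[abs_def] cutoff'_def
  by (auto intro!: derivative_eq_intros DERIV_chain2[OF flat_has_derivative] simp: pderiv_1)

lemma cutoff_zero: "\<epsilon> > 0 \<Longrightarrow> t \<le> 0 \<Longrightarrow> cutoff \<epsilon> t = 0 \<and> cutoff' \<epsilon> t = 0"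
  by (auto simp: cutoff_def cutoff'_def flat_def zero_less_divide_iff)

lemma cutoff'_bounds:
  assumes "\<epsilon> > 0"
  shows "0 \<le> cutoff' \<epsilon> t" "cutoff' \<epsilon> t \<le> 1"
proof -
  have "0 \<le> cutoff' \<epsilon> t \<and> cutoff' \<epsilon> t \<le> 1"
  proof (cases "t > 0")
    case True
    have "cutoff' \<epsilon> t = (1 + \<epsilon> / t) * exp (- (\<epsilon> / t))"
      using assms True by (simp add: cutoff'_def flat_def field_simps)
    moreover have "(1 + \<epsilon> / t) * exp (- (\<epsilon> / t)) \<le> exp (\<epsilon> / t) * exp (- (\<epsilon> / t))"
      by (intro mult_right_mono) auto
    ultimately show ?thesis using assms True by (simp add: exp_minus)
  qed (use cutoff_zero[OF assms, of t] in auto)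
  then show "0 \<le> cutoff' \<epsilon> t" "cutoff' \<epsilon> t \<le> 1" by auto
qed

lemma cutoff_bounds:
  assumes "\<epsilon> > 0" "0 \<le> t"
  shows "0 \<le> cutoff \<epsilon> t" "cutoff \<epsilon> t \<le> t"
  using assms by (auto simp: cutoff_def flat_def mult_left_le)

lemma cutoff_tendsto:
  assumes e: "e \<longlonglongrightarrow> 0" "\<And>n::nat. e n > 0" and t: "t > 0"
  shows "(\<lambda>n. cutoff (e n) (t - e n)) \<longlonglongrightarrow> t"
proof (rule Lim_transform_eventually)
  have "(\<lambda>n. (t - e n) * exp (- (e n / (t - e n)))) \<longlonglongrightarrow> (t - 0) * exp (- (0 / (t - 0)))"
    using t by (intro tendsto_intros e(1)) auto
  then show "(\<lambda>n. (t - e n) * exp (- (e n / (t - e n)))) \<longlonglongrightarrow> t" by simp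
  have "\<forall>\<^sub>F n in sequentially. e n < t" using e(1) t by (intro order_tendstoD) auto
  then show "\<forall>\<^sub>F n in sequentially. (t - e n) * exp (- (e n / (t - e n))) = cutoff (e n) (t - e n)"
    by eventually_elim (use e(2) in \<open>simp add: cutoff_def flat_def\<close>)
qed

context radial_profile
begin

lemma C_k_D: "C_k k (D n)"
proof (induction k arbitrary: n)
  case 0
  show ?case by (simp add: D_continuous)
next
  case (Suc k)
  show ?case by (rule C_k_real_SucI[OF deriv Suc])
qed

text \<open>Subtracting \<epsilon> makes the truncation vanish already before the zero
  \<open>s0\<close>, so it is smooth and compactly supported in the open ball. Setting it to 0
  beyond \<open>s0\<close> discards later intervals where the profile is positive again.\<close>

definition profile_cut :: "real \<Rightarrow> real \<Rightarrow> real \<Rightarrow> real" where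
  "profile_cut s0 \<epsilon> s = (if s < s0 then cutoff \<epsilon> (D 0 s - \<epsilon>) else 0)"

definition profile_cut' :: "real \<Rightarrow> real \<Rightarrow> real \<Rightarrow> real" where
  "profile_cut' s0 \<epsilon> s = (if s < s0 then cutoff' \<epsilon> (D 0 s - \<epsilon>) * D 1 s else 0)"

lemma profile_cut_vanishes_near:
  assumes "D 0 s0 = 0" "\<epsilon> > 0"
  obtains s1 where "s1 < s0" "\<And>s. s1 < s \<Longrightarrow> profile_cut s0 \<epsilon> s = 0" "\<And>s. s1 < s \<Longrightarrow> profile_cut' s0 \<epsilon> s = 0"
proof -
  have "isCont (D 0) s0" using deriv DERIV_isCont by blast
  then have "\<forall>\<^sub>F s in at s0. D 0 s < \<epsilon>"
    using assms unfolding isCont_def by (intro order_tendstoD) auto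
  then obtain d where d: "d > 0" "\<And>s. s \<noteq> s0 \<Longrightarrow> dist s s0 < d \<Longrightarrow> D 0 s < \<epsilon>"
    by (auto simp: eventually_at)
  have "cutoff \<epsilon> (D 0 s - \<epsilon>) = 0 \<and> cutoff' \<epsilon> (D 0 s - \<epsilon>) = 0" if "s0 - d < s" "s < s0" for s
    using d(2)[of s] that by (intro cutoff_zero assms) (auto simp: dist_real_def)
  then show ?thesis
    by (intro that[of "s0 - d"]) (use d in \<open>auto simp: profile_cut_def profile_cut'_def\<close>)
qed

lemma C_k_profile_cut:
  assumes "D 0 s0 = 0" "\<epsilon> > 0"
  shows "C_k k (profile_cut s0 \<epsilon>)"
proof -
  obtain s1 where s1: "s1 < s0" "\<And>s. s1 < s \<Longrightarrow> profile_cut s0 \<epsilon> s = 0"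
    by (rule profile_cut_vanishes_near[OF assms]) blast
  have "C_k k (\<lambda>s. D 0 s + - \<epsilon>)" by (intro C_k_add C_k_const C_k_D)
  then have C: "C_k k (\<lambda>s. cutoff \<epsilon> (D 0 s - \<epsilon>))" using C_k_compose[OF C_k_cutoff] by simp
  show ?thesis
    by (rule C_k_local[OF _ _ _ C, of "{..<s0}" "{s1<..}" "\<lambda>_. 0"]) (use s1 C_k_const in \<open>auto simp: profile_cut_def\<close>)
qed

lemma profile_cut_has_derivative:
  assumes "D 0 s0 = 0" "\<epsilon> > 0"
  shows "(profile_cut s0 \<epsilon> has_real_derivative profile_cut' s0 \<epsilon> s) (at s)"
proof (cases "s < s0")
  case True
  have "((\<lambda>s. cutoff \<epsilon> (D 0 s - \<epsilon>)) has_real_derivative cutoff' \<epsilon> (D 0 s - \<epsilon>) * D 1 s) (at s)"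
    by (auto intro!: derivative_eq_intros DERIV_chain2[OF cutoff_has_derivative[OF assms(2)]] deriv[of 0, simplified])
  then have "(profile_cut s0 \<epsilon> has_real_derivative cutoff' \<epsilon> (D 0 s - \<epsilon>) * D 1 s) (at s)"
    by (rule has_field_derivative_transform_within_open[of _ _ _ "{..<s0}"]) (use True in \<open>auto simp: profile_cut_def\<close>)
  then show ?thesis using True by (simp add: profile_cut'_def)
next
  case False
  obtain s1 where s1: "s1 < s0" "\<And>s. s1 < s \<Longrightarrow> profile_cut s0 \<epsilon> s = 0"
    by (rule profile_cut_vanishes_near[OF assms]) blast
  have "(profile_cut s0 \<epsilon> has_real_derivative 0) (at s)"
    by (rule has_field_derivative_transform_within_open[of "\<lambda>_. 0" _ _ "{s1<..}"]) (use False s1 in auto)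
  then show ?thesis using False by (simp add: profile_cut'_def)
qed

lemma radial_has_derivative:
  assumes "(F has_real_derivative F') (at ((norm (x - c))\<^sup>2))"
  shows "((\<lambda>x. F ((norm (x - c))\<^sup>2)) has_derivative (\<lambda>v. F' * (2 * ((x - c) \<bullet> v)))) (at (x::'a::euclidean_space))"
proof -
  have "((\<lambda>x. (x - c) \<bullet> (x - c)) has_derivative (\<lambda>v. 2 * ((x - c) \<bullet> v))) (at x)"
    by (auto intro!: derivative_eq_intros simp: inner_commute)
  then have "((\<lambda>x. (norm (x - c))\<^sup>2) has_derivative (\<lambda>v. 2 * ((x - c) \<bullet> v))) (at x)"
    by (simp add: power2_norm_eq_inner)
  then show ?thesis
    using assms unfolding has_field_derivative_def by (rule has_derivative_compose)
qed

lemma radial_gradient: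
  assumes "(F has_real_derivative F') (at ((norm (x - c))\<^sup>2))"
  shows "gradient (\<lambda>x. F ((norm (x - c))\<^sup>2)) (x::'a::euclidean_space) = (2 * F') *\<^sub>R (x - c)"
  using radial_has_derivative[OF assms] by (intro gradient_eqI) (simp add: mult_ac)

lemma profile_cut_test_function:
  fixes c :: "'a::euclidean_space"
  assumes s0: "D 0 s0 = 0" "s0 \<le> 1" and \<epsilon>: "\<epsilon> > 0"
  shows "(\<lambda>x. profile_cut s0 \<epsilon> ((norm (x - c))\<^sup>2)) \<in> test_functions (ball c 1)"
proof -
  obtain s1 where s1: "s1 < s0" "\<And>s. s1 < s \<Longrightarrow> profile_cut s0 \<epsilon> s = 0"
    by (rule profile_cut_vanishes_near[OF s0(1) \<epsilon>]) blast
  let ?K = "{x::'a. (norm (x - c))\<^sup>2 \<le> s1}"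
  have sub: "?K \<subseteq> ball c 1"
  proof
    fix x assume "x \<in> ?K"
    then have "(norm (x - c))\<^sup>2 < 1\<^sup>2" using s1(1) s0(2) by simp
    then have "norm (x - c) < 1" by (rule power_less_imp_less_base) simp
    then show "x \<in> ball c 1" by (simp add: dist_norm norm_minus_commute)
  qed
  have "closed ?K" by (intro closed_Collect_le continuous_intros)
  moreover have "bounded ?K" using sub bounded_ball bounded_subset by blast
  ultimately have cpt: "compact ?K" by (simp add: compact_eq_bounded_closed)
  show ?thesis
    by (rule test_functionsI[OF _ cpt sub])
       (use s1 in \<open>auto intro: C_k_compose[OF C_k_profile_cut[OF s0(1) \<epsilon>] C_k_norm_squared]\<close>)
qed

text \<open>\<open>g b\<close> is the \<open>b\<close>-component of the gradient of \<psi> centred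
  at \<open>c\<close>; the components are integrated by parts one at a time, and \<open>ode\<close>
  evaluates the divergence.\<close>

lemma Green_radial:
  fixes c :: "'a::euclidean_space"
  assumes N: "N = DIM('a)" and \<phi>: "\<phi> \<in> test_functions \<Omega>"
  shows "(LBINT x. gradient \<phi> x \<bullet> ((2 * D 1 ((norm (x - c))\<^sup>2)) *\<^sub>R (x - c)))
    = \<mu> * (LBINT x. \<phi> x * D 0 ((norm (x - c))\<^sup>2))"
proof -
  define g where "g b x = 2 * D 1 ((norm (x - c))\<^sup>2) * ((x - c) \<bullet> b)" for b x
  have C_g: "C_k k (g b)" for k b
  proof -
    have "C_k k (\<lambda>x. (2 * D 1 ((norm (x - c))\<^sup>2)) * (x \<bullet> b + - (c \<bullet> b)))"
      by (intro C_k_mult C_k_add C_k_const C_k_compose[OF C_k_D] C_k_norm_squared C_k_linear bounded_linear_inner_left)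
    then show ?thesis by (simp add: g_def[abs_def] inner_diff_left)
  qed
  have grad_g: "gradient (g b) x \<bullet> b = 4 * D 2 ((norm (x - c))\<^sup>2) * ((x - c) \<bullet> b)\<^sup>2 + 2 * D 1 ((norm (x - c))\<^sup>2)"
    if b: "b \<in> Basis" for b x
  proof -
    let ?s = "(norm (x - c))\<^sup>2"
    have "(D 1 has_real_derivative D 2 ?s) (at ?s)" using deriv[of 1] by (simp add: numeral_2_eq_2)
    then have "((\<lambda>x. D 1 ((norm (x - c))\<^sup>2)) has_derivative (\<lambda>v. D 2 ?s * (2 * ((x - c) \<bullet> v)))) (at x)"
      by (rule radial_has_derivative)
    then have "(g b has_derivative (\<lambda>v. 2 * D 1 ?s * (v \<bullet> b) + 2 * (D 2 ?s * (2 * ((x - c) \<bullet> v))) * ((x - c) \<bullet> b))) (at x)"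
      unfolding g_def[abs_def] by (auto intro!: derivative_eq_intros)
    then have "gradient (g b) x = (2 * D 1 ?s) *\<^sub>R b + (4 * D 2 ?s * ((x - c) \<bullet> b)) *\<^sub>R (x - c)"
      by (intro gradient_eqI, elim has_derivative_eq_rhs)
         (rule ext, simp add: inner_add_left, simp add: inner_commute mult_ac)
    then show ?thesis using b by (simp add: inner_add_left power2_eq_square mult_ac)
  qed
  obtain K where K: "compact K" "\<And>x. x \<notin> K \<Longrightarrow> \<phi> x = 0" "\<And>x. x \<notin> K \<Longrightarrow> gradient \<phi> x = 0"
    by (rule test_functionsE[OF \<phi>]) blast
  have cont: "continuous_on UNIV (g b)" "continuous_on UNIV (gradient (g b))" for b
    using C_g[of 0 b] C_g[of "Suc 0" b] by (auto simp: gradient_def[abs_def] intro!: continuous_intros)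
  have int: "integrable lborel (\<lambda>x. (gradient \<phi> x \<bullet> b) * g b x)" "integrable lborel (\<lambda>x. \<phi> x * (gradient (g b) x \<bullet> b))" for b
    using K by (auto intro!: integrable_compact_support[OF _ K(1)] continuous_intros cont
      gradient_continuous[OF \<phi>] test_functions_continuous[OF \<phi>])
  have "(LBINT x. gradient \<phi> x \<bullet> ((2 * D 1 ((norm (x - c))\<^sup>2)) *\<^sub>R (x - c)))
    = (LBINT x. (\<Sum>b\<in>Basis. (gradient \<phi> x \<bullet> b) * g b x))"
    by (subst euclidean_inner) (simp add: g_def mult_ac)
  also have "\<dots> = (\<Sum>b\<in>Basis. LBINT x. (gradient \<phi> x \<bullet> b) * g b x)"
    by (rule Bochner_Integration.integral_sum) (rule int)
  also have "\<dots> = (\<Sum>b\<in>Basis. - (LBINT x. \<phi> x * (gradient (g b) x \<bullet> b)))"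
    using integration_by_parts[OF \<phi> C_g] by simp
  also have "\<dots> = - (LBINT x. (\<Sum>b\<in>Basis. \<phi> x * (gradient (g b) x \<bullet> b)))"
    by (simp add: sum_negf Bochner_Integration.integral_sum[OF int(2)])
  also have "(\<lambda>x. \<Sum>b\<in>Basis. \<phi> x * (gradient (g b) x \<bullet> b)) = (\<lambda>x. - \<mu> * (\<phi> x * D 0 ((norm (x - c))\<^sup>2)))"
  proof
    fix x
    let ?s = "(norm (x - c))\<^sup>2"
    have s: "(\<Sum>b\<in>Basis. ((x - c) \<bullet> b)\<^sup>2) = ?s"
      unfolding power2_norm_eq_inner by (subst euclidean_inner) (simp add: power2_eq_square)
    have "(\<Sum>b\<in>Basis. \<phi> x * (gradient (g b) x \<bullet> b))
      = \<phi> x * (\<Sum>b\<in>Basis. 4 * D 2 ?s * ((x - c) \<bullet> b)\<^sup>2 + 2 * D 1 ?s)"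
      by (simp add: grad_g sum_distrib_left)
    also have "\<dots> = \<phi> x * (4 * D 2 ?s * (\<Sum>b\<in>Basis. ((x - c) \<bullet> b)\<^sup>2) + 2 * real N * D 1 ?s)"
      by (simp add: sum.distrib sum_distrib_left N)
    also have "\<dots> = \<phi> x * (- \<mu> * D 0 ?s)"
      using ode[of ?s] unfolding s by (simp add: mult_ac)
    finally show "(\<Sum>b\<in>Basis. \<phi> x * (gradient (g b) x \<bullet> b)) = - \<mu> * (\<phi> x * D 0 ?s)" by simp
  qed
  finally show ?thesis by simp
qed

text \<open>Where it is nonzero, the gradient of the truncation is that of \<psi> times a factor in
  [0,1]. Its square is therefore at most its product with the gradient of \<psi>, to which Green's
  identity applies.\<close>

lemma profile_cut_energy_le:
  fixes c :: "'a::euclidean_space"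
  assumes N: "N = DIM('a)" and s0: "D 0 s0 = 0" "s0 \<le> 1" and \<epsilon>: "\<epsilon> > 0"
  shows "energy (\<lambda>x. profile_cut s0 \<epsilon> ((norm (x - c))\<^sup>2))
    \<le> \<mu> * (LBINT x. profile_cut s0 \<epsilon> ((norm (x - c))\<^sup>2) * D 0 ((norm (x - c))\<^sup>2))"
proof -
  define \<phi> where "\<phi> x = profile_cut s0 \<epsilon> ((norm (x - c))\<^sup>2)" for x
  have \<phi>: "\<phi> \<in> test_functions (ball c 1)"
    unfolding \<phi>_def[abs_def] by (rule profile_cut_test_function[OF s0 \<epsilon>])
  have grad: "gradient \<phi> x = (2 * profile_cut' s0 \<epsilon> ((norm (x - c))\<^sup>2)) *\<^sub>R (x - c)" for x
    unfolding \<phi>_def[abs_def] by (rule radial_gradient[OF profile_cut_has_derivative[OF s0(1) \<epsilon>]])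
  obtain K where K: "compact K" "\<And>x. x \<notin> K \<Longrightarrow> gradient \<phi> x = 0"
    by (rule test_functionsE[OF \<phi>]) blast
  have "energy \<phi> \<le> (LBINT x. gradient \<phi> x \<bullet> ((2 * D 1 ((norm (x - c))\<^sup>2)) *\<^sub>R (x - c)))"
    unfolding energy_def
  proof (rule integral_mono)
    show "integrable lborel (\<lambda>x. (norm (gradient \<phi> x))\<^sup>2)"
      using sqint_test_function(2)[OF \<phi>] by (simp add: sqint_def)
    have "continuous_on UNIV (\<lambda>x. D 1 ((norm (x - c))\<^sup>2))"
      by (rule continuous_on_compose2[OF D_continuous[of UNIV 1]]) (auto intro!: continuous_intros)
    then show "integrable lborel (\<lambda>x. gradient \<phi> x \<bullet> ((2 * D 1 ((norm (x - c))\<^sup>2)) *\<^sub>R (x - c)))"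
      using K(2) by (intro integrable_compact_support[OF _ K(1)] continuous_intros gradient_continuous[OF \<phi>]) auto
    fix x
    let ?s = "(norm (x - c))\<^sup>2"
    have "(profile_cut' s0 \<epsilon> ?s)\<^sup>2 \<le> profile_cut' s0 \<epsilon> ?s * D 1 ?s"
    proof (cases "?s < s0")
      case True
      let ?k = "cutoff' \<epsilon> (D 0 ?s - \<epsilon>)"
      have "?k * ?k \<le> ?k" using cutoff'_bounds[OF \<epsilon>, of "D 0 ?s - \<epsilon>"] by (simp add: mult_left_le)
      then have "(?k * ?k) * (D 1 ?s)\<^sup>2 \<le> ?k * (D 1 ?s)\<^sup>2" by (rule mult_right_mono) simp
      then show ?thesis using True by (simp add: profile_cut'_def power2_eq_square mult_ac)
    qed (simp add: profile_cut'_def)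
    then have "(profile_cut' s0 \<epsilon> ?s)\<^sup>2 * (4 * ?s) \<le> profile_cut' s0 \<epsilon> ?s * D 1 ?s * (4 * ?s)"
      by (rule mult_right_mono) simp
    then show "(norm (gradient \<phi> x))\<^sup>2 \<le> gradient \<phi> x \<bullet> ((2 * D 1 ?s) *\<^sub>R (x - c))"
      by (simp add: grad power_mult_distrib power2_norm_eq_inner[symmetric] mult_ac)
  qed
  also have "\<dots> = \<mu> * (LBINT x. \<phi> x * D 0 ((norm (x - c))\<^sup>2))"
    by (rule Green_radial[OF N \<phi>])
  finally show ?thesis by (simp only: \<phi>_def[abs_def])
qed

text \<open>Along the truncations both sides of the inequality tend to multiples of the same
  positive number, the squared mass of \<psi> cut at its first zero. Limits are taken only in these
  integrals, not in the gradients.\<close>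

theorem poincare_ball_le:
  fixes c :: "'a::euclidean_space"
  assumes N: "N = DIM('a)" and s0: "D 0 s0 = 0" "0 < s0" "s0 \<le> 1" and pos: "\<And>s. 0 \<le> s \<Longrightarrow> s < s0 \<Longrightarrow> 0 < D 0 s"
    and m: "poincare (ball c 1) m"
  shows "m \<le> \<mu>"
proof -
  define w where "w x = (if (norm (x - c))\<^sup>2 < s0 then D 0 ((norm (x - c))\<^sup>2) else 0)" for x
  define e where "e n = 1 / real (Suc n)" for n
  define \<phi> where "\<phi> n x = profile_cut s0 (e n) ((norm (x - c))\<^sup>2)" for n x
  have e0: "e \<longlonglongrightarrow> 0" using LIMSEQ_Suc[OF lim_1_over_n] by (simp add: e_def[abs_def])
  have e: "e n > 0" for n by (simp add: e_def)
  have \<phi>: "\<phi> n \<in> test_functions (ball c 1)" for n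
    unfolding \<phi>_def[abs_def] by (rule profile_cut_test_function[OF s0(1,3) e])
  have lim: "(\<lambda>n. \<phi> n x) \<longlonglongrightarrow> w x" for x
  proof (cases "(norm (x - c))\<^sup>2 < s0")
    case True
    then show ?thesis using cutoff_tendsto[OF e0 e pos[of "(norm (x - c))\<^sup>2"]] by (simp add: \<phi>_def profile_cut_def w_def)
  qed (simp add: \<phi>_def profile_cut_def w_def)
  obtain B where B: "B \<ge> 0" "\<And>s. -1 \<le> s \<Longrightarrow> s \<le> 9 \<Longrightarrow> \<bar>D 0 s\<bar> \<le> B" by (rule D_bounded[of 0]) blast
  have w_nonneg: "0 \<le> w x" for x using pos[of "(norm (x - c))\<^sup>2"] by (simp add: w_def less_imp_le)
  have bounds: "0 \<le> \<phi> n x" "\<phi> n x \<le> w x" for n x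
  proof -
    let ?s = "(norm (x - c))\<^sup>2"
    have "0 \<le> \<phi> n x \<and> \<phi> n x \<le> w x"
    proof (cases "?s < s0")
      case True
      show ?thesis
      proof (cases "D 0 ?s - e n \<le> 0")
        case True
        then show ?thesis using cutoff_zero[OF e True] w_nonneg[of x] by (simp add: \<phi>_def profile_cut_def)
      next
        case False
        then show ?thesis using cutoff_bounds[OF e[of n], of "D 0 ?s - e n"] \<open>?s < s0\<close> e[of n]
          by (simp add: \<phi>_def profile_cut_def w_def)
      qed
    qed (simp add: \<phi>_def profile_cut_def w_def)
    then show "0 \<le> \<phi> n x" "\<phi> n x \<le> w x" by auto
  qed
  have w_le: "w x \<le> B * indicator (cball c 1) x" for x
  proof (cases "(norm (x - c))\<^sup>2 < s0")
    case True
    then have "(norm (x - c))\<^sup>2 \<le> 1\<^sup>2" using s0(3) by simp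
    then have "norm (x - c) \<le> 1" by (rule power2_le_imp_le) simp
    then have "x \<in> cball c 1" by (simp add: dist_norm norm_minus_commute)
    moreover have "D 0 ((norm (x - c))\<^sup>2) \<le> B"
    proof -
      have "-1 \<le> (norm (x - c))\<^sup>2" by (rule order_trans[of _ 0]) auto
      then show ?thesis using B(2)[of "(norm (x - c))\<^sup>2"] True s0(3) by simp
    qed
    ultimately show ?thesis using True by (simp add: w_def)
  qed (use B(1) in \<open>simp add: w_def\<close>)
  have [measurable]: "\<phi> n \<in> borel_measurable borel" for n by (rule test_measurable(1)[OF \<phi>])
  have [measurable]: "w \<in> borel_measurable borel"
    by (rule borel_measurable_LIMSEQ_metric[OF _ lim]) simp
  have dom: "integrable lborel (\<lambda>x. B\<^sup>2 * indicator (cball c 1) x)"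
    by (intro integrable_mult_right integrable_real_indicator emeasure_bounded_finite) auto
  have w2: "w x * w x \<le> B\<^sup>2 * indicator (cball c 1) x" for x
    using mult_mono[OF w_le[of x] w_le[of x]] B(1) w_nonneg[of x] by (auto simp: power2_eq_square indicator_def split: if_splits)
  have "(\<lambda>n. LBINT x. \<phi> n x * \<phi> n x) \<longlonglongrightarrow> (LBINT x. w x * w x)"
  proof (rule integral_dominated_convergence[OF _ _ dom])
    show "AE x in lborel. (\<lambda>n. \<phi> n x * \<phi> n x) \<longlonglongrightarrow> w x * w x" by (intro AE_I2 tendsto_intros lim)
    show "AE x in lborel. norm (\<phi> n x * \<phi> n x) \<le> B\<^sup>2 * indicator (cball c 1) x" for n
      using order_trans[OF mult_mono[OF bounds(2) bounds(2) w_nonneg bounds(1)] w2] bounds(1)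
      by (intro AE_I2) simp
  qed auto
  then have l1: "(\<lambda>n. m * (LBINT x. \<phi> n x * \<phi> n x)) \<longlonglongrightarrow> m * (LBINT x. w x * w x)"
    by (intro tendsto_intros)
  have "(\<lambda>n. LBINT x. \<phi> n x * w x) \<longlonglongrightarrow> (LBINT x. w x * w x)"
  proof (rule integral_dominated_convergence[OF _ _ dom])
    show "AE x in lborel. (\<lambda>n. \<phi> n x * w x) \<longlonglongrightarrow> w x * w x" by (intro AE_I2 tendsto_intros lim)
    show "AE x in lborel. norm (\<phi> n x * w x) \<le> B\<^sup>2 * indicator (cball c 1) x" for n
      using order_trans[OF mult_right_mono[OF bounds(2) w_nonneg] w2] bounds(1) w_nonneg
      by (intro AE_I2) simp
  qed auto
  then have l2: "(\<lambda>n. \<mu> * (LBINT x. \<phi> n x * w x)) \<longlonglongrightarrow> \<mu> * (LBINT x. w x * w x)"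
    by (intro tendsto_intros)
  have "m * (LBINT x. w x * w x) \<le> \<mu> * (LBINT x. w x * w x)"
  proof (rule LIMSEQ_le[OF l1 l2])
    have "m * (LBINT x. \<phi> n x * \<phi> n x) \<le> \<mu> * (LBINT x. \<phi> n x * w x)" for n
    proof -
      have "m * (LBINT x. \<phi> n x * \<phi> n x) = m * mass (\<phi> n)" by (simp add: mass_def power2_eq_square)
      also have "\<dots> \<le> energy (\<phi> n)" using m \<phi> by (simp add: poincare_iff)
      also have "\<dots> \<le> \<mu> * (LBINT x. \<phi> n x * D 0 ((norm (x - c))\<^sup>2))"
        unfolding \<phi>_def[abs_def] by (rule profile_cut_energy_le[OF N s0(1,3) e])
      also have "(\<lambda>x. \<phi> n x * D 0 ((norm (x - c))\<^sup>2)) = (\<lambda>x. \<phi> n x * w x)"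
        by (auto simp: \<phi>_def profile_cut_def w_def)
      finally show ?thesis .
    qed
    then show "\<exists>k. \<forall>n\<ge>k. m * (LBINT x. \<phi> n x * \<phi> n x) \<le> \<mu> * (LBINT x. \<phi> n x * w x)" by blast
  qed
  moreover have "0 < (LBINT x. w x * w x)"
  proof (rule integral_pos_on_ball[where c = c and \<rho> = "sqrt s0"])
    show "integrable lborel (\<lambda>x. w x * w x)"
      by (rule Bochner_Integration.integrable_bound[OF dom]) (use w2 in \<open>auto intro: order_trans[OF _ abs_ge_self]\<close>)
    show "0 < sqrt s0" using s0 by simp
    fix x assume "x \<in> ball c (sqrt s0)"
    then have "norm (x - c) < sqrt s0" by (simp add: dist_norm norm_minus_commute)
    then have "(norm (x - c))\<^sup>2 < (sqrt s0)\<^sup>2" by (intro power_strict_mono) auto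
    then have "(norm (x - c))\<^sup>2 < s0" using s0 by simp
    then show "0 < w x * w x" using pos[of "(norm (x - c))\<^sup>2"] by (simp add: w_def)
  qed simp
  ultimately show ?thesis by (simp add: mult_le_cancel_right_pos)
qed

end

section \<open>The power series of the comparison function\<close>

text \<open>Comparing powers of s in the radial equation gives (k + 1)(4k + 2N) a_(k+1) = -\<mu>
  a_k. The solution is the hypergeometric 0F1 with parameter N/2 at -\<mu> s / 4, a normalised
  Bessel function of the radius. The variable s = |x|^2 removes the singularity at the
  origin.\<close>

primrec profile_coeff :: "real \<Rightarrow> nat \<Rightarrow> nat \<Rightarrow> real" where
  "profile_coeff \<mu> N 0 = 1"
| "profile_coeff \<mu> N (Suc k) = - \<mu> * profile_coeff \<mu> N k / (real (Suc k) * (4 * real k + 2 * real N))"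

definition profile :: "real \<Rightarrow> nat \<Rightarrow> nat \<Rightarrow> real \<Rightarrow> real" where
  "profile \<mu> N n s = (\<Sum>k. (diffs ^^ n) (profile_coeff \<mu> N) k * s ^ k)"

text \<open>Comparison with the exponential series makes the profile entire, so its derivatives
  exist at every real \<open>s\<close>, as the locale demands.\<close>

lemma profile_coeff_bound:
  assumes "N \<ge> 1"
  shows "\<bar>profile_coeff \<mu> N k\<bar> \<le> \<bar>\<mu>\<bar> ^ k / fact k"
proof (induction k)
  case (Suc k)
  have "real (Suc k) * 1 \<le> real (Suc k) * (4 * real k + 2 * real N)"
    using assms by (intro mult_left_mono) auto
  then have den: "real (Suc k) \<le> real (Suc k) * (4 * real k + 2 * real N)" by simp
  have "\<bar>profile_coeff \<mu> N (Suc k)\<bar> = \<bar>\<mu>\<bar> * \<bar>profile_coeff \<mu> N k\<bar> / (real (Suc k) * (4 * real k + 2 * real N))"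
    using den by (simp add: abs_mult)
  also have "\<dots> \<le> \<bar>\<mu>\<bar> * (\<bar>\<mu>\<bar> ^ k / fact k) / real (Suc k)"
    using Suc den by (intro frac_le mult_left_mono) auto
  finally show ?case by (simp add: field_simps)
qed simp

lemma profile_summable:
  assumes "N \<ge> 1"
  shows "summable (\<lambda>k. (diffs ^^ n) (profile_coeff \<mu> N) k * s ^ k)"
proof (induction n arbitrary: s)
  case 0
  show ?case
  proof (rule summable_comparison_test')
    show "summable (\<lambda>k. inverse (fact k) * (\<bar>\<mu>\<bar> * \<bar>s\<bar>) ^ k)" by (rule summable_exp)
    fix k
    have "\<bar>profile_coeff \<mu> N k\<bar> * \<bar>s\<bar> ^ k \<le> \<bar>\<mu>\<bar> ^ k / fact k * \<bar>s\<bar> ^ k"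
      by (intro mult_right_mono profile_coeff_bound assms) simp
    then show "norm ((diffs ^^ 0) (profile_coeff \<mu> N) k * s ^ k) \<le> inverse (fact k) * (\<bar>\<mu>\<bar> * \<bar>s\<bar>) ^ k"
      by (simp add: abs_mult power_abs power_mult_distrib field_simps)
  qed
next
  case (Suc n)
  show ?case using termdiff_converges_all[OF Suc] by simp
qed

lemma radial_profile_profile:
  assumes "N \<ge> 1"
  shows "radial_profile (profile \<mu> N) \<mu> N"
proof
  fix n s
  show "(profile \<mu> N n has_real_derivative profile \<mu> N (Suc n) s) (at s)"
    using termdiffs_strong_converges_everywhere[OF profile_summable[OF assms], of n \<mu> s]
    by (simp add: profile_def[abs_def])
next
  fix s
  define a where "a = profile_coeff \<mu> N"
  have sum: "summable (\<lambda>k. (diffs ^^ n) a k * s ^ k)" for n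
    unfolding a_def by (rule profile_summable[OF assms])
  \<comment> \<open>The coefficients of \<open>s\<close> times the second derivative after an index
    shift; the shift loses nothing since \<open>g 0 = 0\<close>.\<close>
  define g where "g k = real (Suc k) * real k * a (Suc k) * s ^ k" for k
  have g_Suc: "g (Suc k) = s * ((diffs ^^ 2) a k * s ^ k)" for k
    by (simp add: g_def diffs_def numeral_2_eq_2 mult_ac)
  have sum_g: "summable g"
    using summable_mult[OF sum[of 2], of s] by (subst summable_Suc_iff[symmetric]) (simp only: g_Suc)
  have "s * profile \<mu> N 2 s = (\<Sum>k. g (Suc k))"
    unfolding profile_def g_Suc a_def[symmetric] by (rule suminf_mult[OF sum, symmetric])
  also have "\<dots> = (\<Sum>k. g k)"
  proof -
    have "g 0 = 0" by (simp add: g_def)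
    then show ?thesis using suminf_split_head[OF sum_g] by simp
  qed
  finally have D2: "s * profile \<mu> N 2 s = (\<Sum>k. g k)" .
  have sum1: "summable (\<lambda>k. real (Suc k) * a (Suc k) * s ^ k)"
    using sum[of 1] by (simp add: diffs_def)
  have D1: "profile \<mu> N 1 s = (\<Sum>k. real (Suc k) * a (Suc k) * s ^ k)"
    by (simp add: profile_def a_def diffs_def)
  have "4 * s * profile \<mu> N 2 s + 2 * real N * profile \<mu> N 1 s
    = 4 * (\<Sum>k. g k) + 2 * real N * (\<Sum>k. real (Suc k) * a (Suc k) * s ^ k)"
    by (simp only: D1 D2[symmetric] mult.assoc)
  also have "\<dots> = (\<Sum>k. 4 * g k + 2 * real N * (real (Suc k) * a (Suc k) * s ^ k))"
    by (simp only: suminf_add[OF summable_mult[OF sum_g] summable_mult[OF sum1], symmetric]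
        suminf_mult[OF sum_g] suminf_mult[OF sum1])
  also have "(\<lambda>k. 4 * g k + 2 * real N * (real (Suc k) * a (Suc k) * s ^ k)) = (\<lambda>k. - \<mu> * (a k * s ^ k))"
  proof
    fix k
    define d where "d = real (Suc k) * (4 * real k + 2 * real N)"
    have d: "d > 0" using assms by (simp add: d_def)
    have "4 * g k + 2 * real N * (real (Suc k) * a (Suc k) * s ^ k) = d * a (Suc k) * s ^ k"
      by (simp add: g_def d_def algebra_simps)
    also have "\<dots> = - \<mu> * (a k * s ^ k)"
    proof -
      have "a (Suc k) = - \<mu> * a k / d" unfolding a_def d_def by (rule profile_coeff.simps(2))
      then have "d * a (Suc k) = - \<mu> * a k" using d by simp
      then show ?thesis by simp
    qed
    finally show "4 * g k + 2 * real N * (real (Suc k) * a (Suc k) * s ^ k) = - \<mu> * (a k * s ^ k)" .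
  qed
  also have "(\<Sum>k. - \<mu> * (a k * s ^ k)) = - \<mu> * profile \<mu> N 0 s"
    using suminf_mult[OF sum[of 0], of "- \<mu>"] by (simp add: profile_def a_def)
  finally show "4 * s * profile \<mu> N 2 s + 2 * real N * profile \<mu> N 1 s = - \<mu> * profile \<mu> N 0 s" .
qed

lemma profile_at_0: "profile \<mu> N 0 0 = 1"
  unfolding profile_def by (subst powser_zero) simp

text \<open>A nonpositive value of the profile on [0,1] would produce a first zero there, and
  truncating at it would give m \<le> \<mu>. So \<mu> < m forces positivity, which is what the
  diameter comparison asks for.\<close>

lemma poincare_of_ball:
  fixes \<Omega> :: "'a::euclidean_space set"
  assumes \<Omega>: "open \<Omega>" "bounded \<Omega>" and diam: "\<And>x y. x \<in> \<Omega> \<Longrightarrow> y \<in> \<Omega> \<Longrightarrow> dist x y \<le> 2"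
    and \<mu>: "\<mu> < m" and m: "poincare (ball (c::'a) 1) m"
  shows "poincare \<Omega> \<mu>"
proof -
  define N where "N = DIM('a)"
  have "N \<ge> 1" using DIM_positive[where 'a = 'a] by (simp add: N_def Suc_le_eq)
  then interpret radial_profile "profile \<mu> N" \<mu> N by (rule radial_profile_profile)
  let ?f = "profile \<mu> N 0"
  have "\<forall>s\<in>{0..1}. 0 < ?f s"
  proof (rule ccontr)
    assume "\<not> (\<forall>s\<in>{0..1}. 0 < ?f s)"
    then have ne: "{s \<in> {0..1}. ?f s \<le> 0} \<noteq> {}" by force
    have "closed {s. ?f s \<le> 0}" by (intro closed_Collect_le D_continuous continuous_on_const)
    then have "compact ({0..1} \<inter> {s. ?f s \<le> 0})" by (intro compact_Int_closed) auto
    moreover have "{0..1} \<inter> {s. ?f s \<le> 0} = {s \<in> {0..1}. ?f s \<le> 0}" by auto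
    ultimately obtain s0 where s0: "s0 \<in> {0..1}" "?f s0 \<le> 0" and least: "\<And>s. s \<in> {0..1} \<Longrightarrow> ?f s \<le> 0 \<Longrightarrow> s0 \<le> s"
      using compact_attains_inf[of "{s \<in> {0..1}. ?f s \<le> 0}"] ne by auto
    have "s0 \<noteq> 0" using s0(2) profile_at_0[of \<mu> N] by auto
    have pos: "0 < ?f s" if "0 \<le> s" "s < s0" for s
      using least[of s] that s0(1) by force
    \<comment> \<open>The profile is 1 at 0 and nonpositive at \<open>s0\<close>; by minimality of
      \<open>s0\<close> the intermediate zero can only be \<open>s0\<close> itself.\<close>
    obtain s where s: "0 \<le> s" "s \<le> s0" "?f s = 0"
      using IVT2'[of ?f s0 0 0] s0 profile_at_0[of \<mu> N] D_continuous by auto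
    have "s = s0" using least[of s] s s0(1) by simp
    then have "m \<le> \<mu>"
      using s s0(1) \<open>s0 \<noteq> 0\<close> by (intro poincare_ball_le[OF N_def _ _ _ pos m]) auto
    then show False using \<mu> by simp
  qed
  then show ?thesis by (rule poincare_diameter[OF N_def _ \<Omega> diam])
qed

theorem theorem3p3:
  fixes B :: "(real ^ 'n) set" and c :: "real ^ 'n" and r :: real
  assumes "B = ball c r" and "diameter B = 2"
  shows "is_minimum {lambda1 \<Omega> | \<Omega> :: (real ^ 'n) set. \<Omega> \<in> open_sets_of_diameter 2} (lambda1 B)"
proof -
  have r: "r = 1" using assms by (simp split: if_splits)
  have B: "B \<in> open_sets_of_diameter 2"
    using assms by (simp add: open_sets_of_diameter_def)
  have "lambda1 B \<le> lambda1 \<Omega>" if \<Omega>: "\<Omega> \<in> open_sets_of_diameter 2" for \<Omega> :: "(real ^ 'n) set"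
  \<comment> \<open>The comparison holds for \<mu> strictly below \<open>lambda1 B\<close>; the
    endpoint follows by density.\<close>
  proof (rule dense_le)
    fix \<mu> assume \<mu>: "\<mu> < lambda1 B"
    have \<Omega>': "open \<Omega>" "bounded \<Omega>" "diameter \<Omega> = 2" using \<Omega> by (auto simp: open_sets_of_diameter_def)
    then have ne: "\<Omega> \<noteq> {}" by auto
    have "poincare (ball c 1) (lambda1 B)"
      using poincare_iff_le_lambda1[of "ball c 1" "lambda1 B"] assms(1) r by simp
    moreover have "dist x y \<le> 2" if "x \<in> \<Omega>" "y \<in> \<Omega>" for x y
      using diameter_bounded_bound[OF \<Omega>'(2) that] \<Omega>'(3) by simp
    ultimately have "poincare \<Omega> \<mu>"
      by (intro poincare_of_ball[OF \<Omega>'(1,2) _ \<mu>])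
    then show "\<mu> \<le> lambda1 \<Omega>" using poincare_iff_le_lambda1[OF \<Omega>'(1,2) ne] by simp
  qed
  then show ?thesis using B by (auto simp: is_minimum_def)
qed

end
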